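(* Let $G$ be a discrete group, let $\omega$ be a weight on $G$, let $1\le p<\infty$, and let $q\in(1,\infty]$ be the index conjugate to $p$ (with $d(G)/q=0$ if $q=\infty$). Then $\ell^p(G,\omega)$ admits norm-controlled inversion in $C^*_r(G)$ in each of the following cases: (i) $G=\bigcup_{i\in\mathbb{N}}G_i$ for an increasing sequence $\{G_i\}_{i\in\mathbb{N}}$ of finite subgroups, and $\omega=1+\sum_{i\ge1}n_i1_{G_{i+1}\setminus G_i}$ for an increasing sequence $\{n_i\}_{i\in\mathbb{N}}\subset[1,\infty)$, with $\omega^{-1}\in\ell^s(G)$ for some $0<s<q$; (ii) $G$ is a finitely generated group of polynomial growth and $\omega(x)=(1+\tau(x))^\beta$, $x\in G$, with $\beta>0$ and $\beta>d(G)/q$; (iii) $G$ is a finitely generated group of polynomial growth and $\omega(x)=e^{C\tau(x)^\alpha}$, $x\in G$, with $0<\alpha<1$ and $C>0$; (iv) $G$ is a finitely generated group of intermediate growth whose growth is bounded by $e^{n^{\alpha_0}}$, i.e. $|U^n|\le e^{n^{\alpha_0}}$ for all $n\in\mathbb{N}$, and $\omega(x)=e^{C\tau(x)^\alpha}$, $x\in G$, with $C>0$ and $0<\alpha_0<\alpha<1$.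
   Context: A weight on a discrete group $G$ is a function $\omega:G\to[0,\infty)$ with $\omega(e)=1$, $\omega(x)=\omega(x^{-1})$ and $\omega(xy)\le\omega(x)\omega(y)$ for all $x,y\in G$. For a finitely generated group $G$, fix a finite symmetric generating set $U$ containing $e$. With $U^n=\{u_1\cdots u_n: u_i\in U\}$, the length function is $\tau(x)=\inf\{n\in\mathbb{N}: x\in U^n\}$ for $x\ne e$, and $\tau(e)=0$. $G$ has polynomial growth if there are $K>0$ and $d\in\mathbb{N}$ with $|U^n|\le Kn^d$ for all $n\in\mathbb{N}$; the smallest such $d$ is the order of growth $d(G)$ (independent of $U$). $G$ has intermediate growth if it does not have polynomial growth but $|U^n|$ grows slower than any exponential function of $n$. $\ell^p(G,\omega)=\{f:G\to\mathbb{C} : f\omega\in\ell^p(G)\}$ with norm $\|f\|_{p,\omega}=\|f\omega\|_p$, with convolution product, involution $f^*(x)=\overline{f(x^{-1})}$ and unit $\delta_e$. "Banach algebra" for these spaces means that $\|f*g\|_{p,\omega}\le K\|f\|_{p,\omega}\|g\|_{p,\omega}$ for some constant $K>0$. $C^*_r(G)$ is the reduced $C^*$-algebra of $G$, the norm closure in $B(\ell^2(G))$ of the operators $g\mapsto f*g$, $f\in\ell^1(G)$; elements of $\ell^p(G,\omega)$ are regarded as elements of $C^*_r(G)$ in this way. For algebras $\mathcal{A}\subseteq\mathcal{B}$ with a common unit, $\mathcal{A}$ admits norm-controlled inversion in $\mathcal{B}$ if every $a\in\mathcal{A}$ invertible in $\mathcal{B}$ has $a^{-1}\in\mathcal{A}$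 and there is a function $h:[0,\infty)^2\to[0,\infty)$ such that $\|a^{-1}\|_{\mathcal{A}}\le h(\|a\|_{\mathcal{A}},\|a^{-1}\|_{\mathcal{B}})$ for all such $a$. *)

theory Defs
  imports
    "HOL-Analysis.Analysis"
    "HOL-Library.Landau_Symbols"
    "HOL-Algebra.Algebra"
    "HOL-Algebra.Algebraic_Closure_Type"
begin

section \<open>Weights and growth of groups\<close>

definition weight_on :: "('a, 'm) monoid_scheme \<Rightarrow> ('a \<Rightarrow> real) \<Rightarrow> bool" where
  "weight_on G \<omega> \<longleftrightarrow>
     (\<forall>x\<in>carrier G. 0 \<le> \<omega> x) \<and> \<omega> \<one>\<^bsub>G\<^esub> = 1 \<and>
     (\<forall>x\<in>carrier G. \<omega> (inv\<^bsub>G\<^esub> x) = \<omega> x) \<and>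
     (\<forall>x\<in>carrier G. \<forall>y\<in>carrier G. \<omega> (x \<otimes>\<^bsub>G\<^esub> y) \<le> \<omega> x * \<omega> y)"

definition symmetric_generating_set :: "('a, 'm) monoid_scheme \<Rightarrow> 'a set \<Rightarrow> bool" where
  "symmetric_generating_set G U \<longleftrightarrow>
     U \<subseteq> carrier G \<and> finite U \<and> \<one>\<^bsub>G\<^esub> \<in> U \<and> (\<forall>u\<in>U. inv\<^bsub>G\<^esub> u \<in> U) \<and>
     generate G U = carrier G"

primrec set_power :: "('a, 'm) monoid_scheme \<Rightarrow> 'a set \<Rightarrow> nat \<Rightarrow> 'a set" where
  "set_power G U 0 = {\<one>\<^bsub>G\<^esub>}"
| "set_power G U (Suc n) = set_power G U n <#>\<^bsub>G\<^esub> U"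

definition word_length :: "('a, 'm) monoid_scheme \<Rightarrow> 'a set \<Rightarrow> 'a \<Rightarrow> nat" where
  "word_length G U x = (if x = \<one>\<^bsub>G\<^esub> then 0 else Inf {n. x \<in> set_power G U n})"

text \<open>The growth bounds range over \<open>n \<ge> 1\<close>: at \<open>n = 0\<close> the bound \<open>K * n ^ d\<close> vanishes for \<open>d > 0\<close>.\<close>

definition growth_degree_le :: "('a, 'm) monoid_scheme \<Rightarrow> 'a set \<Rightarrow> nat \<Rightarrow> bool" where
  "growth_degree_le G U d \<longleftrightarrow>
     (\<exists>K>0. \<forall>n\<ge>1. real (card (set_power G U n)) \<le> K * real n ^ d)"

definition polynomial_growth :: "('a, 'm) monoid_scheme \<Rightarrow> 'a set \<Rightarrow> bool" where
  "polynomial_growth G U \<longleftrightarrow> (\<exists>d. growth_degree_le G U d)"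

definition growth_order :: "('a, 'm) monoid_scheme \<Rightarrow> 'a set \<Rightarrow> nat" where
  "growth_order G U = (LEAST d. growth_degree_le G U d)"

definition intermediate_growth :: "('a, 'm) monoid_scheme \<Rightarrow> 'a set \<Rightarrow> bool" where
  "intermediate_growth G U \<longleftrightarrow>
     \<not> polynomial_growth G U \<and>
     (\<forall>c::real. c > 1 \<longrightarrow> (\<lambda>n. real (card (set_power G U n))) \<in> o(\<lambda>n. c ^ n))"

text \<open>
  The constant \<open>K\<close> is essential. If \<open>K = 1\<close> were required, the bound at \<open>n = 1\<close> would read
  \<open>card U \<le> exp 1\<close>, so \<open>card U \<le> 2\<close>, and a group with a symmetric generating set of that kind
  has at most two elements and thus polynomial growth.
\<close>

definition growth_bounded_by_exp_powr :: "('a, 'm) monoid_scheme \<Rightarrow> 'a set \<Rightarrow> real \<Rightarrow> bool" where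
  "growth_bounded_by_exp_powr G U \<alpha> \<longleftrightarrow>
     (\<exists>K>0. \<forall>n\<ge>1. real (card (set_power G U n)) \<le> K * exp (real n powr \<alpha>))"


section \<open>Weighted sequence spaces on a group\<close>

text \<open>Functions on \<open>G\<close> are represented by functions on the whole type that vanish off the carrier.\<close>

definition ell :: "('a, 'm) monoid_scheme \<Rightarrow> real \<Rightarrow> ('a \<Rightarrow> complex) set" where
  "ell G p =
     {f. (\<forall>x. x \<notin> carrier G \<longrightarrow> f x = 0) \<and> (\<lambda>x. cmod (f x) powr p) summable_on carrier G}"

definition ell_norm :: "('a, 'm) monoid_scheme \<Rightarrow> real \<Rightarrow> ('a \<Rightarrow> complex) \<Rightarrow> real" where
  "ell_norm G p f = (\<Sum>\<^sub>\<infinity>x\<in>carrier G. cmod (f x) powr p) powr (1 / p)"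

definition weighted_ell ::
    "('a, 'm) monoid_scheme \<Rightarrow> real \<Rightarrow> ('a \<Rightarrow> real) \<Rightarrow> ('a \<Rightarrow> complex) set" where
  "weighted_ell G p \<omega> =
     {f. (\<forall>x. x \<notin> carrier G \<longrightarrow> f x = 0) \<and> (\<lambda>x. f x * complex_of_real (\<omega> x)) \<in> ell G p}"

definition weighted_ell_norm ::
    "('a, 'm) monoid_scheme \<Rightarrow> real \<Rightarrow> ('a \<Rightarrow> real) \<Rightarrow> ('a \<Rightarrow> complex) \<Rightarrow> real" where
  "weighted_ell_norm G p \<omega> f = ell_norm G p (\<lambda>x. f x * complex_of_real (\<omega> x))"

definition convolution ::
    "('a, 'm) monoid_scheme \<Rightarrow> ('a \<Rightarrow> complex) \<Rightarrow> ('a \<Rightarrow> complex) \<Rightarrow> 'a \<Rightarrow> complex" where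
  "convolution G f g =
     (\<lambda>x. if x \<in> carrier G
          then \<Sum>\<^sub>\<infinity>y\<in>carrier G. f y * g (inv\<^bsub>G\<^esub> y \<otimes>\<^bsub>G\<^esub> x) else 0)"

definition weighted_ell_algebra ::
    "('a, 'm) monoid_scheme \<Rightarrow> real \<Rightarrow> ('a \<Rightarrow> real) \<Rightarrow> (complex, 'a \<Rightarrow> complex) module" where
  "weighted_ell_algebra G p \<omega> =
     \<lparr>carrier = weighted_ell G p \<omega>, mult = convolution G,
      one = (\<lambda>x. if x = \<one>\<^bsub>G\<^esub> then 1 else 0),
      ring.zero = (\<lambda>x. 0), ring.add = (\<lambda>f g x. f x + g x), smult = (\<lambda>c f x. c * f x)\<rparr>"


section \<open>The reduced group C*-algebra\<close>

text \<open>
  Operators on \<open>ell G 2\<close> are extensional functions (arbitrary but fixed off \<open>ell G 2\<close>), so that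
  equality of operators is equality of functions.
\<close>

type_synonym 'a l2_operator = "('a \<Rightarrow> complex) \<Rightarrow> ('a \<Rightarrow> complex)"

definition bounded_operators :: "('a, 'm) monoid_scheme \<Rightarrow> 'a l2_operator set" where
  "bounded_operators G =
     {T. T \<in> ell G 2 \<rightarrow>\<^sub>E ell G 2 \<and>
         (\<forall>f\<in>ell G 2. \<forall>g\<in>ell G 2. T (\<lambda>x. f x + g x) = (\<lambda>x. T f x + T g x)) \<and>
         (\<forall>c. \<forall>f\<in>ell G 2. T (\<lambda>x. c * f x) = (\<lambda>x. c * T f x)) \<and>
         (\<exists>M. \<forall>f\<in>ell G 2. ell_norm G 2 (T f) \<le> M * ell_norm G 2 f)}"

definition operator_norm :: "('a, 'm) monoid_scheme \<Rightarrow> 'a l2_operator \<Rightarrow> real" where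
  "operator_norm G T = (SUP f\<in>{f \<in> ell G 2. ell_norm G 2 f \<le> 1}. ell_norm G 2 (T f))"

definition left_convolution ::
    "('a, 'm) monoid_scheme \<Rightarrow> ('a \<Rightarrow> complex) \<Rightarrow> 'a l2_operator" where
  "left_convolution G f = (\<lambda>g\<in>ell G 2. convolution G f g)"

definition reduced_Cstar :: "('a, 'm) monoid_scheme \<Rightarrow> 'a l2_operator set" where
  "reduced_Cstar G =
     {T \<in> bounded_operators G.
        \<forall>\<epsilon>>0. \<exists>f\<in>ell G 1.
          operator_norm G (\<lambda>g\<in>ell G 2. \<lambda>x. T g x - left_convolution G f g x) < \<epsilon>}"

definition reduced_Cstar_algebra ::
    "('a, 'm) monoid_scheme \<Rightarrow> (complex, 'a l2_operator) module" where
  "reduced_Cstar_algebra G =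
     \<lparr>carrier = reduced_Cstar G, mult = compose (ell G 2),
      one = (\<lambda>g\<in>ell G 2. g),
      ring.zero = (\<lambda>g\<in>ell G 2. \<lambda>x. 0),
      ring.add = (\<lambda>S T. \<lambda>g\<in>ell G 2. \<lambda>x. S g x + T g x),
      smult = (\<lambda>c T. \<lambda>g\<in>ell G 2. \<lambda>x. c * T g x)\<rparr>"


section \<open>Norm-controlled inversion\<close>

text \<open>The locale \<^locale>\<open>algebra\<close> of the library is restricted to commutative multiplication.\<close>

definition unital_complex_algebra :: "(complex, 'b, 'm) module_scheme \<Rightarrow> bool" where
  "unital_complex_algebra A \<longleftrightarrow>
     ring A \<and> Module.module (ring_of_type_algebra :: complex ring) A \<and>
     (\<forall>c. \<forall>x\<in>carrier A. \<forall>y\<in>carrier A.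
        (c \<odot>\<^bsub>A\<^esub> x) \<otimes>\<^bsub>A\<^esub> y = c \<odot>\<^bsub>A\<^esub> (x \<otimes>\<^bsub>A\<^esub> y) \<and>
        x \<otimes>\<^bsub>A\<^esub> (c \<odot>\<^bsub>A\<^esub> y) = c \<odot>\<^bsub>A\<^esub> (x \<otimes>\<^bsub>A\<^esub> y))"

text \<open>An inclusion of algebras with a common unit is given by an embedding \<open>\<iota>\<close>
  (\<^const>\<open>ring_hom\<close> includes preservation of the unit).\<close>

definition unital_embedding ::
    "(complex, 'b, 'm) module_scheme \<Rightarrow> (complex, 'c, 'n) module_scheme \<Rightarrow> ('b \<Rightarrow> 'c) \<Rightarrow> bool" where
  "unital_embedding A B \<iota> \<longleftrightarrow>
     \<iota> \<in> ring_hom A B \<and> inj_on \<iota> (carrier A) \<and>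
     (\<forall>c. \<forall>x\<in>carrier A. \<iota> (c \<odot>\<^bsub>A\<^esub> x) = c \<odot>\<^bsub>B\<^esub> \<iota> x)"

definition norm_controlled_inversion ::
    "(complex, 'b, 'm) module_scheme \<Rightarrow> ('b \<Rightarrow> real) \<Rightarrow>
     (complex, 'c, 'n) module_scheme \<Rightarrow> ('c \<Rightarrow> real) \<Rightarrow> ('b \<Rightarrow> 'c) \<Rightarrow> bool" where
  "norm_controlled_inversion A normA B normB \<iota> \<longleftrightarrow>
     unital_complex_algebra A \<and> unital_complex_algebra B \<and> unital_embedding A B \<iota> \<and>
     (\<forall>a\<in>carrier A. \<iota> a \<in> Units B \<longrightarrow> inv\<^bsub>B\<^esub> (\<iota> a) \<in> \<iota> ` carrier A) \<and>
     (\<exists>h :: real \<Rightarrow> real \<Rightarrow> real.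
        (\<forall>s\<ge>0. \<forall>t\<ge>0. 0 \<le> h s t) \<and>
        (\<forall>a\<in>carrier A. \<forall>b\<in>carrier A.
           \<iota> a \<in> Units B \<and> \<iota> b = inv\<^bsub>B\<^esub> (\<iota> a) \<longrightarrow>
           normA b \<le> h (normA a) (normB (inv\<^bsub>B\<^esub> (\<iota> a)))))"

end

theory Submission
  imports Defs "HOL-Real_Asymp.Real_Asymp"
begin

text \<open>
  All four families of weights satisfy \<open>\<omega>(x y) \<le> K (\<omega>(x) \<omega>(y)\<^sup>\<gamma> + \<omega>(x)\<^sup>\<gamma> \<omega>(y))\<close> with some
  \<open>\<gamma> < 1\<close>, and \<open>\<omega>\<^sup>-\<^sup>s\<close> is summable for some \<open>s < (1 - \<gamma>) q\<close>. By Young's inequality the first property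
  bounds \<open>\<parallel>f * g\<parallel>\<^bsub>p,\<omega>\<^esub>\<close> by \<open>K (\<parallel>f\<parallel>\<^bsub>p,\<omega>\<^esub> \<parallel>g \<omega>\<^sup>\<gamma>\<parallel>\<^sub>1 + \<parallel>f \<omega>\<^sup>\<gamma>\<parallel>\<^sub>1 \<parallel>g\<parallel>\<^bsub>p,\<omega>\<^esub>)\<close>. By Hoelder's inequality the
  second one interpolates \<open>\<parallel>f \<omega>\<^sup>\<gamma>\<parallel>\<^sub>1 \<le> C \<parallel>f\<parallel>\<^sub>2\<^bsup>1-\<theta>\<^esup> \<parallel>f\<parallel>\<^bsub>p,\<omega>\<^esub>\<^bsup>\<theta>\<^esup>\<close> with \<open>\<theta> < 1\<close>. As the 2-norm is below the
  operator norm, squaring costs \<open>\<parallel>f * f\<parallel>\<^bsub>p,\<omega>\<^esub> \<le> D \<parallel>f\<parallel>\<^bsub>op\<^esub>\<^bsup>1-\<theta>\<^esup> \<parallel>f\<parallel>\<^bsub>p,\<omega>\<^esub>\<^bsup>1+\<theta>\<^esup>\<close>.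

  Given \<open>a\<close> invertible with inverse \<open>T\<close>, put \<open>c = 1 - a\<^sup>* a / L\<^sup>2\<close> with \<open>L \<ge> \<parallel>a\<parallel>\<^sub>1\<close>. Since
  \<open>\<parallel>c v\<parallel>\<^sup>2 \<le> \<parallel>v\<parallel>\<^sup>2 - \<parallel>a v\<parallel>\<^sup>2 / L\<^sup>2\<close>, the operator norm of \<open>c\<close> is below 1, with a bound that depends
  only on \<open>L\<close> and \<open>\<parallel>T\<parallel>\<close>. The squaring estimate makes the weighted norms of \<open>c\<^bsup>2^k\<^esup>\<close> decay doubly
  exponentially, so that the products of the factors \<open>1 + c\<^bsup>2^j\<^esup>\<close>, \<open>j < k\<close>, stay bounded in the weighted
  norm. Multiplied by \<open>a\<^sup>* / L\<^sup>2\<close> they tend in the 2-norm, hence pointwise, to \<open>T \<delta>\<^sub>e\<close>, which inherits the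
  bound by Fatou's lemma. No completeness is needed.
\<close>

no_notation Infinite_Set_Sum.abs_summable_on (infix "abs'_summable'_on" 50)

section \<open>Inequalities for finite and infinite sums\<close>

text \<open>Concavity of the logarithm for positive \<open>x\<close> and \<open>y\<close>; at the
  boundary the left side vanishes because \<open>0 powr a = 0\<close>.\<close>

lemma weighted_AM_GM:
  fixes a b x y :: real
  assumes "0 < a" "0 < b" "a + b = 1" "0 \<le> x" "0 \<le> y"
  shows "x powr a * y powr b \<le> a * x + b * y"
proof (cases "x = 0 \<or> y = 0")
  case False
  with assms show ?thesis by (intro Youngs_inequality_0) auto
qed (use assms in auto)

text \<open>Dividing \<open>u\<close> and \<open>v\<close> by their sums reduces the claim to the
  weighted AM-GM inequality term by term. The exponents stand for the reciprocals of the usual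
  conjugate indices. If one sum is 0, its terms all vanish and so does the left side.\<close>

lemma Holder_sum:
  fixes u v :: "'i \<Rightarrow> real"
  assumes "finite E" "0 < a" "0 < b" "a + b = 1"
    and u: "\<And>i. i \<in> E \<Longrightarrow> 0 \<le> u i" and v: "\<And>i. i \<in> E \<Longrightarrow> 0 \<le> v i"
  shows "(\<Sum>i\<in>E. u i powr a * v i powr b) \<le> (\<Sum>i\<in>E. u i) powr a * (\<Sum>i\<in>E. v i) powr b"
proof -
  define A where "A = (\<Sum>i\<in>E. u i)"
  define B where "B = (\<Sum>i\<in>E. v i)"
  have nn: "0 \<le> A" "0 \<le> B" unfolding A_def B_def using u v by (auto intro: sum_nonneg)
  show ?thesis
  proof (cases "A = 0 \<or> B = 0")
    case True
    then have "(\<forall>i\<in>E. u i = 0) \<or> (\<forall>i\<in>E. v i = 0)"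
      unfolding A_def B_def using assms(1) u v by (auto simp: sum_nonneg_eq_0_iff)
    then have "(\<Sum>i\<in>E. u i powr a * v i powr b) = 0"
      by (auto intro!: sum.neutral)
    then show ?thesis by simp
  next
    case False
    with nn have pos: "0 < A" "0 < B" by auto
    have "(\<Sum>i\<in>E. u i powr a * v i powr b)
        = A powr a * B powr b * (\<Sum>i\<in>E. (u i / A) powr a * (v i / B) powr b)"
      unfolding sum_distrib_left using u v pos by (intro sum.cong) (auto simp: powr_divide)
    also have "\<dots> \<le> A powr a * B powr b * (\<Sum>i\<in>E. a * (u i / A) + b * (v i / B))"
      using assms pos by (intro mult_left_mono sum_mono weighted_AM_GM) auto
    also have "(\<Sum>i\<in>E. a * (u i / A) + b * (v i / B)) = a * (A / A) + b * (B / B)"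
      unfolding A_def B_def
      by (simp only: sum.distrib sum_distrib_left[symmetric] sum_divide_distrib[symmetric])
    also have "\<dots> = 1" using pos assms by simp
    finally show ?thesis by (simp add: A_def B_def)
  qed
qed

text \<open>Two applications of the inequality for two factors: the product of the first two is
  treated as one factor of exponent \<open>a + b\<close>, then split with the exponents
  rescaled.\<close>

lemma Holder_sum3:
  fixes u v w :: "'i \<Rightarrow> real"
  assumes "finite E" "0 < a" "0 < b" "0 < c" "a + b + c = 1"
    and u: "\<And>i. i \<in> E \<Longrightarrow> 0 \<le> u i" and v: "\<And>i. i \<in> E \<Longrightarrow> 0 \<le> v i"
    and w: "\<And>i. i \<in> E \<Longrightarrow> 0 \<le> w i"
  shows "(\<Sum>i\<in>E. u i powr a * v i powr b * w i powr c)
       \<le> (\<Sum>i\<in>E. u i) powr a * (\<Sum>i\<in>E. v i) powr b * (\<Sum>i\<in>E. w i) powr c"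
proof -
  define d where "d = a + b"
  have d: "0 < d" "d + c = 1" "a / d + b / d = 1"
    using assms by (auto simp: d_def add_divide_distrib[symmetric])
  have "(\<Sum>i\<in>E. u i powr a * v i powr b * w i powr c)
      = (\<Sum>i\<in>E. (u i powr (a / d) * v i powr (b / d)) powr d * w i powr c)"
    using d by (simp add: powr_mult powr_powr)
  also have "\<dots> \<le> (\<Sum>i\<in>E. u i powr (a / d) * v i powr (b / d)) powr d * (\<Sum>i\<in>E. w i) powr c"
    using assms d by (intro Holder_sum) auto
  also have "\<dots> \<le> ((\<Sum>i\<in>E. u i) powr (a / d) * (\<Sum>i\<in>E. v i) powr (b / d)) powr d
                   * (\<Sum>i\<in>E. w i) powr c"
    using assms d by (intro mult_right_mono powr_mono2 Holder_sum sum_nonneg) auto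
  also have "\<dots> = (\<Sum>i\<in>E. u i) powr a * (\<Sum>i\<in>E. v i) powr b * (\<Sum>i\<in>E. w i) powr c"
    using d by (simp add: powr_mult powr_powr)
  finally show ?thesis .
qed

text \<open>Jensen's inequality for the convex function \<open>t powr p\<close> with weights of
  arbitrary total mass. It follows from Hoelder's inequality with exponents \<open>1 - 1 / p\<close>
  and \<open>1 / p\<close>, which are both positive only for \<open>p > 1\<close>.\<close>

lemma weighted_power_mean_sum:
  fixes a b :: "'i \<Rightarrow> real"
  assumes "finite E" "1 \<le> p"
    and a: "\<And>i. i \<in> E \<Longrightarrow> 0 \<le> a i" and b: "\<And>i. i \<in> E \<Longrightarrow> 0 \<le> b i"
  shows "(\<Sum>i\<in>E. a i * b i) powr p \<le> (\<Sum>i\<in>E. a i) powr (p - 1) * (\<Sum>i\<in>E. a i * b i powr p)"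
proof (cases "p = 1")
  case True
  have "0 \<le> (\<Sum>i\<in>E. a i * b i)" using a b by (auto intro: sum_nonneg)
  moreover have "(\<Sum>i\<in>E. a i * b i powr p) = (\<Sum>i\<in>E. a i * b i)"
    using b True by (intro sum.cong) auto
  \<comment> \<open>For \<open>p = 1\<close> the factor in front is a sum raised to the power 0,
    which is 0 rather than 1 when the sum is 0; the left side must then vanish too.\<close>
  moreover have "(\<Sum>i\<in>E. a i * b i) = 0" if "(\<Sum>i\<in>E. a i) = 0"
    using that a assms(1) by (simp add: sum_nonneg_eq_0_iff)
  ultimately show ?thesis using True by auto
next
  case False
  with assms have p: "1 < p" by simp
  have "(\<Sum>i\<in>E. a i * b i) = (\<Sum>i\<in>E. a i powr (1 - 1 / p) * (a i * b i powr p) powr (1 / p))"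
  proof (intro sum.cong refl)
    fix i assume i: "i \<in> E"
    have "a i powr (1 - 1 / p) * (a i * b i powr p) powr (1 / p)
        = a i powr (1 - 1 / p + 1 / p) * b i"
      using a[OF i] b[OF i] p by (simp only: powr_add) (simp add: powr_mult powr_powr)
    then show "a i * b i = a i powr (1 - 1 / p) * (a i * b i powr p) powr (1 / p)"
      using a[OF i] by simp
  qed
  also have "\<dots> \<le> (\<Sum>i\<in>E. a i) powr (1 - 1 / p) * (\<Sum>i\<in>E. a i * b i powr p) powr (1 / p)"
    using assms p by (intro Holder_sum) auto
  finally have "(\<Sum>i\<in>E. a i * b i) powr p
      \<le> ((\<Sum>i\<in>E. a i) powr (1 - 1 / p) * (\<Sum>i\<in>E. a i * b i powr p) powr (1 / p)) powr p"
    using a b p by (intro powr_mono2) (auto intro!: sum_nonneg)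
  also have "\<dots> = (\<Sum>i\<in>E. a i) powr (p - 1) * (\<Sum>i\<in>E. a i * b i powr p)"
  proof -
    have "(1 - 1 / p) * p = p - 1" using p by (simp add: field_simps)
    moreover have "0 \<le> (\<Sum>i\<in>E. a i * b i powr p)" using a by (auto intro: sum_nonneg)
    ultimately show ?thesis using p by (simp add: powr_mult powr_powr)
  qed
  finally show ?thesis .
qed

lemma summable_on_bounded_finite_sums:
  fixes f :: "'i \<Rightarrow> real"
  assumes "\<And>x. x \<in> A \<Longrightarrow> 0 \<le> f x" and "\<And>F. finite F \<Longrightarrow> F \<subseteq> A \<Longrightarrow> sum f F \<le> B"
  shows "f summable_on A"
  using assms by (intro nonneg_bdd_above_summable_on bdd_aboveI2[where M = B]) auto

lemma weighted_power_mean_infsum: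
  fixes a b :: "'i \<Rightarrow> real"
  assumes p: "1 \<le> p" and a: "\<And>i. i \<in> S \<Longrightarrow> 0 \<le> a i" and b: "\<And>i. i \<in> S \<Longrightarrow> 0 \<le> b i"
    and sa: "a summable_on S" and sb: "(\<lambda>i. a i * b i powr p) summable_on S"
    and sab: "(\<lambda>i. a i * b i) summable_on S"
  shows "(\<Sum>\<^sub>\<infinity>i\<in>S. a i * b i) powr p
       \<le> (\<Sum>\<^sub>\<infinity>i\<in>S. a i) powr (p - 1) * (\<Sum>\<^sub>\<infinity>i\<in>S. a i * b i powr p)"
    (is "?T powr p \<le> ?R")
proof -
  have "?T \<le> ?R powr (1 / p)"
  proof (rule infsum_le_finite_sums[OF sab])
    fix E assume E: "finite E" "E \<subseteq> S"
    have nn: "0 \<le> (\<Sum>i\<in>E. a i * b i)" using E a b by (intro sum_nonneg) auto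
    have "(\<Sum>i\<in>E. a i * b i) powr p
        \<le> (\<Sum>i\<in>E. a i) powr (p - 1) * (\<Sum>i\<in>E. a i * b i powr p)"
      using E a b p by (intro weighted_power_mean_sum) auto
    also have "\<dots> \<le> ?R"
      using E a b p sa sb
      by (intro mult_mono powr_mono2 finite_sum_le_infsum sum_nonneg) auto
    finally have "((\<Sum>i\<in>E. a i * b i) powr p) powr (1 / p) \<le> ?R powr (1 / p)"
      using p by (intro powr_mono2) auto
    then show "(\<Sum>i\<in>E. a i * b i) \<le> ?R powr (1 / p)"
      using nn p by (simp add: powr_powr)
  qed
  moreover have "0 \<le> ?T" using a b by (intro infsum_nonneg) auto
  ultimately have "?T powr p \<le> (?R powr (1 / p)) powr p"
    using p by (intro powr_mono2) auto
  also have "\<dots> = ?R"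
  proof -
    have "0 \<le> ?R" using a by (intro mult_nonneg_nonneg infsum_nonneg) auto
    then show ?thesis using p by (simp only: powr_powr) simp
  qed
  finally show ?thesis .
qed

section \<open>Sequence spaces on a group\<close>

lemma ell_support: "f \<in> ell G p \<Longrightarrow> x \<notin> carrier G \<Longrightarrow> f x = 0"
  by (simp add: ell_def)

lemma ell_summable: "f \<in> ell G p \<Longrightarrow> (\<lambda>x. cmod (f x) powr p) summable_on carrier G"
  by (simp add: ell_def)

lemma ell_norm_nonneg [simp]: "0 \<le> ell_norm G p f"
  by (simp add: ell_norm_def)

lemma ell_norm_powr: "p \<noteq> 0 \<Longrightarrow> ell_norm G p f powr p = (\<Sum>\<^sub>\<infinity>x\<in>carrier G. cmod (f x) powr p)"
  by (simp add: ell_norm_def powr_powr infsum_nonneg)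

lemma sum_le_ell_norm_powr:
  assumes "f \<in> ell G p" "p \<noteq> 0" "finite F" "F \<subseteq> carrier G"
  shows "(\<Sum>x\<in>F. cmod (f x) powr p) \<le> ell_norm G p f powr p"
  using assms by (simp add: ell_norm_powr finite_sum_le_infsum ell_summable)

text \<open>The criterion behind most membership proofs below: a uniform bound on finite partial
  sums yields summability and the norm bound together.\<close>

lemma ell_bounded_finite_sums:
  assumes "0 < p" "0 \<le> B" and supp: "\<And>x. x \<notin> carrier G \<Longrightarrow> f x = 0"
    and bd: "\<And>F. finite F \<Longrightarrow> F \<subseteq> carrier G \<Longrightarrow> (\<Sum>x\<in>F. cmod (f x) powr p) \<le> B powr p"
  shows "f \<in> ell G p" and "ell_norm G p f \<le> B"
proof -
  have s: "(\<lambda>x. cmod (f x) powr p) summable_on carrier G"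
    using bd by (intro summable_on_bounded_finite_sums) auto
  then show "f \<in> ell G p" using supp by (auto simp: ell_def)
  have "(\<Sum>\<^sub>\<infinity>x\<in>carrier G. cmod (f x) powr p) \<le> B powr p"
    using bd by (intro infsum_le_finite_sums s) auto
  then have "ell_norm G p f \<le> (B powr p) powr (1 / p)"
    unfolding ell_norm_def using assms by (intro powr_mono2) (auto intro: infsum_nonneg)
  then show "ell_norm G p f \<le> B" using assms by (simp add: powr_powr)
qed

lemma ell_mono:
  assumes "0 < p" "g \<in> ell G p" and supp: "\<And>x. x \<notin> carrier G \<Longrightarrow> f x = 0"
    and le: "\<And>x. x \<in> carrier G \<Longrightarrow> cmod (f x) \<le> cmod (g x)"
  shows "f \<in> ell G p" and "ell_norm G p f \<le> ell_norm G p g"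
proof -
  have "(\<Sum>x\<in>F. cmod (f x) powr p) \<le> ell_norm G p g powr p"
    if "finite F" "F \<subseteq> carrier G" for F
  proof -
    have "(\<Sum>x\<in>F. cmod (f x) powr p) \<le> (\<Sum>x\<in>F. cmod (g x) powr p)"
      using that assms by (intro sum_mono powr_mono2) auto
    also have "\<dots> \<le> ell_norm G p g powr p"
      using that assms by (intro sum_le_ell_norm_powr) auto
    finally show ?thesis .
  qed
  with assms show "f \<in> ell G p" and "ell_norm G p f \<le> ell_norm G p g"
    using ell_bounded_finite_sums[of p "ell_norm G p g" G f] by auto
qed

lemma norm_le_ell_norm:
  assumes "f \<in> ell G p" "0 < p"
  shows "cmod (f x) \<le> ell_norm G p f"
proof (cases "x \<in> carrier G")
  case True
  have "cmod (f x) powr p \<le> ell_norm G p f powr p"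
    using sum_le_ell_norm_powr[OF assms(1), of "{x}"] assms True by simp
  then show ?thesis using powr_less_mono2[of p "ell_norm G p f" "cmod (f x)"] assms by fastforce
qed (use ell_support[OF assms(1)] in auto)

lemma ell_scale:
  assumes "f \<in> ell G p" "0 < p"
  shows "(\<lambda>x. c * f x) \<in> ell G p" and "ell_norm G p (\<lambda>x. c * f x) = cmod c * ell_norm G p f"
proof -
  have *: "(\<lambda>x. cmod (c * f x) powr p) = (\<lambda>x. cmod c powr p * cmod (f x) powr p)"
    by (simp add: norm_mult powr_mult)
  show "(\<lambda>x. c * f x) \<in> ell G p"
    using assms by (auto simp: ell_def * intro: summable_on_cmult_right)
  have "0 \<le> (\<Sum>\<^sub>\<infinity>x\<in>carrier G. cmod (f x) powr p)" by (intro infsum_nonneg) auto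
  then show "ell_norm G p (\<lambda>x. c * f x) = cmod c * ell_norm G p f"
    using assms by (simp add: ell_norm_def * infsum_cmult_right' powr_mult powr_powr)
qed

lemma zero_in_ell [simp]: "0 < p \<Longrightarrow> (\<lambda>x. 0) \<in> ell G p"
  by (simp add: ell_def)

lemma ell_norm_zero [simp]: "0 < p \<Longrightarrow> ell_norm G p (\<lambda>x. 0) = 0"
  by (simp add: ell_norm_def)

lemma ell_norm_eq_0: "f \<in> ell G p \<Longrightarrow> 0 < p \<Longrightarrow> ell_norm G p f = 0 \<Longrightarrow> f = (\<lambda>x. 0)"
  using norm_le_ell_norm[of f G p] by (intro ext) (metis norm_le_zero_iff)

text \<open>The power mean inequality over the two-element index type \<open>bool\<close>; the total
  weight 1 removes the first factor.\<close>

lemma convex_powr_sum: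
  fixes a b s t p :: real
  assumes "1 \<le> p" "0 \<le> a" "0 \<le> b" "0 \<le> s" "0 \<le> t" "s + t = 1"
  shows "(s * a + t * b) powr p \<le> s * a powr p + t * b powr p"
  using weighted_power_mean_sum[of "UNIV :: bool set" p "\<lambda>i. if i then s else t" "\<lambda>i. if i then a else b"]
    assms by (simp add: UNIV_bool add.commute)

text \<open>Minkowski's inequality. With norms \<open>A\<close> and \<open>B\<close>, the function
  |f| + |g| is \<open>A + B\<close> times a convex combination of |f| / A and |g| / B. The p-th
  powers of these two sum to at most 1, so convexity of the power gives the claim.\<close>

lemma ell_add:
  assumes f: "f \<in> ell G p" and g: "g \<in> ell G p" and p: "1 \<le> p"
  shows "(\<lambda>x. f x + g x) \<in> ell G p"
    and "ell_norm G p (\<lambda>x. f x + g x) \<le> ell_norm G p f + ell_norm G p g"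
proof -
  define A B where "A = ell_norm G p f" and "B = ell_norm G p g"
  have nn: "0 \<le> A" "0 \<le> B" by (auto simp: A_def B_def)
  have bd: "(\<Sum>x\<in>F. cmod (f x + g x) powr p) \<le> (A + B) powr p"
    if F: "finite F" "F \<subseteq> carrier G" for F
  proof (cases "A = 0 \<or> B = 0")
    case True
    then consider "f = (\<lambda>x. 0)" | "g = (\<lambda>x. 0)"
      using ell_norm_eq_0 f g p unfolding A_def B_def by (metis less_le_trans zero_less_one)
    then show ?thesis
      using sum_le_ell_norm_powr[OF f _ F] sum_le_ell_norm_powr[OF g _ F] p
      by cases (auto simp: A_def B_def)
  next
    case False
    with nn have pos: "0 < A" "0 < B" by auto
    have "(\<Sum>x\<in>F. cmod (f x + g x) powr p)
        \<le> (\<Sum>x\<in>F. (A + B) powr p * (A / (A + B) * (cmod (f x) powr p / A powr p)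
             + B / (A + B) * (cmod (g x) powr p / B powr p)))"
    proof (rule sum_mono)
      fix x assume "x \<in> F"
      have "cmod (f x + g x) powr p \<le> (cmod (f x) + cmod (g x)) powr p"
        using p by (intro powr_mono2 norm_triangle_ineq) auto
      also have "cmod (f x) + cmod (g x)
          = (A + B) * (A / (A + B) * (cmod (f x) / A) + B / (A + B) * (cmod (g x) / B))"
        using pos by (simp add: distrib_left)
      also have "\<dots> powr p = (A + B) powr p
          * (A / (A + B) * (cmod (f x) / A) + B / (A + B) * (cmod (g x) / B)) powr p"
        using pos by (simp add: powr_mult)
      also have "\<dots> \<le> (A + B) powr p * (A / (A + B) * (cmod (f x) / A) powr p
          + B / (A + B) * (cmod (g x) / B) powr p)"
        using pos p
        by (intro mult_left_mono convex_powr_sum) (auto simp: add_divide_distrib[symmetric])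
      finally show "cmod (f x + g x) powr p \<le> (A + B) powr p * (A / (A + B)
          * (cmod (f x) powr p / A powr p) + B / (A + B) * (cmod (g x) powr p / B powr p))"
        using pos by (simp add: powr_divide)
    qed
    also have "\<dots> = (A + B) powr p * (A / (A + B) * ((\<Sum>x\<in>F. cmod (f x) powr p) / A powr p)
        + B / (A + B) * ((\<Sum>x\<in>F. cmod (g x) powr p) / B powr p))"
      by (simp only: sum.distrib sum_distrib_left[symmetric] sum_divide_distrib[symmetric])
    also have "\<dots> \<le> (A + B) powr p * (A / (A + B) * 1 + B / (A + B) * 1)"
      using pos p sum_le_ell_norm_powr[OF f _ F] sum_le_ell_norm_powr[OF g _ F]
      by (intro mult_left_mono add_mono) (auto simp: A_def B_def)
    also have "\<dots> = (A + B) powr p" using pos by (simp add: add_divide_distrib[symmetric])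
    finally show ?thesis .
  qed
  show "(\<lambda>x. f x + g x) \<in> ell G p" "ell_norm G p (\<lambda>x. f x + g x) \<le> ell_norm G p f + ell_norm G p g"
    using ell_bounded_finite_sums[of p "A + B" G "\<lambda>x. f x + g x"] bd nn p
      ell_support[OF f] ell_support[OF g] by (auto simp: A_def B_def)
qed

lemma ell_diff:
  assumes f: "f \<in> ell G p" and g: "g \<in> ell G p" and p: "1 \<le> p"
  shows "(\<lambda>x. f x - g x) \<in> ell G p"
    and "ell_norm G p (\<lambda>x. f x - g x) \<le> ell_norm G p f + ell_norm G p g"
  using ell_add[OF f ell_scale(1)[OF g, of "-1"] p] ell_scale(2)[OF g, of "-1"] p by auto

lemma sum_infsum_swap:
  fixes h :: "'i \<Rightarrow> 'j \<Rightarrow> real"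
  assumes "finite F" "\<And>x. x \<in> F \<Longrightarrow> h x summable_on S"
  shows "(\<lambda>y. \<Sum>x\<in>F. h x y) summable_on S"
    and "(\<Sum>x\<in>F. \<Sum>\<^sub>\<infinity>y\<in>S. h x y) = (\<Sum>\<^sub>\<infinity>y\<in>S. \<Sum>x\<in>F. h x y)"
proof -
  have "((\<lambda>y. \<Sum>x\<in>F. h x y) has_sum (\<Sum>x\<in>F. \<Sum>\<^sub>\<infinity>y\<in>S. h x y)) S"
    using assms by (induction F rule: finite_induct) (auto intro!: has_sum_add)
  then show "(\<lambda>y. \<Sum>x\<in>F. h x y) summable_on S"
    and "(\<Sum>x\<in>F. \<Sum>\<^sub>\<infinity>y\<in>S. h x y) = (\<Sum>\<^sub>\<infinity>y\<in>S. \<Sum>x\<in>F. h x y)"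
    by (auto simp: summable_on_def dest: infsumI)
qed

section \<open>The exponents 1 and 2\<close>

lemma ell_1_summable: "f \<in> ell G 1 \<Longrightarrow> (\<lambda>x. cmod (f x)) summable_on carrier G"
  using ell_summable[of f G 1] by simp

lemma ell_norm_1: "ell_norm G 1 f = (\<Sum>\<^sub>\<infinity>x\<in>carrier G. cmod (f x))"
  by (simp add: ell_norm_def infsum_nonneg)

lemma ell_2_summable: "f \<in> ell G 2 \<Longrightarrow> (\<lambda>x. (cmod (f x))\<^sup>2) summable_on carrier G"
  using ell_summable[of f G 2] by simp

lemma ell_norm_2: "(ell_norm G 2 f)\<^sup>2 = (\<Sum>\<^sub>\<infinity>x\<in>carrier G. (cmod (f x))\<^sup>2)"
  using ell_norm_powr[of 2 G f] by simp

text \<open>The elementary bound |u v| \<le> |u|^2 + |v|^2 takes the place of Cauchy-Schwarz. The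
  bijection allows for \<open>g (inv y \<otimes> x)\<close>; the bound does not depend on it, as the
  associativity of convolution requires.\<close>

lemma ell_2_product:
  assumes f: "f \<in> ell G 2" and g: "g \<in> ell G 2" and \<phi>: "bij_betw \<phi> (carrier G) (carrier G)"
  shows "(\<lambda>x. f x * g (\<phi> x)) abs_summable_on carrier G"
    and "(\<Sum>\<^sub>\<infinity>x\<in>carrier G. norm (f x * g (\<phi> x))) \<le> (ell_norm G 2 f)\<^sup>2 + (ell_norm G 2 g)\<^sup>2"
proof -
  have sg: "(\<lambda>x. (cmod (g (\<phi> x)))\<^sup>2) summable_on carrier G"
    using ell_2_summable[OF g] summable_on_reindex_bij_betw[OF \<phi>, of "\<lambda>x. (cmod (g x))\<^sup>2"] by simp
  have ss: "(\<lambda>x. (cmod (f x))\<^sup>2 + (cmod (g (\<phi> x)))\<^sup>2) summable_on carrier G"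
    by (intro summable_on_add ell_2_summable f sg)
  have le: "norm (f x * g (\<phi> x)) \<le> (cmod (f x))\<^sup>2 + (cmod (g (\<phi> x)))\<^sup>2" for x
  proof -
    have "0 \<le> (cmod (f x) - cmod (g (\<phi> x)))\<^sup>2 + (cmod (f x))\<^sup>2 + (cmod (g (\<phi> x)))\<^sup>2" by simp
    then show ?thesis by (simp add: norm_mult power2_diff)
  qed
  show s: "(\<lambda>x. f x * g (\<phi> x)) abs_summable_on carrier G"
    using ss le by (rule Infinite_Sum.abs_summable_on_comparison_test')
  have "(\<Sum>\<^sub>\<infinity>x\<in>carrier G. norm (f x * g (\<phi> x)))
      \<le> (\<Sum>\<^sub>\<infinity>x\<in>carrier G. (cmod (f x))\<^sup>2 + (cmod (g (\<phi> x)))\<^sup>2)"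
    using le by (intro infsum_mono s ss) auto
  also have "\<dots> = (ell_norm G 2 f)\<^sup>2 + (ell_norm G 2 g)\<^sup>2"
    using infsum_reindex_bij_betw[OF \<phi>, of "\<lambda>x. (cmod (g x))\<^sup>2"]
    by (simp add: infsum_add[OF ell_2_summable[OF f] sg] ell_norm_2)
  finally show "(\<Sum>\<^sub>\<infinity>x\<in>carrier G. norm (f x * g (\<phi> x)))
      \<le> (ell_norm G 2 f)\<^sup>2 + (ell_norm G 2 g)\<^sup>2" .
qed

section \<open>Convolution\<close>

definition group_adjoint :: "('a, 'm) monoid_scheme \<Rightarrow> ('a \<Rightarrow> complex) \<Rightarrow> 'a \<Rightarrow> complex" where
  "group_adjoint G f = (\<lambda>x. if x \<in> carrier G then cnj (f (inv\<^bsub>G\<^esub> x)) else 0)"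

abbreviation group_delta :: "('a, 'm) monoid_scheme \<Rightarrow> 'a \<Rightarrow> complex" where
  "group_delta G \<equiv> (\<lambda>x. if x = \<one>\<^bsub>G\<^esub> then 1 else 0)"

lemma convolution_support: "x \<notin> carrier G \<Longrightarrow> convolution G f g x = 0"
  by (simp add: convolution_def)

lemma convolution_scale_right: "convolution G f (\<lambda>x. c * g x) = (\<lambda>x. c * convolution G f g x)"
  unfolding convolution_def by (auto simp: mult.left_commute infsum_cmult_right')

lemma convolution_scale_left: "convolution G (\<lambda>x. c * f x) g = (\<lambda>x. c * convolution G f g x)"
  unfolding convolution_def by (auto simp: mult.assoc infsum_cmult_right')

section \<open>Reindexing by the group operations\<close>

context group
begin

lemma bij_left_mult: "z \<in> carrier G \<Longrightarrow> bij_betw (\<lambda>y. z \<otimes> y) (carrier G) (carrier G)"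
  by (rule bij_betw_byWitness[where f' = "\<lambda>y. inv z \<otimes> y"]) (auto simp: m_assoc[symmetric])

lemma bij_inv: "bij_betw (\<lambda>y. inv y) (carrier G) (carrier G)"
  by (rule bij_betw_byWitness[where f' = "\<lambda>y. inv y"]) auto

lemma inv_cancel:
  assumes "z \<in> carrier G" "x \<in> carrier G"
  shows "z \<otimes> (inv z \<otimes> x) = x" and "inv z \<otimes> (z \<otimes> x) = x"
  using assms by (simp_all add: m_assoc[symmetric])

lemma bij_inv_mult: "x \<in> carrier G \<Longrightarrow> bij_betw (\<lambda>y. inv y \<otimes> x) (carrier G) (carrier G)"
  by (rule bij_betw_byWitness[where f' = "\<lambda>y. x \<otimes> inv y"])
    (auto simp: m_assoc inv_mult_group inv_cancel)

text \<open>The substitution \<open>w = inv z \<otimes> y\<close>, under which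
  \<open>inv y \<otimes> x\<close> becomes \<open>inv w \<otimes> (inv z \<otimes> x)\<close>. It is
  the change of variables in the associativity law, used for the complex terms and for their
  norms.\<close>

lemma reindex_translate:
  fixes K :: "'a \<Rightarrow> 'a \<Rightarrow> 'z :: {comm_monoid_add, t2_space}"
  assumes "z \<in> carrier G" "x \<in> carrier G"
  shows "(\<Sum>\<^sub>\<infinity>y\<in>carrier G. K (inv z \<otimes> y) (inv y \<otimes> x))
      = (\<Sum>\<^sub>\<infinity>w\<in>carrier G. K w (inv w \<otimes> (inv z \<otimes> x)))"
    and "(\<lambda>y. K (inv z \<otimes> y) (inv y \<otimes> x)) summable_on carrier G
      \<longleftrightarrow> (\<lambda>w. K w (inv w \<otimes> (inv z \<otimes> x))) summable_on carrier G"
proof -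
  have cancel: "inv (inv z \<otimes> y) \<otimes> (inv z \<otimes> x) = inv y \<otimes> x" if "y \<in> carrier G" for y
    using that assms by (simp add: inv_mult_group m_assoc inv_cancel)
  show "(\<Sum>\<^sub>\<infinity>y\<in>carrier G. K (inv z \<otimes> y) (inv y \<otimes> x))
      = (\<Sum>\<^sub>\<infinity>w\<in>carrier G. K w (inv w \<otimes> (inv z \<otimes> x)))"
    using infsum_reindex_bij_betw[OF bij_left_mult[of "inv z"],
        of "\<lambda>w. K w (inv w \<otimes> (inv z \<otimes> x))"] assms by (simp only: inv_closed cancel cong: infsum_cong)
  show "(\<lambda>y. K (inv z \<otimes> y) (inv y \<otimes> x)) summable_on carrier G
      \<longleftrightarrow> (\<lambda>w. K w (inv w \<otimes> (inv z \<otimes> x))) summable_on carrier G"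
    using summable_on_reindex_bij_betw[OF bij_left_mult[of "inv z"],
        of "\<lambda>w. K w (inv w \<otimes> (inv z \<otimes> x))"] assms by (simp only: inv_closed cancel cong: summable_on_cong)
qed

section \<open>Young's inequality\<close>

lemma convolution_abs_summable:
  assumes f: "f \<in> ell G 1" and g: "\<And>y. y \<in> carrier G \<Longrightarrow> cmod (g y) \<le> B"
    and x: "x \<in> carrier G"
  shows "(\<lambda>y. f y * g (inv y \<otimes> x)) abs_summable_on carrier G"
    and "(\<Sum>\<^sub>\<infinity>y\<in>carrier G. norm (f y * g (inv y \<otimes> x))) \<le> ell_norm G 1 f * B"
proof -
  have s: "(\<lambda>y. cmod (f y) * B) summable_on carrier G"
    using ell_1_summable[OF f] by (rule summable_on_cmult_left)
  have le: "norm (f y * g (inv y \<otimes> x)) \<le> cmod (f y) * B" if "y \<in> carrier G" for y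
    using that x g by (auto simp: norm_mult intro!: mult_left_mono)
  show a: "(\<lambda>y. f y * g (inv y \<otimes> x)) abs_summable_on carrier G"
    using s le by (rule Infinite_Sum.abs_summable_on_comparison_test')
  show "(\<Sum>\<^sub>\<infinity>y\<in>carrier G. norm (f y * g (inv y \<otimes> x))) \<le> ell_norm G 1 f * B"
    unfolding ell_norm_1 infsum_cmult_left'[symmetric] using a s le by (rule infsum_mono)
qed

text \<open>The power mean inequality with weights |f y| bounds the p-th power of the convolution at
  x by \<open>A powr (p - 1)\<close> times the sum of |f y| |g (y^-1 x)|^p over y. Summing over x
  and exchanging the sums leaves the p-norm of \<open>g\<close>, since left translations preserve
  it.\<close>

lemma convolution_ell:
  assumes f: "f \<in> ell G 1" and g: "g \<in> ell G p" and p: "1 \<le> p"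
  shows "convolution G f g \<in> ell G p"
    and "ell_norm G p (convolution G f g) \<le> ell_norm G 1 f * ell_norm G p g"
proof -
  define A B where "A = ell_norm G 1 f" and "B = ell_norm G p g"
  have gB: "cmod (g y) \<le> B" for y unfolding B_def using norm_le_ell_norm[OF g] p by simp
  have nn: "0 \<le> A" "0 \<le> B" by (auto simp: A_def B_def)
  have bd: "(\<Sum>x\<in>F. cmod (convolution G f g x) powr p) \<le> (A * B) powr p"
    if F: "finite F" "F \<subseteq> carrier G" for F
  proof -
    have s: "(\<lambda>y. cmod (f y) * cmod (g (inv y \<otimes> x)) powr p) summable_on carrier G"
      if x: "x \<in> carrier G" for x
    proof -
      have "(\<lambda>y. cmod (f y) * B powr p) summable_on carrier G"
        using ell_1_summable[OF f] by (rule summable_on_cmult_left)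
      moreover have "norm (cmod (f y) * cmod (g (inv y \<otimes> x)) powr p) \<le> cmod (f y) * B powr p" for y
      proof -
        have "cmod (g (inv y \<otimes> x)) powr p \<le> B powr p"
          using p by (intro powr_mono2 gB) simp_all
        then show ?thesis by (simp add: mult_left_mono)
      qed
      ultimately have "(\<lambda>y. norm (cmod (f y) * cmod (g (inv y \<otimes> x)) powr p)) summable_on carrier G"
        by (rule Infinite_Sum.abs_summable_on_comparison_test')
      then show ?thesis by simp
    qed
    have "cmod (convolution G f g x) powr p
        \<le> A powr (p - 1) * (\<Sum>\<^sub>\<infinity>y\<in>carrier G. cmod (f y) * cmod (g (inv y \<otimes> x)) powr p)"
      if x: "x \<in> carrier G" for x
    proof -
      note ab = convolution_abs_summable[OF f gB x]
      have "cmod (convolution G f g x) \<le> (\<Sum>\<^sub>\<infinity>y\<in>carrier G. cmod (f y) * cmod (g (inv y \<otimes> x)))"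
        using norm_infsum_bound[OF ab(1)] x by (simp add: convolution_def norm_mult)
      then have "cmod (convolution G f g x) powr p
          \<le> (\<Sum>\<^sub>\<infinity>y\<in>carrier G. cmod (f y) * cmod (g (inv y \<otimes> x))) powr p"
        using p by (intro powr_mono2) auto
      also have "\<dots> \<le> (\<Sum>\<^sub>\<infinity>y\<in>carrier G. cmod (f y)) powr (p - 1)
          * (\<Sum>\<^sub>\<infinity>y\<in>carrier G. cmod (f y) * cmod (g (inv y \<otimes> x)) powr p)"
        using ab(1) p by (intro weighted_power_mean_infsum ell_1_summable f s x) (auto simp: norm_mult)
      finally show ?thesis by (simp add: A_def ell_norm_1)
    qed
    then have "(\<Sum>x\<in>F. cmod (convolution G f g x) powr p)
        \<le> (\<Sum>x\<in>F. A powr (p - 1) * (\<Sum>\<^sub>\<infinity>y\<in>carrier G. cmod (f y) * cmod (g (inv y \<otimes> x)) powr p))"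
      using F by (intro sum_mono) auto
    also have "\<dots> = A powr (p - 1)
        * (\<Sum>\<^sub>\<infinity>y\<in>carrier G. \<Sum>x\<in>F. cmod (f y) * cmod (g (inv y \<otimes> x)) powr p)"
    proof -
      have "(\<Sum>x\<in>F. \<Sum>\<^sub>\<infinity>y\<in>carrier G. cmod (f y) * cmod (g (inv y \<otimes> x)) powr p)
          = (\<Sum>\<^sub>\<infinity>y\<in>carrier G. \<Sum>x\<in>F. cmod (f y) * cmod (g (inv y \<otimes> x)) powr p)"
        using F s by (intro sum_infsum_swap(2)) auto
      then show ?thesis by (simp only: sum_distrib_left[symmetric])
    qed
    also have "\<dots> \<le> A powr (p - 1) * (\<Sum>\<^sub>\<infinity>y\<in>carrier G. cmod (f y) * B powr p)"
    proof (intro mult_left_mono infsum_mono)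
      show "(\<lambda>y. \<Sum>x\<in>F. cmod (f y) * cmod (g (inv y \<otimes> x)) powr p) summable_on carrier G"
        using F s by (intro sum_infsum_swap(1)) auto
      show "(\<lambda>y. cmod (f y) * B powr p) summable_on carrier G"
        using ell_1_summable[OF f] by (rule summable_on_cmult_left)
      fix y assume y: "y \<in> carrier G"
      have "inj_on (\<lambda>x. inv y \<otimes> x) F"
        using bij_left_mult[of "inv y"] y F by (auto simp: bij_betw_def intro: inj_on_subset)
      then have "(\<Sum>x\<in>F. cmod (g (inv y \<otimes> x)) powr p) = (\<Sum>x\<in>(\<lambda>x. inv y \<otimes> x) ` F. cmod (g x) powr p)"
        by (simp add: sum.reindex)
      also have "\<dots> \<le> B powr p"
        unfolding B_def using F y p by (intro sum_le_ell_norm_powr g) auto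
      finally show "(\<Sum>x\<in>F. cmod (f y) * cmod (g (inv y \<otimes> x)) powr p) \<le> cmod (f y) * B powr p"
        unfolding sum_distrib_left[symmetric] by (intro mult_left_mono) auto
    qed auto
    also have "\<dots> = (A powr (p - 1) * A powr 1) * B powr p"
      using nn by (simp add: infsum_cmult_left' A_def ell_norm_1 mult.assoc)
    also have "\<dots> = (A * B) powr p"
      unfolding powr_add[symmetric] using nn by (simp add: powr_mult)
    finally show ?thesis .
  qed
  show "convolution G f g \<in> ell G p"
    and "ell_norm G p (convolution G f g) \<le> ell_norm G 1 f * ell_norm G p g"
    using ell_bounded_finite_sums[of p "A * B" G "convolution G f g"] bd nn p
    by (auto simp: A_def B_def convolution_support)
qed

section \<open>The involution\<close>

lemma group_adjoint_ell:
  assumes "f \<in> ell G p"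
  shows "group_adjoint G f \<in> ell G p" and "ell_norm G p (group_adjoint G f) = ell_norm G p f"
proof -
  have "(\<lambda>x. cmod (f (inv x)) powr p) summable_on carrier G"
    using summable_on_reindex_bij_betw[OF bij_inv, of "\<lambda>x. cmod (f x) powr p"] ell_summable[OF assms]
    by simp
  then show "group_adjoint G f \<in> ell G p"
    by (auto simp: ell_def group_adjoint_def cong: summable_on_cong)
  have "(\<Sum>\<^sub>\<infinity>x\<in>carrier G. cmod (group_adjoint G f x) powr p)
      = (\<Sum>\<^sub>\<infinity>x\<in>carrier G. cmod (f (inv x)) powr p)"
    by (intro infsum_cong) (simp add: group_adjoint_def)
  also have "\<dots> = (\<Sum>\<^sub>\<infinity>x\<in>carrier G. cmod (f x) powr p)"
    by (rule infsum_reindex_bij_betw[OF bij_inv])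
  finally show "ell_norm G p (group_adjoint G f) = ell_norm G p f"
    by (simp add: ell_norm_def)
qed

lemma group_adjoint_involution:
  assumes "\<And>x. x \<notin> carrier G \<Longrightarrow> f x = 0"
  shows "group_adjoint G (group_adjoint G f) = f"
  using assms by (auto simp: group_adjoint_def)

lemma group_adjoint_convolution:
  "group_adjoint G (convolution G f g) = convolution G (group_adjoint G g) (group_adjoint G f)"
proof
  fix x
  show "group_adjoint G (convolution G f g) x
      = convolution G (group_adjoint G g) (group_adjoint G f) x"
  proof (cases "x \<in> carrier G")
    case True
    have "(\<Sum>\<^sub>\<infinity>y\<in>carrier G. cnj (f y * g (inv y \<otimes> inv x)))
        = (\<Sum>\<^sub>\<infinity>z\<in>carrier G. group_adjoint G g z * group_adjoint G f (inv z \<otimes> x))"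
      by (rule infsum_reindex_bij_witness[where j = "\<lambda>y. x \<otimes> y" and i = "\<lambda>z. inv x \<otimes> z"])
        (use True in \<open>auto simp: m_assoc[symmetric] group_adjoint_def inv_mult_group\<close>)
    then show ?thesis
      using True by (simp add: convolution_def group_adjoint_def flip: infsum_cnj complex_cnj_mult)
  qed (simp add: group_adjoint_def convolution_def)
qed

section \<open>Associativity\<close>

text \<open>Fubini for the terms \<open>f z * g (inv z \<otimes> y) * h (inv y \<otimes> x)\<close>.
  For fixed \<open>z\<close> the absolute sum over \<open>y\<close> is |f z| times a translated sum
  bounded by \<open>B\<close>, so the double sum is at most \<open>B\<close> times the 1-norm of
  \<open>f\<close>. The conditions on \<open>g\<close> and \<open>h\<close> are kept abstract to
  serve two pairs of spaces.\<close>

lemma convolution_assoc_abs_summable: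
  assumes f: "f \<in> ell G 1"
    and s: "\<And>x. x \<in> carrier G \<Longrightarrow> (\<lambda>y. g y * h (inv y \<otimes> x)) abs_summable_on carrier G"
    and B: "\<And>x. x \<in> carrier G \<Longrightarrow> (\<Sum>\<^sub>\<infinity>y\<in>carrier G. norm (g y * h (inv y \<otimes> x))) \<le> B"
  shows "convolution G (convolution G f g) h = convolution G f (convolution G g h)"
proof
  fix x
  show "convolution G (convolution G f g) h x = convolution G f (convolution G g h) x"
  proof (cases "x \<in> carrier G")
    case x: True
    let ?F = "\<lambda>z y. f z * (g (inv z \<otimes> y) * h (inv y \<otimes> x))"
    have shift_s: "(\<lambda>y. g (inv z \<otimes> y) * h (inv y \<otimes> x)) abs_summable_on carrier G"
      if "z \<in> carrier G" for z
      using reindex_translate(2)[OF that x, of "\<lambda>w t. norm (g w * h t)"] that s[of "inv z \<otimes> x"] x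
      by (simp only: inv_closed m_closed)
    have "(\<lambda>(z, y). ?F z y) abs_summable_on carrier G \<times> carrier G"
      unfolding Infinite_Sum.abs_summable_on_Sigma_iff
    proof (intro conjI ballI)
      fix z assume z: "z \<in> carrier G"
      show "(\<lambda>y. case (z, y) of (z, y) \<Rightarrow> ?F z y) abs_summable_on carrier G"
        using summable_on_cmult_right[OF shift_s[OF z], of "cmod (f z)"] by (simp add: norm_mult)
    next
      have "(\<lambda>z. cmod (f z) * B) summable_on carrier G"
        using ell_1_summable[OF f] by (rule summable_on_cmult_left)
      then show "(\<lambda>z. \<Sum>\<^sub>\<infinity>y\<in>carrier G. norm (case (z, y) of (z, y) \<Rightarrow> ?F z y))
          abs_summable_on carrier G"
      proof (rule Infinite_Sum.abs_summable_on_comparison_test')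
        fix z assume z: "z \<in> carrier G"
        have "(\<Sum>\<^sub>\<infinity>y\<in>carrier G. norm (?F z y))
            = cmod (f z) * (\<Sum>\<^sub>\<infinity>w\<in>carrier G. norm (g w * h (inv w \<otimes> (inv z \<otimes> x))))"
          unfolding norm_mult[of "f z"] infsum_cmult_right'
            reindex_translate(1)[OF z x, of "\<lambda>w t. norm (g w * h t)"] by (rule refl)
        also have "\<dots> \<le> cmod (f z) * B"
          using B[of "inv z \<otimes> x"] x z by (intro mult_left_mono) auto
        finally show "norm (\<Sum>\<^sub>\<infinity>y\<in>carrier G. norm (case (z, y) of (z, y) \<Rightarrow> ?F z y)) \<le> cmod (f z) * B"
          by (simp add: infsum_nonneg)
      qed
    qed
    then have F: "(\<lambda>(z, y). ?F z y) summable_on carrier G \<times> carrier G"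
      by (rule abs_summable_summable)
    have "convolution G (convolution G f g) h x
        = (\<Sum>\<^sub>\<infinity>y\<in>carrier G. \<Sum>\<^sub>\<infinity>z\<in>carrier G. ?F z y)"
    proof -
      have "convolution G (convolution G f g) h x
          = (\<Sum>\<^sub>\<infinity>y\<in>carrier G. convolution G f g y * h (inv y \<otimes> x))"
        using x by (simp add: convolution_def[of G _ h])
      also have "\<dots> = (\<Sum>\<^sub>\<infinity>y\<in>carrier G. \<Sum>\<^sub>\<infinity>z\<in>carrier G. ?F z y)"
        unfolding mult.assoc[symmetric] infsum_cmult_left'
        by (intro infsum_cong) (simp add: convolution_def)
      finally show ?thesis .
    qed
    also have "\<dots> = (\<Sum>\<^sub>\<infinity>z\<in>carrier G. \<Sum>\<^sub>\<infinity>y\<in>carrier G. ?F z y)"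
      using infsum_swap_banach[OF F] by simp
    also have "\<dots> = (\<Sum>\<^sub>\<infinity>z\<in>carrier G. f z * convolution G g h (inv z \<otimes> x))"
    proof (rule infsum_cong)
      fix z assume z: "z \<in> carrier G"
      show "(\<Sum>\<^sub>\<infinity>y\<in>carrier G. ?F z y) = f z * convolution G g h (inv z \<otimes> x)"
        unfolding infsum_cmult_right' reindex_translate(1)[OF z x, of "\<lambda>w t. g w * h t"]
        using x z by (simp add: convolution_def)
    qed
    also have "\<dots> = convolution G f (convolution G g h) x"
      using x by (simp add: convolution_def)
    finally show ?thesis .
  qed (simp add: convolution_def)
qed

lemma convolution_assoc:
  assumes "f \<in> ell G 1" "g \<in> ell G 1" "h \<in> ell G r" "0 < r"
  shows "convolution G (convolution G f g) h = convolution G f (convolution G g h)"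
  by (rule convolution_assoc_abs_summable[OF assms(1)
        convolution_abs_summable[OF assms(2) norm_le_ell_norm[OF assms(3,4)]]])

text \<open>Here \<open>convolution G g h\<close> is only controlled as a bounded function; this
  version allows inner products to be treated as convolutions.\<close>

lemma convolution_assoc_2:
  assumes "f \<in> ell G 1" "g \<in> ell G 2" "h \<in> ell G 2"
  shows "convolution G (convolution G f g) h = convolution G f (convolution G g h)"
  by (rule convolution_assoc_abs_summable[OF assms(1) ell_2_product[OF assms(2,3) bij_inv_mult]])

section \<open>Bilinearity and the unit\<close>

lemma convolution_summable:
  assumes "f \<in> ell G 1" "g \<in> ell G r" "0 < r" "x \<in> carrier G"
  shows "(\<lambda>y. f y * g (inv y \<otimes> x)) summable_on carrier G"
  by (rule abs_summable_summable[OF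
        convolution_abs_summable(1)[OF assms(1) norm_le_ell_norm[OF assms(2,3)] assms(4)]])

lemma convolution_add_right:
  assumes "f \<in> ell G 1" "g \<in> ell G r" "h \<in> ell G r" "0 < r"
  shows "convolution G f (\<lambda>x. g x + h x) = (\<lambda>x. convolution G f g x + convolution G f h x)"
proof
  fix x
  show "convolution G f (\<lambda>x. g x + h x) x = convolution G f g x + convolution G f h x"
  proof (cases "x \<in> carrier G")
    case True
    then show ?thesis
      using infsum_add[OF convolution_summable[OF assms(1,2,4) True]
          convolution_summable[OF assms(1,3,4) True]]
      by (simp add: convolution_def distrib_left)
  qed (simp add: convolution_def)
qed

lemma convolution_add_left:
  assumes "f \<in> ell G 1" "g \<in> ell G 1" "h \<in> ell G r" "0 < r"
  shows "convolution G (\<lambda>x. f x + g x) h = (\<lambda>x. convolution G f h x + convolution G g h x)"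
proof
  fix x
  show "convolution G (\<lambda>x. f x + g x) h x = convolution G f h x + convolution G g h x"
  proof (cases "x \<in> carrier G")
    case True
    then show ?thesis
      using infsum_add[OF convolution_summable[OF assms(1,3,4) True]
          convolution_summable[OF assms(2,3,4) True]]
      by (simp add: convolution_def distrib_right)
  qed (simp add: convolution_def)
qed

lemma convolution_delta_left:
  assumes "\<And>x. x \<notin> carrier G \<Longrightarrow> f x = 0"
  shows "convolution G (group_delta G) f = f"
proof
  fix x
  have "(\<Sum>\<^sub>\<infinity>y\<in>carrier G. group_delta G y * f (inv y \<otimes> x)) = (\<Sum>\<^sub>\<infinity>y\<in>{\<one>}. f x)"
    if "x \<in> carrier G"
    using that by (intro infsum_cong_neutral) auto
  then show "convolution G (group_delta G) f x = f x"
    using assms by (simp add: convolution_def)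
qed

lemma convolution_delta_right:
  assumes "\<And>x. x \<notin> carrier G \<Longrightarrow> f x = 0"
  shows "convolution G f (group_delta G) = f"
proof
  fix x
  have "(\<Sum>\<^sub>\<infinity>y\<in>carrier G. f y * group_delta G (inv y \<otimes> x)) = (\<Sum>\<^sub>\<infinity>y\<in>{x}. f x)"
    if "x \<in> carrier G"
    using that by (intro infsum_cong_neutral) (auto simp: inv_solve_left')
  then show "convolution G f (group_delta G) x = f x"
    using assms by (simp add: convolution_def)
qed

lemma delta_ell: "group_delta G \<in> ell G r" "0 < r \<Longrightarrow> ell_norm G r (group_delta G) = 1"
proof -
  have eq: "cmod (group_delta G x) powr r = (if x = \<one> then 1 else 0)" for x
    by simp
  have s: "((\<lambda>x. if x = \<one> then 1 else 0 :: real) has_sum 1) (carrier G)"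
    by (rule has_sum_finite_neutralI[of "{\<one>}"]) auto
  show "group_delta G \<in> ell G r"
    unfolding ell_def mem_Collect_eq eq using has_sum_imp_summable[OF s] by auto
  show "ell_norm G r (group_delta G) = 1" if "0 < r"
    using infsumI[OF s] unfolding ell_norm_def eq by simp
qed

section \<open>Inner products and the trace\<close>

lemma convolution_adjoint_at_one:
  "convolution G f (group_adjoint G g) \<one> = (\<Sum>\<^sub>\<infinity>y\<in>carrier G. f y * cnj (g y))"
  unfolding convolution_def by (auto simp: group_adjoint_def intro!: infsum_cong)

text \<open>The trace property of evaluation at the unit; the sum is reindexed by inversion.\<close>

lemma convolution_commute_at_one: "convolution G f g \<one> = convolution G g f \<one>"
proof -
  have "(\<Sum>\<^sub>\<infinity>y\<in>carrier G. f y * g (inv y)) = (\<Sum>\<^sub>\<infinity>y\<in>carrier G. g y * f (inv y))"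
    by (rule infsum_reindex_bij_witness[where j = "\<lambda>y. inv y" and i = "\<lambda>y. inv y"]) auto
  then show ?thesis by (simp add: convolution_def cong: infsum_cong)
qed

text \<open>This is \<open>\<langle>a\<^sup>* a v, v\<rangle> = \<langle>a v, a v\<rangle>\<close>; the inner product \<open>\<langle>f, g\<rangle>\<close> is the value of
  \<open>f g\<^sup>*\<close> at the unit, so that the identity follows from associativity and the trace property.\<close>

lemma inner_adjoint_convolution:
  assumes a: "a \<in> ell G 1" and v: "v \<in> ell G 2"
  shows "(\<Sum>\<^sub>\<infinity>y\<in>carrier G. convolution G (group_adjoint G a) (convolution G a v) y * cnj (v y))
      = complex_of_real ((ell_norm G 2 (convolution G a v))\<^sup>2)"
proof -
  let ?w = "convolution G a v" and ?c = "convolution G" and ?s = "group_adjoint G"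
  have w: "?w \<in> ell G 2" using a v by (intro convolution_ell) auto
  have "?c (?c (?s a) ?w) (?s v) = ?c (?s a) (?c ?w (?s v))"
    by (intro convolution_assoc_2 group_adjoint_ell a w v)
  \<comment> \<open>Associativity is available only with a factor from \<open>ell G 1\<close> on the
    left, so this regrouping is obtained as the adjoint of (a v) u = a (v u), where a v = w and u =
    w^*.\<close>
  moreover have "?c (?c ?w (?s v)) (?s a) = ?c ?w (?s ?w)"
  proof -
    have "?c (?c a v) (?s ?w) = ?c a (?c v (?s ?w))"
      by (intro convolution_assoc_2 group_adjoint_ell a w v)
    then have "?s (?c ?w (?s ?w)) = ?s (?c a (?c v (?s ?w)))" by simp
    then show ?thesis
      using w by (simp add: group_adjoint_convolution[of ?w] group_adjoint_convolution[of v]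
          group_adjoint_convolution[of a "?c v (?s ?w)"] group_adjoint_involution ell_support)
  qed
  ultimately have "?c (?c (?s a) ?w) (?s v) \<one> = ?c ?w (?s ?w) \<one>"
    using convolution_commute_at_one[of "?s a"] by simp
  also have "\<dots> = (\<Sum>\<^sub>\<infinity>y\<in>carrier G. complex_of_real ((cmod (?w y))\<^sup>2))"
    by (simp only: convolution_adjoint_at_one complex_norm_square)
  also have "\<dots> = complex_of_real ((ell_norm G 2 ?w)\<^sup>2)"
    unfolding ell_norm_2 by (intro infsumI has_sum_of_real has_sum_infsum ell_2_summable w)
  finally show ?thesis by (simp only: convolution_adjoint_at_one)
qed

text \<open>In the expansion of the square, the cross term is -2 / L^2 times ||a v||^2 by
  \<open>inner_adjoint_convolution\<close>, and the last term is at most ||a v||^2 / L^2 because the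
  adjoint of \<open>a\<close> has 1-norm at most \<open>L\<close>. The remaining gain is what a
  lower bound of \<open>a\<close> turns into a strict contraction.\<close>

lemma ell_2_minus_adjoint_convolution:
  assumes a: "a \<in> ell G 1" and v: "v \<in> ell G 2" and L: "ell_norm G 1 a \<le> L" "0 < L"
  defines "n \<equiv> convolution G (group_adjoint G a) (convolution G a v)"
  shows "(ell_norm G 2 (\<lambda>x. v x - complex_of_real (1 / L\<^sup>2) * n x))\<^sup>2
    \<le> (ell_norm G 2 v)\<^sup>2 - (ell_norm G 2 (convolution G a v))\<^sup>2 / L\<^sup>2"
proof -
  define r where "r = 1 / L\<^sup>2"
  let ?w = "convolution G a v"
  have w: "?w \<in> ell G 2" using a v by (intro convolution_ell) auto
  have n: "n \<in> ell G 2"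
    unfolding n_def using group_adjoint_ell(1)[OF a] w by (rule convolution_ell(1)) simp
  have "ell_norm G 2 n \<le> ell_norm G 1 (group_adjoint G a) * ell_norm G 2 ?w"
    unfolding n_def using a w
    by (intro convolution_ell(2)[where g = "convolution G a v"] group_adjoint_ell) auto
  also have "\<dots> \<le> L * ell_norm G 2 ?w"
    using L a by (simp add: group_adjoint_ell mult_right_mono)
  finally have nL: "(ell_norm G 2 n)\<^sup>2 \<le> L\<^sup>2 * (ell_norm G 2 ?w)\<^sup>2"
    by (metis ell_norm_nonneg power_mono power_mult_distrib)
  have nv: "(\<lambda>y. n y * cnj (v y)) summable_on carrier G"
  proof -
    have "(\<lambda>y. n y * v y) abs_summable_on carrier G"
      using ell_2_product(1)[OF n v, of "\<lambda>x. x"] by (simp add: bij_betw_def)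
    then have "(\<lambda>y. n y * cnj (v y)) abs_summable_on carrier G" by (simp add: norm_mult)
    then show ?thesis by (rule abs_summable_summable)
  qed
  have Re_nv: "(\<Sum>\<^sub>\<infinity>y\<in>carrier G. Re (n y * cnj (v y))) = (ell_norm G 2 ?w)\<^sup>2"
    using inner_adjoint_convolution[OF a v] infsum_Re[OF nv] by (simp add: n_def)
  have expand: "(cmod (v x - complex_of_real r * n x))\<^sup>2
      = (cmod (v x))\<^sup>2 + ((- 2 * r) * Re (n x * cnj (v x)) + r\<^sup>2 * (cmod (n x))\<^sup>2)" for x
    unfolding cmod_power2 by (simp add: power2_eq_square algebra_simps)
  have "(ell_norm G 2 (\<lambda>x. v x - complex_of_real r * n x))\<^sup>2
      = (ell_norm G 2 v)\<^sup>2 + ((- 2 * r) * (ell_norm G 2 ?w)\<^sup>2 + r\<^sup>2 * (ell_norm G 2 n)\<^sup>2)"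
    unfolding ell_norm_2[of G "\<lambda>x. v x - complex_of_real r * n x"] expand
    by (subst infsum_add, intro ell_2_summable v,
        intro summable_on_add summable_on_cmult_right summable_on_Re nv ell_2_summable n,
        subst infsum_add, intro summable_on_cmult_right summable_on_Re nv,
        intro summable_on_cmult_right ell_2_summable n)
      (simp only: infsum_cmult_right' Re_nv ell_norm_2)
  also have "r\<^sup>2 * (ell_norm G 2 n)\<^sup>2 \<le> r\<^sup>2 * (L\<^sup>2 * (ell_norm G 2 ?w)\<^sup>2)"
    using nL by (intro mult_left_mono) auto
  also have "\<dots> = r * (ell_norm G 2 ?w)\<^sup>2"
    using L by (simp add: r_def power2_eq_square)
  finally show ?thesis by (simp add: r_def)
qed

end

section \<open>Bounded operators and the reduced group C*-algebra\<close>

lemma bounded_operatorsD: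
  assumes "T \<in> bounded_operators G"
  shows "f \<in> ell G 2 \<Longrightarrow> T f \<in> ell G 2"
    and "f \<notin> ell G 2 \<Longrightarrow> T f = undefined"
    and "f \<in> ell G 2 \<Longrightarrow> g \<in> ell G 2 \<Longrightarrow> T (\<lambda>x. f x + g x) = (\<lambda>x. T f x + T g x)"
    and "f \<in> ell G 2 \<Longrightarrow> T (\<lambda>x. c * f x) = (\<lambda>x. c * T f x)"
  using assms by (auto simp: bounded_operators_def PiE_def extensional_def)

lemma bounded_operatorsI:
  assumes "\<And>f. f \<in> ell G 2 \<Longrightarrow> F f \<in> ell G 2"
    and "\<And>f g. f \<in> ell G 2 \<Longrightarrow> g \<in> ell G 2 \<Longrightarrow> F (\<lambda>x. f x + g x) = (\<lambda>x. F f x + F g x)"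
    and "\<And>c f. f \<in> ell G 2 \<Longrightarrow> F (\<lambda>x. c * f x) = (\<lambda>x. c * F f x)"
    and "\<And>f. f \<in> ell G 2 \<Longrightarrow> ell_norm G 2 (F f) \<le> M * ell_norm G 2 f"
  shows "restrict F (ell G 2) \<in> bounded_operators G"
proof -
  have "\<exists>M. \<forall>f\<in>ell G 2. ell_norm G 2 (restrict F (ell G 2) f) \<le> M * ell_norm G 2 f"
    using assms(4) by (intro exI[of _ M]) simp
  then show ?thesis
    using assms(1-3) unfolding bounded_operators_def by (simp add: ell_add(1) ell_scale(1))
qed

lemma operator_norm_bdd_above:
  assumes "T \<in> bounded_operators G"
  shows "bdd_above ((\<lambda>f. ell_norm G 2 (T f)) ` {f \<in> ell G 2. ell_norm G 2 f \<le> 1})"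
proof -
  obtain M where M: "\<And>f. f \<in> ell G 2 \<Longrightarrow> ell_norm G 2 (T f) \<le> M * ell_norm G 2 f"
    using assms unfolding bounded_operators_def by blast
  have "ell_norm G 2 (T f) \<le> \<bar>M\<bar>" if "f \<in> ell G 2" "ell_norm G 2 f \<le> 1" for f
  proof -
    have "M * ell_norm G 2 f \<le> \<bar>M\<bar> * ell_norm G 2 f" by (intro mult_right_mono) auto
    also have "\<dots> \<le> \<bar>M\<bar> * 1" using that by (intro mult_left_mono) auto
    finally show ?thesis using M[OF that(1)] by simp
  qed
  then show ?thesis by (intro bdd_aboveI2[where M = "\<bar>M\<bar>"]) auto
qed

lemma operator_norm_bound:
  assumes T: "T \<in> bounded_operators G" and f: "f \<in> ell G 2"
  shows "ell_norm G 2 (T f) \<le> operator_norm G T * ell_norm G 2 f"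
proof (cases "ell_norm G 2 f = 0")
  case True
  then show ?thesis using T f by (auto simp: bounded_operators_def)
next
  case False
  define n where "n = ell_norm G 2 f"
  have n: "0 < n" using False by (simp add: n_def order_less_le)
  let ?g = "\<lambda>x. complex_of_real (1 / n) * f x"
  have g: "?g \<in> ell G 2" "ell_norm G 2 ?g = 1"
    using ell_scale[OF f, of "complex_of_real (1 / n)"] n by (auto simp: n_def norm_divide)
  have "ell_norm G 2 (T ?g) \<le> operator_norm G T"
    unfolding operator_norm_def using g
    by (intro cSUP_upper operator_norm_bdd_above T) auto
  moreover have "ell_norm G 2 (T ?g) = ell_norm G 2 (T f) / n"
    using n ell_scale(2)[OF bounded_operatorsD(1)[OF T f], of "complex_of_real (1 / n)"]
    by (simp only: bounded_operatorsD(4)[OF T f]) (simp add: norm_divide)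
  ultimately show ?thesis using n by (simp add: n_def field_simps)
qed

lemma operator_norm_nonneg:
  assumes "T \<in> bounded_operators G"
  shows "0 \<le> operator_norm G T"
proof -
  have "ell_norm G 2 (T (\<lambda>x. 0)) \<le> operator_norm G T"
    unfolding operator_norm_def by (intro cSUP_upper operator_norm_bdd_above assms) simp
  then show ?thesis using ell_norm_nonneg order_trans by blast
qed

lemma operator_norm_le:
  assumes "\<And>f. f \<in> ell G 2 \<Longrightarrow> ell_norm G 2 (T f) \<le> M * ell_norm G 2 f" "0 \<le> M"
  shows "operator_norm G T \<le> M"
  unfolding operator_norm_def
proof (rule cSUP_least)
  have "(\<lambda>x. 0) \<in> {f \<in> ell G 2. ell_norm G 2 f \<le> 1}" by simp
  then show "{f \<in> ell G 2. ell_norm G 2 f \<le> 1} \<noteq> {}" by blast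
  fix f assume f: "f \<in> {f \<in> ell G 2. ell_norm G 2 f \<le> 1}"
  then have "M * ell_norm G 2 f \<le> M * 1" using assms(2) by (intro mult_left_mono) auto
  with assms(1)[of f] f show "ell_norm G 2 (T f) \<le> M" by simp
qed

section \<open>The norm closure of the convolution operators\<close>

context group
begin

lemma convolution_diff_right:
  assumes f: "f \<in> ell G 1" and g: "g \<in> ell G r" and h: "h \<in> ell G r" and r: "0 < r"
  shows "convolution G f (\<lambda>x. g x - h x) = (\<lambda>x. convolution G f g x - convolution G f h x)"
  using convolution_add_right[OF f g ell_scale(1)[OF h r, of "-1"] r]
    convolution_scale_right[of G f "-1" h] by simp

lemma convolution_diff_left:
  assumes f: "f \<in> ell G 1" and g: "g \<in> ell G 1" and h: "h \<in> ell G r" and r: "0 < r"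
  shows "convolution G (\<lambda>x. f x - g x) h = (\<lambda>x. convolution G f h x - convolution G g h x)"
  using convolution_add_left[OF f ell_scale(1)[OF g, of "-1"] h r]
    convolution_scale_left[of G "-1" g h] by simp

lemma left_convolution_bounded:
  assumes f: "f \<in> ell G 1"
  shows "left_convolution G f \<in> bounded_operators G"
  unfolding left_convolution_def
  using f by (intro bounded_operatorsI[where M = "ell_norm G 1 f"])
    (auto intro: convolution_ell convolution_scale_right convolution_add_right[where r = 2])

text \<open>The strict bound on the operator norm of a difference is traded for a pointwise
  estimate, the form in which the closure properties below are verified.\<close>

lemma reduced_Cstar_iff:
  "T \<in> reduced_Cstar G \<longleftrightarrow> T \<in> bounded_operators G \<and>
     (\<forall>\<epsilon>>0. \<exists>f\<in>ell G 1. \<forall>g\<in>ell G 2.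
        ell_norm G 2 (\<lambda>x. T g x - convolution G f g x) \<le> \<epsilon> * ell_norm G 2 g)"
    (is "_ \<longleftrightarrow> ?b \<and> ?approx")
proof -
  let ?D = "\<lambda>f. \<lambda>g\<in>ell G 2. \<lambda>x. T g x - left_convolution G f g x"
  have D: "?D f \<in> bounded_operators G" if T: "T \<in> bounded_operators G" and f: "f \<in> ell G 1" for f
  proof (rule bounded_operatorsI[where M = "operator_norm G T + ell_norm G 1 f"])
    fix g assume g: "g \<in> ell G 2"
    note c = convolution_ell[OF f g]
    show "(\<lambda>x. T g x - left_convolution G f g x) \<in> ell G 2"
      using g c by (simp add: left_convolution_def ell_diff bounded_operatorsD(1)[OF T])
    have "ell_norm G 2 (\<lambda>x. T g x - convolution G f g x)
        \<le> ell_norm G 2 (T g) + ell_norm G 2 (convolution G f g)"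
      using c by (intro ell_diff bounded_operatorsD(1)[OF T g]) auto
    also have "\<dots> \<le> operator_norm G T * ell_norm G 2 g + ell_norm G 1 f * ell_norm G 2 g"
      using c by (intro add_mono operator_norm_bound T g) auto
    finally show "ell_norm G 2 (\<lambda>x. T g x - left_convolution G f g x)
        \<le> (operator_norm G T + ell_norm G 1 f) * ell_norm G 2 g"
      using g by (simp add: left_convolution_def distrib_right)
    show "(\<lambda>x. T (\<lambda>x. c * g x) x - left_convolution G f (\<lambda>x. c * g x) x)
        = (\<lambda>x. c * (T g x - left_convolution G f g x))" for c
      using g by (simp add: bounded_operatorsD(4)[OF T] left_convolution_def ell_scale(1)
          convolution_scale_right right_diff_distrib)
    fix h assume h: "h \<in> ell G 2"
    show "(\<lambda>x. T (\<lambda>x. g x + h x) x - left_convolution G f (\<lambda>x. g x + h x) x)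
        = (\<lambda>x. T g x - left_convolution G f g x + (T h x - left_convolution G f h x))"
      using g h by (simp add: bounded_operatorsD(3)[OF T] left_convolution_def ell_add(1)
          convolution_add_right[OF f g h] algebra_simps)
  qed
  show ?thesis
  proof (intro iffI conjI allI impI)
    assume T: "T \<in> reduced_Cstar G"
    then show b: ?b by (simp add: reduced_Cstar_def)
    fix \<epsilon> :: real assume "0 < \<epsilon>"
    with T obtain f where f: "f \<in> ell G 1" "operator_norm G (?D f) < \<epsilon>"
      by (auto simp: reduced_Cstar_def)
    have "ell_norm G 2 (\<lambda>x. T g x - convolution G f g x) \<le> \<epsilon> * ell_norm G 2 g"
      if g: "g \<in> ell G 2" for g
    proof -
      have "ell_norm G 2 (\<lambda>x. T g x - convolution G f g x)
          \<le> operator_norm G (?D f) * ell_norm G 2 g"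
        using operator_norm_bound[OF D[OF b f(1)] g] g by (simp add: left_convolution_def)
      also have "\<dots> \<le> \<epsilon> * ell_norm G 2 g" using f by (intro mult_right_mono) auto
      finally show ?thesis .
    qed
    with f show "\<exists>f\<in>ell G 1. \<forall>g\<in>ell G 2.
        ell_norm G 2 (\<lambda>x. T g x - convolution G f g x) \<le> \<epsilon> * ell_norm G 2 g" by blast
  next
    assume T: "?b \<and> ?approx"
    have "\<exists>f\<in>ell G 1. operator_norm G (?D f) < \<epsilon>" if "0 < \<epsilon>" for \<epsilon>
    proof -
      \<comment> \<open>Half of \<epsilon> is used because the definition asks for a strict
        inequality.\<close>
      from that T obtain f where f: "f \<in> ell G 1"
        "\<And>g. g \<in> ell G 2 \<Longrightarrow> ell_norm G 2 (\<lambda>x. T g x - convolution G f g x) \<le> \<epsilon> / 2 * ell_norm G 2 g"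
        by (meson half_gt_zero)
      have "operator_norm G (?D f) \<le> \<epsilon> / 2"
        using f that by (intro operator_norm_le) (auto simp: left_convolution_def)
      with f that show ?thesis by (intro bexI[of _ f]) auto
    qed
    with T show "T \<in> reduced_Cstar G" by (auto simp: reduced_Cstar_def)
  qed
qed

lemma reduced_CstarI:
  assumes "T \<in> bounded_operators G"
    and "\<And>\<epsilon>. 0 < \<epsilon> \<Longrightarrow> \<exists>f\<in>ell G 1. \<forall>g\<in>ell G 2.
        ell_norm G 2 (\<lambda>x. T g x - convolution G f g x) \<le> \<epsilon> * ell_norm G 2 g"
  shows "T \<in> reduced_Cstar G"
  using assms by (auto simp: reduced_Cstar_iff)

lemma reduced_Cstar_bounded: "T \<in> reduced_Cstar G \<Longrightarrow> T \<in> bounded_operators G"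
  by (simp add: reduced_Cstar_def)

lemma reduced_Cstar_approx:
  assumes "T \<in> reduced_Cstar G" "0 < \<epsilon>"
  obtains f where "f \<in> ell G 1"
    "\<And>g. g \<in> ell G 2 \<Longrightarrow> ell_norm G 2 (\<lambda>x. T g x - convolution G f g x) \<le> \<epsilon> * ell_norm G 2 g"
proof -
  have "\<exists>f\<in>ell G 1. \<forall>g\<in>ell G 2.
      ell_norm G 2 (\<lambda>x. T g x - convolution G f g x) \<le> \<epsilon> * ell_norm G 2 g"
    using assms by (simp add: reduced_Cstar_iff)
  then show thesis using that by blast
qed

lemma left_convolution_reduced_Cstar:
  assumes f: "f \<in> ell G 1"
  shows "left_convolution G f \<in> reduced_Cstar G"
proof (rule reduced_CstarI[OF left_convolution_bounded[OF f]])
  show "\<exists>h\<in>ell G 1. \<forall>g\<in>ell G 2. ell_norm G 2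
      (\<lambda>x. left_convolution G f g x - convolution G h g x) \<le> \<epsilon> * ell_norm G 2 g" if "0 < \<epsilon>" for \<epsilon>
    using f that by (intro bexI[of _ f]) (auto simp: left_convolution_def)
qed

lemma left_convolution_delta: "left_convolution G (group_delta G) = (\<lambda>g\<in>ell G 2. g)"
  by (auto simp: left_convolution_def restrict_def convolution_delta_left ell_support)

lemma reduced_Cstar_one: "(\<lambda>g\<in>ell G 2. g) \<in> reduced_Cstar G"
  using left_convolution_reduced_Cstar[OF delta_ell(1)] by (simp add: left_convolution_delta)

lemma reduced_Cstar_zero: "(\<lambda>g\<in>ell G 2. \<lambda>x. 0) \<in> reduced_Cstar G"
proof -
  have "left_convolution G (\<lambda>x. 0) = (\<lambda>g\<in>ell G 2. \<lambda>x. 0)"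
    by (simp add: left_convolution_def convolution_def fun_eq_iff)
  then show ?thesis using left_convolution_reduced_Cstar[of "\<lambda>x. 0"] by simp
qed

lemma reduced_Cstar_add:
  assumes S: "S \<in> reduced_Cstar G" and T: "T \<in> reduced_Cstar G"
  shows "(\<lambda>g\<in>ell G 2. \<lambda>x. S g x + T g x) \<in> reduced_Cstar G"
proof (rule reduced_CstarI)
  note S' = reduced_Cstar_bounded[OF S] and T' = reduced_Cstar_bounded[OF T]
  show "(\<lambda>g\<in>ell G 2. \<lambda>x. S g x + T g x) \<in> bounded_operators G"
  proof (rule bounded_operatorsI[where M = "operator_norm G S + operator_norm G T"])
    fix f assume f: "f \<in> ell G 2"
    have "ell_norm G 2 (\<lambda>x. S f x + T f x) \<le> ell_norm G 2 (S f) + ell_norm G 2 (T f)"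
      by (intro ell_add bounded_operatorsD(1)[OF S' f] bounded_operatorsD(1)[OF T' f]) auto
    also have "\<dots> \<le> operator_norm G S * ell_norm G 2 f + operator_norm G T * ell_norm G 2 f"
      by (intro add_mono operator_norm_bound S' T' f)
    finally show "ell_norm G 2 (\<lambda>x. S f x + T f x)
        \<le> (operator_norm G S + operator_norm G T) * ell_norm G 2 f"
      by (simp add: distrib_right)
  qed (auto simp: bounded_operatorsD(1,3,4)[OF S'] bounded_operatorsD(1,3,4)[OF T'] ell_add(1)
      distrib_left)
  fix \<epsilon> :: real assume "0 < \<epsilon>"
  then have e: "0 < \<epsilon> / 2" by simp
  obtain f where f: "f \<in> ell G 1"
    "\<And>g. g \<in> ell G 2 \<Longrightarrow> ell_norm G 2 (\<lambda>x. S g x - convolution G f g x) \<le> \<epsilon> / 2 * ell_norm G 2 g"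
    using reduced_Cstar_approx[OF S e] by blast
  obtain h where h: "h \<in> ell G 1"
    "\<And>g. g \<in> ell G 2 \<Longrightarrow> ell_norm G 2 (\<lambda>x. T g x - convolution G h g x) \<le> \<epsilon> / 2 * ell_norm G 2 g"
    using reduced_Cstar_approx[OF T e] by blast
  show "\<exists>f\<in>ell G 1. \<forall>g\<in>ell G 2. ell_norm G 2
      (\<lambda>x. (\<lambda>g\<in>ell G 2. \<lambda>x. S g x + T g x) g x - convolution G f g x) \<le> \<epsilon> * ell_norm G 2 g"
  proof (intro bexI ballI)
    show "(\<lambda>x. f x + h x) \<in> ell G 1" using f h by (intro ell_add) auto
    fix g assume g: "g \<in> ell G 2"
    have d: "(\<lambda>x. S g x - convolution G f g x) \<in> ell G 2" "(\<lambda>x. T g x - convolution G h g x) \<in> ell G 2"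
      using f(1) h(1) g by (auto intro!: ell_diff(1) convolution_ell(1) bounded_operatorsD(1)[OF S']
          bounded_operatorsD(1)[OF T'])
    have "ell_norm G 2 (\<lambda>x. (S g x - convolution G f g x) + (T g x - convolution G h g x))
        \<le> \<epsilon> / 2 * ell_norm G 2 g + \<epsilon> / 2 * ell_norm G 2 g"
      using ell_add(2)[OF d] f(2)[OF g] h(2)[OF g] by simp
    moreover have "(\<lambda>x. (\<lambda>g\<in>ell G 2. \<lambda>x. S g x + T g x) g x - convolution G (\<lambda>x. f x + h x) g x)
        = (\<lambda>x. (S g x - convolution G f g x) + (T g x - convolution G h g x))"
      using g by (simp add: convolution_add_left[OF f(1) h(1) g] algebra_simps)
    ultimately show "ell_norm G 2 (\<lambda>x. (\<lambda>g\<in>ell G 2. \<lambda>x. S g x + T g x) g x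
        - convolution G (\<lambda>x. f x + h x) g x) \<le> \<epsilon> * ell_norm G 2 g"
      by (simp add: field_simps)
  qed
qed

text \<open>With approximants \<open>f\<close> of \<open>S\<close> and \<open>h\<close> of
  \<open>T\<close>, the error is (S - f) T + f (T - h). The tolerance for \<open>h\<close> involves
  the 1-norm of \<open>f\<close>, so \<open>f\<close> is chosen first; the 1 added in the
  denominators guards against vanishing norms.\<close>

lemma reduced_Cstar_compose:
  assumes S: "S \<in> reduced_Cstar G" and T: "T \<in> reduced_Cstar G"
  shows "compose (ell G 2) S T \<in> reduced_Cstar G"
proof (rule reduced_CstarI)
  note S' = reduced_Cstar_bounded[OF S] and T' = reduced_Cstar_bounded[OF T]
  define t where "t = operator_norm G T"
  have t: "0 \<le> t" unfolding t_def by (rule operator_norm_nonneg[OF T'])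
  show "compose (ell G 2) S T \<in> bounded_operators G"
    unfolding compose_def
  proof (rule bounded_operatorsI[where M = "operator_norm G S * t"])
    fix f assume f: "f \<in> ell G 2"
    have "ell_norm G 2 (S (T f)) \<le> operator_norm G S * ell_norm G 2 (T f)"
      by (intro operator_norm_bound S' bounded_operatorsD(1)[OF T' f])
    also have "\<dots> \<le> operator_norm G S * (t * ell_norm G 2 f)"
      unfolding t_def by (intro mult_left_mono operator_norm_bound T' f operator_norm_nonneg S')
    finally show "ell_norm G 2 (S (T f)) \<le> operator_norm G S * t * ell_norm G 2 f"
      by (simp add: mult.assoc)
  qed (auto simp: bounded_operatorsD(1,3,4)[OF S'] bounded_operatorsD(1,3,4)[OF T'])
  fix \<epsilon> :: real assume e: "0 < \<epsilon>"
  have e1: "0 < \<epsilon> / (2 * (t + 1))" using e t by simp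
  obtain f where f: "f \<in> ell G 1"
    "\<And>g. g \<in> ell G 2 \<Longrightarrow>
      ell_norm G 2 (\<lambda>x. S g x - convolution G f g x) \<le> \<epsilon> / (2 * (t + 1)) * ell_norm G 2 g"
    using reduced_Cstar_approx[OF S e1] by blast
  define u where "u = ell_norm G 1 f"
  have u: "0 \<le> u" by (simp add: u_def)
  have e2: "0 < \<epsilon> / (2 * (u + 1))" using e u by simp
  obtain h where h: "h \<in> ell G 1"
    "\<And>g. g \<in> ell G 2 \<Longrightarrow>
      ell_norm G 2 (\<lambda>x. T g x - convolution G h g x) \<le> \<epsilon> / (2 * (u + 1)) * ell_norm G 2 g"
    using reduced_Cstar_approx[OF T e2] by blast
  show "\<exists>f\<in>ell G 1. \<forall>g\<in>ell G 2.
      ell_norm G 2 (\<lambda>x. compose (ell G 2) S T g x - convolution G f g x) \<le> \<epsilon> * ell_norm G 2 g"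
  proof (intro bexI ballI)
    show "convolution G f h \<in> ell G 1" using f h by (intro convolution_ell) auto
    fix g assume g: "g \<in> ell G 2"
    define n where "n = ell_norm G 2 g"
    have n: "0 \<le> n" by (simp add: n_def)
    have Tg: "T g \<in> ell G 2" by (rule bounded_operatorsD(1)[OF T' g])
    have hg: "convolution G h g \<in> ell G 2" using h(1) g by (intro convolution_ell) auto
    have d1: "(\<lambda>x. S (T g) x - convolution G f (T g) x) \<in> ell G 2"
      using f(1) Tg by (intro ell_diff(1) convolution_ell(1) bounded_operatorsD(1)[OF S']) auto
    have d2: "(\<lambda>x. T g x - convolution G h g x) \<in> ell G 2"
      using Tg hg by (intro ell_diff(1)) auto
    have d3: "convolution G f (\<lambda>x. T g x - convolution G h g x) \<in> ell G 2"
      using f(1) d2 by (intro convolution_ell(1)) auto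
    have "ell_norm G 2 (\<lambda>x. S (T g) x - convolution G f (T g) x) \<le> \<epsilon> / (2 * (t + 1)) * (t * n)"
      using e t operator_norm_bound[OF T' g]
      by (intro order_trans[OF f(2)[OF Tg]] mult_left_mono) (auto simp: t_def n_def)
    also have "\<dots> = \<epsilon> / 2 * n * (t / (t + 1))" using t by (simp add: field_simps)
    also have "\<dots> \<le> \<epsilon> / 2 * n * 1" using e n t by (intro mult_left_mono) auto
    finally have 1: "ell_norm G 2 (\<lambda>x. S (T g) x - convolution G f (T g) x) \<le> \<epsilon> / 2 * n" by simp
    have "ell_norm G 2 (convolution G f (\<lambda>x. T g x - convolution G h g x))
        \<le> u * (\<epsilon> / (2 * (u + 1)) * n)"
      unfolding u_def n_def
      using h(2)[OF g] by (intro order_trans[OF convolution_ell(2)[OF f(1) d2]] mult_left_mono)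
        (auto simp: u_def)
    also have "\<dots> = \<epsilon> / 2 * n * (u / (u + 1))" using u by (simp add: field_simps)
    also have "\<dots> \<le> \<epsilon> / 2 * n * 1" using e n u by (intro mult_left_mono) auto
    finally have 2: "ell_norm G 2 (convolution G f (\<lambda>x. T g x - convolution G h g x)) \<le> \<epsilon> / 2 * n"
      by simp
    have "(\<lambda>x. compose (ell G 2) S T g x - convolution G (convolution G f h) g x)
        = (\<lambda>x. (S (T g) x - convolution G f (T g) x)
            + convolution G f (\<lambda>x. T g x - convolution G h g x) x)"
      using g by (simp add: compose_def convolution_diff_right[OF f(1) Tg hg]
          convolution_assoc[OF f(1) h(1) g])
    then show "ell_norm G 2 (\<lambda>x. compose (ell G 2) S T g x - convolution G (convolution G f h) g x)
        \<le> \<epsilon> * ell_norm G 2 g"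
      using ell_add(2)[OF d1 d3] 1 2 by (simp add: n_def)
  qed
qed

section \<open>Left convolution as an injective homomorphism\<close>

lemma left_convolution_mult:
  assumes "f \<in> ell G 1" "g \<in> ell G 1"
  shows "left_convolution G (convolution G f g)
       = compose (ell G 2) (left_convolution G f) (left_convolution G g)"
  using assms by (auto simp: left_convolution_def compose_def restrict_def fun_eq_iff
      convolution_ell(1) convolution_assoc[where r = 2])

lemma left_convolution_scale:
  "left_convolution G (\<lambda>x. c * f x) = (\<lambda>g\<in>ell G 2. \<lambda>x. c * left_convolution G f g x)"
  by (auto simp: left_convolution_def convolution_scale_left restrict_def)

lemma left_convolution_add:
  assumes "f \<in> ell G 1" "g \<in> ell G 1"
  shows "left_convolution G (\<lambda>x. f x + g x)
       = (\<lambda>h\<in>ell G 2. \<lambda>x. left_convolution G f h x + left_convolution G g h x)"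
  using assms by (auto simp: left_convolution_def convolution_add_left[where r = 2] restrict_def)

lemma left_convolution_inj:
  assumes f: "f \<in> ell G 1" and g: "g \<in> ell G 1" and eq: "left_convolution G f = left_convolution G g"
  shows "f = g"
proof -
  have "left_convolution G f (group_delta G) = left_convolution G g (group_delta G)"
    using eq by simp
  then show ?thesis
    using f g by (simp add: left_convolution_def delta_ell convolution_delta_right ell_support)
qed

text \<open>Scaling is composition with the convolution operator of a multiple of the unit, so
  closure under composition suffices.\<close>

lemma reduced_Cstar_scale:
  assumes T: "T \<in> reduced_Cstar G"
  shows "(\<lambda>g\<in>ell G 2. \<lambda>x. c * T g x) \<in> reduced_Cstar G"
proof -
  have "compose (ell G 2) (left_convolution G (\<lambda>x. c * group_delta G x)) T \<in> reduced_Cstar G"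
    by (intro reduced_Cstar_compose T left_convolution_reduced_Cstar ell_scale delta_ell) simp
  also have "compose (ell G 2) (left_convolution G (\<lambda>x. c * group_delta G x)) T
      = (\<lambda>g\<in>ell G 2. \<lambda>x. c * T g x)"
    unfolding left_convolution_scale left_convolution_delta
    by (auto simp: compose_def restrict_def fun_eq_iff bounded_operatorsD(1)[OF reduced_Cstar_bounded[OF T]])
  finally show ?thesis .
qed

end

text \<open>The laws are checked pointwise; since operators are \<open>undefined\<close> off
  \<open>ell G 2\<close>, they hold as equalities of functions.\<close>

lemma (in group) reduced_Cstar_unital_complex_algebra:
  "unital_complex_algebra (reduced_Cstar_algebra G)"
proof -
  let ?B = "reduced_Cstar_algebra G"
  note simps = reduced_Cstar_algebra_def compose_def restrict_def
  note op = bounded_operatorsD[OF reduced_Cstar_bounded]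
  have ab: "abelian_group ?B"
  proof (rule abelian_groupI)
    fix T assume "T \<in> carrier ?B"
    then have T: "T \<in> reduced_Cstar G" by (simp add: simps)
    show "\<exists>S\<in>carrier ?B. S \<oplus>\<^bsub>?B\<^esub> T = \<zero>\<^bsub>?B\<^esub>"
      using reduced_Cstar_scale[OF T, of "-1"]
      by (intro bexI[of _ "\<lambda>g\<in>ell G 2. \<lambda>x. (-1) * T g x"]) (simp_all add: simps fun_eq_iff)
    show "\<zero>\<^bsub>?B\<^esub> \<oplus>\<^bsub>?B\<^esub> T = T"
      by (simp add: simps fun_eq_iff op(2)[OF T])
  qed (simp_all add: reduced_Cstar_algebra_def reduced_Cstar_add reduced_Cstar_zero,
      simp_all add: restrict_def fun_eq_iff add.assoc add.commute)
  have mon: "Group.monoid ?B"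
  proof (rule monoidI)
    fix S T U assume "S \<in> carrier ?B" "T \<in> carrier ?B" "U \<in> carrier ?B"
    then have T: "T \<in> reduced_Cstar G" "U \<in> reduced_Cstar G" by (simp_all add: simps)
    show "\<one>\<^bsub>?B\<^esub> \<otimes>\<^bsub>?B\<^esub> T = T" "T \<otimes>\<^bsub>?B\<^esub> \<one>\<^bsub>?B\<^esub> = T"
      by (simp_all add: simps fun_eq_iff op(1)[OF T(1)] op(2)[OF T(1)])
    show "S \<otimes>\<^bsub>?B\<^esub> T \<otimes>\<^bsub>?B\<^esub> U = S \<otimes>\<^bsub>?B\<^esub> (T \<otimes>\<^bsub>?B\<^esub> U)"
      by (simp add: simps fun_eq_iff op(1)[OF T(2)])
  qed (simp_all add: reduced_Cstar_algebra_def reduced_Cstar_one reduced_Cstar_compose)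
  have ring: "ring ?B"
  proof (rule ringI[OF ab mon])
    fix S T U assume "S \<in> carrier ?B" "T \<in> carrier ?B" "U \<in> carrier ?B"
    then have T: "S \<in> reduced_Cstar G" "T \<in> reduced_Cstar G" "U \<in> reduced_Cstar G"
      by (simp_all add: simps)
    show "(S \<oplus>\<^bsub>?B\<^esub> T) \<otimes>\<^bsub>?B\<^esub> U = S \<otimes>\<^bsub>?B\<^esub> U \<oplus>\<^bsub>?B\<^esub> T \<otimes>\<^bsub>?B\<^esub> U"
      by (simp add: simps fun_eq_iff op(1)[OF T(3)])
    show "U \<otimes>\<^bsub>?B\<^esub> (S \<oplus>\<^bsub>?B\<^esub> T) = U \<otimes>\<^bsub>?B\<^esub> S \<oplus>\<^bsub>?B\<^esub> U \<otimes>\<^bsub>?B\<^esub> T"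
      by (simp add: simps fun_eq_iff op(1)[OF T(1)] op(1)[OF T(2)] op(3)[OF T(3)])
  qed
  have "Module.module (ring_of_type_algebra :: complex ring) ?B"
  proof (intro Module.module.intro module_axioms.intro)
    show "cring (ring_of_type_algebra :: complex ring)" by (rule cring_from_type_algebra)
    show "abelian_group ?B" by (rule ab)
    fix T assume "T \<in> carrier ?B"
    then have T: "T \<in> reduced_Cstar G" by (simp add: simps)
    show "\<one>\<^bsub>ring_of_type_algebra\<^esub> \<odot>\<^bsub>?B\<^esub> T = T"
      by (simp add: simps ring_of_type_algebra_def fun_eq_iff op(2)[OF T])
  qed (simp_all add: reduced_Cstar_algebra_def ring_of_type_algebra_def reduced_Cstar_scale,
      simp_all add: restrict_def fun_eq_iff algebra_simps)
  moreover have "(c \<odot>\<^bsub>?B\<^esub> S) \<otimes>\<^bsub>?B\<^esub> T = c \<odot>\<^bsub>?B\<^esub> (S \<otimes>\<^bsub>?B\<^esub> T) \<and>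
      S \<otimes>\<^bsub>?B\<^esub> (c \<odot>\<^bsub>?B\<^esub> T) = c \<odot>\<^bsub>?B\<^esub> (S \<otimes>\<^bsub>?B\<^esub> T)"
    if "S \<in> carrier ?B" "T \<in> carrier ?B" for c S T
  proof -
    have T: "S \<in> reduced_Cstar G" "T \<in> reduced_Cstar G" using that by (simp_all add: simps)
    show ?thesis by (simp add: simps fun_eq_iff op(1)[OF T(2)] op(4)[OF T(1)])
  qed
  ultimately show ?thesis using ring by (simp add: unital_complex_algebra_def)
qed

section \<open>Weighted sequence algebras\<close>

lemma sum_squares_le_square_sum:
  fixes a :: "'i \<Rightarrow> real"
  assumes "finite F" "\<And>i. i \<in> F \<Longrightarrow> 0 \<le> a i"
  shows "(\<Sum>i\<in>F. (a i)\<^sup>2) \<le> (\<Sum>i\<in>F. a i)\<^sup>2"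
  using assms
proof (induction F rule: finite_induct)
  case (insert i F)
  have "0 \<le> 2 * a i * (\<Sum>i\<in>F. a i)"
    using insert.prems by (intro mult_nonneg_nonneg sum_nonneg) auto
  with insert show ?case by (simp add: power2_sum)
qed simp

lemma ell_of_real_cmod:
  assumes "f \<in> ell G p"
  shows "(\<lambda>x. complex_of_real (cmod (f x))) \<in> ell G p"
    and "ell_norm G p (\<lambda>x. complex_of_real (cmod (f x))) = ell_norm G p f"
  using assms by (auto simp: ell_def ell_norm_def)

context group
begin

text \<open>Taking adjoints exchanges the two factors and reduces the claims to Young's inequality.
  The third claim supplies absolute convergence when the factor in \<open>ell G p\<close> stands on
  the left.\<close>

lemma convolution_ell_right:
  assumes f: "f \<in> ell G p" and g: "g \<in> ell G 1" and p: "1 \<le> p"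
  shows "convolution G f g \<in> ell G p"
    and "ell_norm G p (convolution G f g) \<le> ell_norm G p f * ell_norm G 1 g"
    and "x \<in> carrier G \<Longrightarrow> (\<lambda>y. f y * g (inv y \<otimes> x)) abs_summable_on carrier G"
proof -
  have eq: "convolution G f g = group_adjoint G (convolution G (group_adjoint G g) (group_adjoint G f))"
    unfolding group_adjoint_convolution using f g by (simp add: group_adjoint_involution ell_support)
  have c: "convolution G (group_adjoint G g) (group_adjoint G f) \<in> ell G p"
    "ell_norm G p (convolution G (group_adjoint G g) (group_adjoint G f))
      \<le> ell_norm G 1 (group_adjoint G g) * ell_norm G p (group_adjoint G f)"
    by (intro convolution_ell group_adjoint_ell f g p)+
  show "convolution G f g \<in> ell G p"
    unfolding eq by (intro group_adjoint_ell c)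
  show "ell_norm G p (convolution G f g) \<le> ell_norm G p f * ell_norm G 1 g"
    unfolding eq group_adjoint_ell(2)[OF c(1)]
    using c(2) group_adjoint_ell(2)[OF f] group_adjoint_ell(2)[OF g] by (simp add: mult.commute)
  show "(\<lambda>y. f y * g (inv y \<otimes> x)) abs_summable_on carrier G" if x: "x \<in> carrier G"
  proof -
    let ?t = "\<lambda>z. norm (group_adjoint G g z * group_adjoint G f (inv z \<otimes> inv x))"
    have "?t summable_on carrier G"
      using x p convolution_abs_summable(1)[OF group_adjoint_ell(1)[OF g]
          norm_le_ell_norm[OF group_adjoint_ell(1)[OF f]], of "inv x"] by simp
    then have "(\<lambda>y. ?t (inv x \<otimes> y)) summable_on carrier G"
      using x summable_on_reindex_bij_betw[OF bij_left_mult[of "inv x"], of ?t] by simp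
    moreover have "?t (inv x \<otimes> y) = norm (f y * g (inv y \<otimes> x))" if y: "y \<in> carrier G" for y
      using x y by (simp add: group_adjoint_def norm_mult inv_mult_group m_assoc mult.commute)
    ultimately show ?thesis by (simp cong: summable_on_cong)
  qed
qed

end

text \<open>The condition \<open>s * (1 - 1 / p) < 1 - \<gamma>\<close> is
  \<open>s < (1 - \<gamma>) q\<close> for the conjugate index q, in a form that covers p = 1 as
  well. The parameter \<gamma> is 0 for finite subgroups and polynomial weights, and
  \<open>2 powr \<alpha> - 1\<close> for subexponential ones.\<close>

locale weakly_subadditive_weight = group +
  fixes \<omega> :: "'a \<Rightarrow> real" and p \<gamma> K s :: real
  assumes weight: "weight_on G \<omega>" and p: "1 \<le> p" and \<gamma>: "0 \<le> \<gamma>" and K: "0 \<le> K"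
    and submult: "\<And>x y. x \<in> carrier G \<Longrightarrow> y \<in> carrier G \<Longrightarrow>
      \<omega> (x \<otimes> y) \<le> K * (\<omega> x * \<omega> y powr \<gamma> + \<omega> x powr \<gamma> * \<omega> y)"
    and s: "0 < s" "s * (1 - 1 / p) < 1 - \<gamma>"
    and summable: "(\<lambda>x. inverse (\<omega> x) powr s) summable_on carrier G"
begin

section \<open>Norms, exponents and constants of the interpolation\<close>

abbreviation "W \<equiv> weighted_ell G p \<omega>"
abbreviation "normW \<equiv> weighted_ell_norm G p \<omega>"
abbreviation "twist \<equiv> (\<lambda>f x. f x * complex_of_real (\<omega> x))"
abbreviation "twist_pow \<equiv> (\<lambda>f x. f x * complex_of_real (\<omega> x powr \<gamma>))"
abbreviation "norm_pow \<equiv> (\<lambda>f. ell_norm G 1 (twist_pow f))"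

text \<open>The number e = 1 - \<theta> solves e (1 + s) = 1 - \<gamma> - s (1 - 1 / p), which is
  chosen to ensure \<open>\<gamma> \<le> \<theta> - s * c\<close>.\<close>

definition "\<theta> = 1 - (1 - \<gamma> - s * (1 - 1 / p)) / (1 + s)"
text \<open>The third Hoelder exponent, complementary to \<open>(1 - \<theta>) / 2\<close> for the
  squares of \<open>f\<close> and \<open>\<theta> / p\<close> for the weighted p-th powers.\<close>

definition "c = 1 - (1 - \<theta>) / 2 - \<theta> / p"
definition "C = (\<Sum>\<^sub>\<infinity>x\<in>carrier G. inverse (\<omega> x) powr s) powr c"
text \<open>The constant that results when the interpolation inequality is solved for the 1-norm of
  \<open>twist_pow f\<close>.\<close>

definition "C0 = C powr (1 / \<theta>)"

text \<open>Submultiplicativity and symmetry give 1 = \<omega>(x x^-1) \<le> \<omega>(x)^2.\<close>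

lemma weight_ge_1:
  assumes "x \<in> carrier G"
  shows "1 \<le> \<omega> x"
proof (rule ccontr)
  assume "\<not> 1 \<le> \<omega> x"
  moreover have "0 \<le> \<omega> x" "\<omega> (inv x) = \<omega> x" "\<omega> \<one> = 1"
    using weight assms by (auto simp: weight_on_def)
  moreover have "\<omega> (x \<otimes> inv x) \<le> \<omega> x * \<omega> (inv x)"
    using weight assms inv_closed[OF assms] unfolding weight_on_def by blast
  moreover have "\<omega> x * \<omega> x \<le> \<omega> x * 1" using calculation by (intro mult_left_mono) auto
  ultimately show False using assms by simp
qed

lemma \<theta>: "0 < \<theta>" "\<theta> < 1"
proof -
  have "0 \<le> s * (1 - 1 / p)" using s p by simp
  then have "(1 - \<gamma> - s * (1 - 1 / p)) / (1 + s) < 1" using \<gamma> s by (simp add: field_simps)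
  then show "0 < \<theta>" by (simp add: \<theta>_def)
  show "\<theta> < 1" using s by (simp add: \<theta>_def)
qed

lemma c_pos: "0 < c"
proof -
  have "\<theta> / p \<le> \<theta>" using \<theta> p by (simp add: divide_le_eq)
  then show ?thesis using \<theta> by (simp add: c_def field_simps)
qed

text \<open>With e = 1 - \<theta>, the exponent c equals 1 - 1/p + e (1/p - 1/2) and is at most 1 -
  1/p + e. Hence s c + e \<le> s (1 - 1/p) + e (1 + s) = 1 - \<gamma>.\<close>

lemma exponent_le: "\<gamma> \<le> \<theta> - s * c"
proof -
  define e where "e = 1 - \<theta>"
  have e: "0 < e" "e * (1 + s) = 1 - \<gamma> - s * (1 - 1 / p)"
    using \<theta> s by (auto simp: e_def \<theta>_def)
  have c: "c = 1 - 1 / p + e * (1 / p - 1 / 2)"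
  proof -
    have "\<theta> / p = 1 / p - e / p" by (simp add: e_def diff_divide_distrib)
    then show ?thesis by (simp add: c_def e_def algebra_simps diff_divide_distrib)
  qed
  have "e * (1 / p - 1 / 2) \<le> e * 1"
    using e p by (intro mult_left_mono) (auto simp: field_simps)
  then have "s * c \<le> s * (1 - 1 / p) + s * e"
    unfolding c distrib_left using s by (intro add_left_mono mult_left_mono) auto
  then show ?thesis using e by (simp add: e_def algebra_simps)
qed

lemma C_nonneg: "0 \<le> C" "0 \<le> C0"
  by (auto simp: C_def C0_def)

section \<open>Interpolation between the 2-norm and the weighted norm\<close>

lemma W_iff: "f \<in> W \<longleftrightarrow> (\<forall>x. x \<notin> carrier G \<longrightarrow> f x = 0) \<and> twist f \<in> ell G p"
  by (simp add: weighted_ell_def)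

lemma W_support: "f \<in> W \<Longrightarrow> x \<notin> carrier G \<Longrightarrow> f x = 0"
  by (simp add: W_iff)

lemma normW_nonneg [simp]: "0 \<le> normW f"
  by (simp add: weighted_ell_norm_def)

text \<open>Hoelder's inequality for the splitting of |f| \<omega>^(\<theta> - s c) into |f|^(1 -
  \<theta>), (|f| \<omega>)^\<theta> and \<omega>^(- s c). The sum of squares stays restricted to
  \<open>F\<close>, so that the estimate can be applied to itself below.\<close>

lemma interpolation_finite:
  assumes f: "f \<in> W" and F: "finite F" "F \<subseteq> carrier G"
  shows "(\<Sum>x\<in>F. cmod (f x) * \<omega> x powr \<gamma>)
    \<le> (\<Sum>x\<in>F. (cmod (f x))\<^sup>2) powr ((1 - \<theta>) / 2) * normW f powr \<theta> * C"
proof -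
  have le: "cmod (f x) * \<omega> x powr \<gamma> \<le> (cmod (f x))\<^sup>2 powr ((1 - \<theta>) / 2)
      * (cmod (twist f x) powr p) powr (\<theta> / p) * (inverse (\<omega> x) powr s) powr c"
    if "x \<in> F" for x
  proof -
    have w: "1 \<le> \<omega> x" using weight_ge_1 that F by auto
    have "cmod (f x) * \<omega> x powr \<gamma> \<le> cmod (f x) * \<omega> x powr (\<theta> - s * c)"
      using w exponent_le by (intro mult_left_mono powr_mono) auto
    also have "\<dots> = cmod (f x) powr ((1 - \<theta>) + \<theta>) * \<omega> x powr (\<theta> + - (s * c))"
      by simp
    also have "\<dots> = cmod (f x) powr (1 - \<theta>) * (cmod (f x) powr \<theta> * \<omega> x powr \<theta>)
        * \<omega> x powr (- (s * c))"
      unfolding powr_add by simp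
    also have "cmod (f x) powr (1 - \<theta>) = (cmod (f x))\<^sup>2 powr ((1 - \<theta>) / 2)"
    proof -
      have "(cmod (f x))\<^sup>2 = cmod (f x) powr 2" by simp
      then show ?thesis by (simp only: powr_powr) simp
    qed
    also have "cmod (f x) powr \<theta> * \<omega> x powr \<theta> = (cmod (twist f x) powr p) powr (\<theta> / p)"
      using w p by (simp add: norm_mult powr_mult powr_powr)
    also have "\<omega> x powr (- (s * c)) = (inverse (\<omega> x) powr s) powr c"
      using w by (simp add: powr_powr powr_minus inverse_powr)
    finally show ?thesis .
  qed
  have "(\<Sum>x\<in>F. cmod (f x) * \<omega> x powr \<gamma>) \<le> (\<Sum>x\<in>F. (cmod (f x))\<^sup>2 powr ((1 - \<theta>) / 2)
      * (cmod (twist f x) powr p) powr (\<theta> / p) * (inverse (\<omega> x) powr s) powr c)"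
    using le by (rule sum_mono)
  also have "\<dots> \<le> (\<Sum>x\<in>F. (cmod (f x))\<^sup>2) powr ((1 - \<theta>) / 2)
      * (\<Sum>x\<in>F. cmod (twist f x) powr p) powr (\<theta> / p) * (\<Sum>x\<in>F. inverse (\<omega> x) powr s) powr c"
    using \<theta> p c_pos F by (intro Holder_sum3) (auto simp: c_def)
  also have "\<dots> \<le> (\<Sum>x\<in>F. (cmod (f x))\<^sup>2) powr ((1 - \<theta>) / 2)
      * (normW f powr p) powr (\<theta> / p) * C"
    unfolding C_def weighted_ell_norm_def using f F \<theta> p c_pos summable
    by (intro mult_mono powr_mono2 sum_le_ell_norm_powr finite_sum_le_infsum)
      (auto simp: W_iff sum_nonneg)
  finally show ?thesis using p by (simp add: powr_powr)
qed

text \<open>The sum of squares over \<open>F\<close> is at most S^2 for the sum \<open>S\<close> to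
  be bounded, so \<open>interpolation_finite\<close> gives S \<le> S^(1 - \<theta>) times a
  constant, and the finite number S^(1 - \<theta>) cancels. The resulting bound is uniform in
  \<open>F\<close>.\<close>

lemma twist_pow_ell:
  assumes f: "f \<in> W"
  shows "twist_pow f \<in> ell G 1" and "norm_pow f \<le> C0 * normW f"
proof -
  have bd: "(\<Sum>x\<in>F. cmod (twist_pow f x) powr 1) \<le> (C0 * normW f) powr 1"
    if F: "finite F" "F \<subseteq> carrier G" for F
  proof -
    define S where "S = (\<Sum>x\<in>F. cmod (f x) * \<omega> x powr \<gamma>)"
    have S0: "0 \<le> S" unfolding S_def by (intro sum_nonneg) auto
    have "S \<le> C0 * normW f"
    proof (cases "S = 0")
      case False
      with S0 have S: "0 < S" by simp
      have "(\<Sum>x\<in>F. (cmod (f x))\<^sup>2) \<le> (\<Sum>x\<in>F. cmod (f x))\<^sup>2"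
        by (intro sum_squares_le_square_sum F) auto
      also have "\<dots> \<le> S\<^sup>2"
        unfolding S_def
      proof (intro power_mono sum_mono sum_nonneg)
        fix x assume "x \<in> F"
        then have "1 \<le> \<omega> x powr \<gamma>" using weight_ge_1 F \<gamma> by (auto intro!: ge_one_powr_ge_zero)
        then have "cmod (f x) * 1 \<le> cmod (f x) * \<omega> x powr \<gamma>" by (intro mult_left_mono) auto
        then show "cmod (f x) \<le> cmod (f x) * \<omega> x powr \<gamma>" by simp
      qed auto
      finally have "(\<Sum>x\<in>F. (cmod (f x))\<^sup>2) powr ((1 - \<theta>) / 2) \<le> (S powr 2) powr ((1 - \<theta>) / 2)"
        using \<theta> S by (intro powr_mono2) (auto intro: sum_nonneg)
      then have "(\<Sum>x\<in>F. (cmod (f x))\<^sup>2) powr ((1 - \<theta>) / 2) \<le> S powr (1 - \<theta>)"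
        by (simp only: powr_powr) simp
      then have "S \<le> S powr (1 - \<theta>) * (normW f powr \<theta> * C)"
        using interpolation_finite[OF f F] C_nonneg mult_right_mono[of _ _ "normW f powr \<theta> * C"]
        unfolding S_def by (fastforce simp: mult.assoc)
      moreover have "S = S powr (1 - \<theta>) * S powr \<theta>"
        using S by (simp flip: powr_add)
      ultimately have "S powr (1 - \<theta>) * S powr \<theta> \<le> S powr (1 - \<theta>) * (normW f powr \<theta> * C)"
        by simp
      then have "S powr \<theta> \<le> normW f powr \<theta> * C"
        by (rule mult_left_le_imp_le) (use S in simp)
      then have "(S powr \<theta>) powr (1 / \<theta>) \<le> (normW f powr \<theta> * C) powr (1 / \<theta>)"
        using \<theta> by (intro powr_mono2) auto
      then show ?thesis
        using \<theta> S C_nonneg by (simp add: powr_powr powr_mult C0_def mult.commute)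
    qed (simp add: C_nonneg)
    then show ?thesis
      using C_nonneg by (simp add: S_def norm_mult)
  qed
  show "twist_pow f \<in> ell G 1" "norm_pow f \<le> C0 * normW f"
    using ell_bounded_finite_sums[of 1 "C0 * normW f" G "twist_pow f"] bd C_nonneg
    by (auto simp: W_support[OF f])
qed

lemma W_ell_1:
  assumes f: "f \<in> W"
  shows "f \<in> ell G 1" and "ell_norm G 1 f \<le> norm_pow f"
proof -
  have "cmod (f x) \<le> cmod (twist_pow f x)" if "x \<in> carrier G" for x
  proof -
    have "1 \<le> \<omega> x powr \<gamma>" using weight_ge_1[OF that] \<gamma> by (intro ge_one_powr_ge_zero) auto
    then have "cmod (f x) * 1 \<le> cmod (f x) * \<omega> x powr \<gamma>" by (intro mult_left_mono) auto
    then show ?thesis by (simp add: norm_mult)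
  qed
  then show "f \<in> ell G 1" "ell_norm G 1 f \<le> norm_pow f"
    using ell_mono[of 1 "twist_pow f" G f] twist_pow_ell(1)[OF f] by (auto simp: W_support[OF f])
qed

text \<open>Young's inequality for the product of \<open>f\<close> with the unit delta embeds
  \<open>ell G 1\<close> into \<open>ell G 2\<close>.\<close>

lemma W_ell_2:
  assumes f: "f \<in> W"
  shows "f \<in> ell G 2"
  using convolution_ell(1)[OF W_ell_1(1)[OF f] delta_ell(1), of 2]
  by (simp add: convolution_delta_right W_support[OF f])

lemma interpolation:
  assumes f: "f \<in> W"
  shows "norm_pow f \<le> C * ell_norm G 2 f powr (1 - \<theta>) * normW f powr \<theta>"
proof -
  have "norm_pow f = (\<Sum>\<^sub>\<infinity>x\<in>carrier G. cmod (twist_pow f x))"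
    by (simp add: ell_norm_1)
  also have "\<dots> \<le> C * ell_norm G 2 f powr (1 - \<theta>) * normW f powr \<theta>"
  proof (rule infsum_le_finite_sums[OF ell_1_summable[OF twist_pow_ell(1)[OF f]]])
    fix F assume F: "finite F" "F \<subseteq> carrier G"
    have "(\<Sum>x\<in>F. cmod (twist_pow f x)) = (\<Sum>x\<in>F. cmod (f x) * \<omega> x powr \<gamma>)"
      by (simp add: norm_mult)
    also have "\<dots> \<le> (\<Sum>x\<in>F. (cmod (f x))\<^sup>2) powr ((1 - \<theta>) / 2) * normW f powr \<theta> * C"
      by (rule interpolation_finite[OF f F])
    also have "\<dots> \<le> (ell_norm G 2 f powr 2) powr ((1 - \<theta>) / 2) * normW f powr \<theta> * C"
      using \<theta> C_nonneg sum_le_ell_norm_powr[OF W_ell_2[OF f] _ F]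
      by (intro mult_right_mono powr_mono2) (auto intro: sum_nonneg)
    also have "(ell_norm G 2 f powr 2) powr ((1 - \<theta>) / 2) = ell_norm G 2 f powr (1 - \<theta>)"
      by (simp only: powr_powr) simp
    finally show "(\<Sum>x\<in>F. cmod (twist_pow f x))
        \<le> C * ell_norm G 2 f powr (1 - \<theta>) * normW f powr \<theta>"
      by (simp add: mult_ac)
  qed
  finally show ?thesis .
qed

section \<open>The weighted space as a normed algebra with involution\<close>

lemma W_add:
  assumes "f \<in> W" "g \<in> W"
  shows "(\<lambda>x. f x + g x) \<in> W" and "normW (\<lambda>x. f x + g x) \<le> normW f + normW g"
  using assms ell_add[of "twist f" G p "twist g"] p
  by (auto simp: W_iff weighted_ell_norm_def distrib_right)

lemma W_scale:
  assumes "f \<in> W"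
  shows "(\<lambda>x. k * f x) \<in> W" and "normW (\<lambda>x. k * f x) = cmod k * normW f"
  using assms ell_scale[of "twist f" G p k] p by (auto simp: W_iff weighted_ell_norm_def mult.assoc)

lemma W_zero: "(\<lambda>x. 0) \<in> W"
  using p by (simp add: W_iff)

lemma W_delta: "group_delta G \<in> W" "normW (group_delta G) = 1"
proof -
  have "twist (group_delta G) = group_delta G"
    using weight by (auto simp: weight_on_def fun_eq_iff)
  then show "group_delta G \<in> W" "normW (group_delta G) = 1"
    using delta_ell[of p] p by (auto simp: W_iff weighted_ell_norm_def)
qed

lemma W_adjoint:
  assumes "f \<in> W"
  shows "group_adjoint G f \<in> W" and "normW (group_adjoint G f) = normW f"
proof -
  have "twist (group_adjoint G f) = group_adjoint G (twist f)"
    using weight by (auto simp: weight_on_def group_adjoint_def fun_eq_iff)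
  then show "group_adjoint G f \<in> W" "normW (group_adjoint G f) = normW f"
    using assms group_adjoint_ell[of "twist f" p]
    by (auto simp: W_iff weighted_ell_norm_def group_adjoint_def)
qed

text \<open>The weight inequality, applied under the sum to x = y (y^-1 x), dominates |f * g|
  \<omega> pointwise by \<open>K\<close> times |f \<omega>| * |g \<omega>^\<gamma>| + |f
  \<omega>^\<gamma>| * |g \<omega>|, and Young's inequality bounds both convolutions.\<close>

lemma W_convolution:
  assumes f: "f \<in> W" and g: "g \<in> W"
  shows "convolution G f g \<in> W"
    and "normW (convolution G f g) \<le> K * (normW f * norm_pow g + norm_pow f * normW g)"
proof -
  \<comment> \<open>Moduli keep all norms and make the terms of \<open>P\<close> and
    \<open>Q\<close> nonnegative, so that no cancellation occurs in these convolutions.\<close>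
  define f1 f2 g1 g2 where "f1 = (\<lambda>x. complex_of_real (cmod (twist f x)))"
    and "f2 = (\<lambda>x. complex_of_real (cmod (twist_pow f x)))"
    and "g1 = (\<lambda>x. complex_of_real (cmod (twist g x)))"
    and "g2 = (\<lambda>x. complex_of_real (cmod (twist_pow g x)))"
  have f1: "f1 \<in> ell G p" "ell_norm G p f1 = normW f"
    using f unfolding f1_def weighted_ell_norm_def by (auto simp only: W_iff ell_of_real_cmod)
  have g1: "g1 \<in> ell G p" "ell_norm G p g1 = normW g"
    using g unfolding g1_def weighted_ell_norm_def by (auto simp only: W_iff ell_of_real_cmod)
  have f2: "f2 \<in> ell G 1" "ell_norm G 1 f2 = norm_pow f"
    unfolding f2_def using twist_pow_ell(1)[OF f] by (auto simp only: ell_of_real_cmod)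
  have g2: "g2 \<in> ell G 1" "ell_norm G 1 g2 = norm_pow g"
    unfolding g2_def using twist_pow_ell(1)[OF g] by (auto simp only: ell_of_real_cmod)
  define P Q where "P = convolution G f1 g2" and "Q = convolution G f2 g1"
  have P: "P \<in> ell G p" "ell_norm G p P \<le> normW f * norm_pow g"
    unfolding P_def using convolution_ell_right[OF f1(1) g2(1) p] f1(2) g2(2) by auto
  have Q: "Q \<in> ell G p" "ell_norm G p Q \<le> norm_pow f * normW g"
    unfolding Q_def using convolution_ell[OF f2(1) g1(1) p] f2(2) g1(2) by auto
  have PQ: "(\<lambda>x. complex_of_real K * (P x + Q x)) \<in> ell G p"
    "ell_norm G p (\<lambda>x. complex_of_real K * (P x + Q x)) = K * ell_norm G p (\<lambda>x. P x + Q x)"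
    using ell_scale[OF ell_add(1)[OF P(1) Q(1) p], of "complex_of_real K"] p K by auto
  have le: "cmod (twist (convolution G f g) x) \<le> cmod (complex_of_real K * (P x + Q x))"
    if x: "x \<in> carrier G" for x
  proof -
    define a b where "a = (\<lambda>y. cmod (f1 y * g2 (inv y \<otimes> x)))"
      and "b = (\<lambda>y. cmod (f2 y * g1 (inv y \<otimes> x)))"
    have a: "a summable_on carrier G"
      unfolding a_def by (rule convolution_ell_right(3)[OF f1(1) g2(1) p x])
    have b: "b summable_on carrier G"
      unfolding b_def using p
      by (intro convolution_abs_summable(1)[OF f2(1) norm_le_ell_norm[OF g1(1)] x]) auto
    have s: "(\<lambda>y. f y * g (inv y \<otimes> x)) abs_summable_on carrier G"
      using convolution_abs_summable(1)[OF W_ell_1(1)[OF f] norm_le_ell_norm[OF W_ell_1(1)[OF g]] x]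
      by simp
    have "cmod (twist (convolution G f g) x) \<le> (\<Sum>\<^sub>\<infinity>y\<in>carrier G. cmod (f y * g (inv y \<otimes> x))) * \<omega> x"
    proof -
      have "cmod (twist (convolution G f g) x) = cmod (convolution G f g x) * \<omega> x"
        using weight_ge_1[OF x] by (simp add: norm_mult)
      moreover have "cmod (convolution G f g x) \<le> (\<Sum>\<^sub>\<infinity>y\<in>carrier G. cmod (f y * g (inv y \<otimes> x)))"
        using norm_infsum_bound[OF s] x by (simp add: convolution_def)
      ultimately show ?thesis using weight_ge_1[OF x] by (simp add: mult_right_mono)
    qed
    also have "\<dots> = (\<Sum>\<^sub>\<infinity>y\<in>carrier G. cmod (f y * g (inv y \<otimes> x)) * \<omega> x)"
      by (simp add: infsum_cmult_left')
    also have "\<dots> \<le> (\<Sum>\<^sub>\<infinity>y\<in>carrier G. K * (a y + b y))"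
    proof (rule infsum_mono)
      show "(\<lambda>y. cmod (f y * g (inv y \<otimes> x)) * \<omega> x) summable_on carrier G"
        using s by (rule summable_on_cmult_left)
      show "(\<lambda>y. K * (a y + b y)) summable_on carrier G"
        by (intro summable_on_cmult_right summable_on_add a b)
      fix y assume y: "y \<in> carrier G"
      let ?z = "inv y \<otimes> x"
      have z: "?z \<in> carrier G" using x y by simp
      have "\<omega> (y \<otimes> ?z) \<le> K * (\<omega> y * \<omega> ?z powr \<gamma> + \<omega> y powr \<gamma> * \<omega> ?z)"
        by (rule submult[OF y z])
      moreover have "y \<otimes> ?z = x" using x y by (simp add: inv_cancel)
      ultimately have "cmod (f y * g ?z) * \<omega> x
          \<le> cmod (f y * g ?z) * (K * (\<omega> y * \<omega> ?z powr \<gamma> + \<omega> y powr \<gamma> * \<omega> ?z))"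
        by (intro mult_left_mono) auto
      also have "\<dots> = K * (a y + b y)"
        using weight_ge_1[OF y] weight_ge_1[OF z]
        by (simp add: a_def b_def f1_def f2_def g1_def g2_def norm_mult algebra_simps)
      finally show "cmod (f y * g ?z) * \<omega> x \<le> K * (a y + b y)" .
    qed
    also have "\<dots> = K * (infsum a (carrier G) + infsum b (carrier G))"
      by (simp add: infsum_cmult_right' infsum_add[OF a b])
    also have "\<dots> = cmod (complex_of_real K * (P x + Q x))"
    proof -
      have "(\<Sum>\<^sub>\<infinity>y\<in>carrier G. complex_of_real (a y)) = complex_of_real (infsum a (carrier G))"
        by (intro infsumI has_sum_of_real has_sum_infsum a)
      then have "P x = complex_of_real (infsum a (carrier G))"
        using x by (simp add: P_def convolution_def a_def f1_def g2_def norm_mult)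
      moreover have "(\<Sum>\<^sub>\<infinity>y\<in>carrier G. complex_of_real (b y)) = complex_of_real (infsum b (carrier G))"
        by (intro infsumI has_sum_of_real has_sum_infsum b)
      then have "Q x = complex_of_real (infsum b (carrier G))"
        using x by (simp add: Q_def convolution_def b_def f2_def g1_def norm_mult)
      moreover have "0 \<le> infsum a (carrier G)" "0 \<le> infsum b (carrier G)"
        by (auto simp: a_def b_def intro: infsum_nonneg)
      ultimately show ?thesis using K by (simp add: norm_mult flip: of_real_add)
    qed
    finally show ?thesis .
  qed
  have supp: "x \<notin> carrier G \<Longrightarrow> twist (convolution G f g) x = 0" for x
    by (simp add: convolution_support)
  have m: "twist (convolution G f g) \<in> ell G p"
    "ell_norm G p (twist (convolution G f g)) \<le> ell_norm G p (\<lambda>x. complex_of_real K * (P x + Q x))"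
    using ell_mono[OF _ PQ(1) supp le] p by auto
  then show "convolution G f g \<in> W"
    by (simp add: W_iff convolution_support)
  have "normW (convolution G f g) \<le> K * ell_norm G p (\<lambda>x. P x + Q x)"
    using m(2) PQ(2) by (simp add: weighted_ell_norm_def)
  also have "\<dots> \<le> K * (normW f * norm_pow g + norm_pow f * normW g)"
    using ell_add(2)[OF P(1) Q(1) p] P(2) Q(2) K by (intro mult_left_mono) auto
  finally show "normW (convolution G f g) \<le> K * (normW f * norm_pow g + norm_pow f * normW g)" .
qed

text \<open>\<open>norm_pow\<close> of either factor is at most \<open>C0\<close> times its weighted
  norm; this is the Banach algebra inequality.\<close>

lemma normW_convolution_le:
  assumes f: "f \<in> W" and g: "g \<in> W"
  shows "normW (convolution G f g) \<le> 2 * K * C0 * (normW f * normW g)"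
proof -
  have "normW (convolution G f g) \<le> K * (normW f * norm_pow g + norm_pow f * normW g)"
    by (rule W_convolution[OF f g])
  also have "\<dots> \<le> K * (normW f * (C0 * normW g) + (C0 * normW f) * normW g)"
    using twist_pow_ell(2)[OF f] twist_pow_ell(2)[OF g] K
    by (intro mult_left_mono add_mono mult_right_mono) auto
  finally show ?thesis by (simp add: algebra_simps)
qed

text \<open>For equal factors the interpolation bound replaces \<open>C0\<close>. The weighted norm
  enters with exponent 1 + \<theta> < 2, which is why repeated squaring gains on it.\<close>

lemma normW_convolution_square_le:
  assumes f: "f \<in> W"
  shows "normW (convolution G f f)
    \<le> 2 * K * C * ell_norm G 2 f powr (1 - \<theta>) * normW f powr (1 + \<theta>)"
proof -
  have "normW (convolution G f f) \<le> 2 * K * (normW f * norm_pow f)"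
    using W_convolution(2)[OF f f] by (simp add: algebra_simps)
  also have "\<dots> \<le> 2 * K * (normW f * (C * ell_norm G 2 f powr (1 - \<theta>) * normW f powr \<theta>))"
    using K interpolation[OF f] by (intro mult_left_mono) auto
  finally show ?thesis by (simp add: powr_add mult_ac)
qed

text \<open>Fatou's lemma: over each finite set the partial sums converge, and they stay below
  \<open>B powr p\<close>.\<close>

lemma W_limit:
  assumes f: "\<And>n. f n \<in> W" "\<And>n. normW (f n) \<le> B" and lim: "\<And>x. (\<lambda>n. f n x) \<longlonglongrightarrow> g x"
  shows "g \<in> W" and "normW g \<le> B"
proof -
  have B: "0 \<le> B" using f(2)[of 0] normW_nonneg[of "f 0"] by linarith
  have supp: "g x = 0" if "x \<notin> carrier G" for x
    using lim[of x] W_support[OF f(1) that] by (simp add: LIMSEQ_const_iff)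
  have bd: "(\<Sum>x\<in>F. cmod (twist g x) powr p) \<le> B powr p" if F: "finite F" "F \<subseteq> carrier G" for F
  proof (rule LIMSEQ_le_const2)
    show "(\<lambda>n. \<Sum>x\<in>F. cmod (twist (f n) x) powr p) \<longlonglongrightarrow> (\<Sum>x\<in>F. cmod (twist g x) powr p)"
      using p by (intro tendsto_sum tendsto_powr' tendsto_norm tendsto_mult lim tendsto_const) auto
    have "(\<Sum>x\<in>F. cmod (twist (f n) x) powr p) \<le> normW (f n) powr p" for n
      unfolding weighted_ell_norm_def using f(1) F p by (intro sum_le_ell_norm_powr) (auto simp: W_iff)
    also have "normW (f n) powr p \<le> B powr p" for n
      using f(2) p by (intro powr_mono2) auto
    finally show "\<exists>N. \<forall>n\<ge>N. (\<Sum>x\<in>F. cmod (twist (f n) x) powr p) \<le> B powr p" by blast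
  qed
  show "g \<in> W" "normW g \<le> B"
    using ell_bounded_finite_sums[of p B G "twist g"] bd B p supp
    by (auto simp: W_iff weighted_ell_norm_def)
qed

section \<open>The algebra structure and the embedding\<close>

lemma weighted_ell_unital_complex_algebra:
  "unital_complex_algebra (weighted_ell_algebra G p \<omega>)"
proof -
  let ?A = "weighted_ell_algebra G p \<omega>"
  note simps = weighted_ell_algebra_def
  note W1 = W_ell_1(1)
  have ab: "abelian_group ?A"
  proof (rule abelian_groupI)
    fix f assume f: "f \<in> carrier ?A"
    show "\<exists>g\<in>carrier ?A. g \<oplus>\<^bsub>?A\<^esub> f = \<zero>\<^bsub>?A\<^esub>"
      using f W_scale(1)[of f "-1"] by (intro bexI[of _ "\<lambda>x. (-1) * f x"]) (auto simp: simps)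
  qed (auto simp: simps W_add W_zero add.assoc add.commute)
  have mon: "Group.monoid ?A"
    by (rule monoidI) (auto simp: simps W_convolution W_delta convolution_delta_left W_support
        convolution_delta_right W1 intro: convolution_assoc[where r = 1])
  have ring: "ring ?A"
    by (rule ringI[OF ab mon]) (auto simp: simps W1 convolution_add_left[where r = 1]
        convolution_add_right[where r = 1])
  have "Module.module (ring_of_type_algebra :: complex ring) ?A"
  proof (intro Module.module.intro module_axioms.intro)
    show "cring (ring_of_type_algebra :: complex ring)" by (rule cring_from_type_algebra)
    show "abelian_group ?A" by (rule ab)
  qed (auto simp: simps ring_of_type_algebra_def W_scale algebra_simps)
  then show ?thesis
    using ring by (auto simp: unital_complex_algebra_def simps convolution_scale_left
        convolution_scale_right)
qed

lemma left_convolution_unital_embedding: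
  "unital_embedding (weighted_ell_algebra G p \<omega>) (reduced_Cstar_algebra G) (left_convolution G)"
  unfolding unital_embedding_def
proof (intro conjI allI ballI)
  show "left_convolution G \<in> ring_hom (weighted_ell_algebra G p \<omega>) (reduced_Cstar_algebra G)"
    by (rule ring_hom_memI) (auto simp: weighted_ell_algebra_def reduced_Cstar_algebra_def W_ell_1(1)
        left_convolution_reduced_Cstar left_convolution_mult left_convolution_add
        left_convolution_delta)
  show "inj_on (left_convolution G) (carrier (weighted_ell_algebra G p \<omega>))"
    by (auto simp: weighted_ell_algebra_def inj_on_def W_ell_1(1) intro: left_convolution_inj)
qed (simp add: weighted_ell_algebra_def reduced_Cstar_algebra_def left_convolution_scale)

end

section \<open>Norm-controlled inversion\<close>

text \<open>Since \<open>m < 2\<close>, the term \<open>\<eta> * 2 ^ k\<close> eventually exceeds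
  the other one by at least \<open>k\<close>, so the terms are dominated by the powers of
  \<open>exp (- 1)\<close>.\<close>

lemma summable_exp_minus_dominated_power:
  fixes m \<eta> z l :: real
  assumes "0 < \<eta>" "0 \<le> m" "m < 2"
  shows "summable (\<lambda>k. exp (- \<eta> * 2 ^ k + m ^ k * (z + real k * l)))"
proof -
  \<comment> \<open>The competing terms divided by \<open>2 ^ k\<close>; the summand
    \<open>real k * (1 / 2) ^ k\<close> provides the margin \<open>k\<close>.\<close>
  have "(\<lambda>k. (m / 2) ^ k * z + l * (real k * (m / 2) ^ k) + real k * (1 / 2) ^ k)
      \<longlonglongrightarrow> 0 * z + l * 0 + 0"
    using assms by (intro tendsto_intros LIMSEQ_power_zero powser_times_n_limit_0) auto
  then have "eventually (\<lambda>k. (m / 2) ^ k * z + l * (real k * (m / 2) ^ k) + real k * (1 / 2) ^ k < \<eta>)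
      sequentially"
    using assms(1) by (intro order_tendstoD(2)[where y = "0 * z + l * 0 + 0"]) auto
  then have "eventually (\<lambda>k. norm (exp (- \<eta> * 2 ^ k + m ^ k * (z + real k * l))) \<le> exp (- 1) ^ k)
      sequentially"
  proof eventually_elim
    case (elim k)
    have "2 ^ k * ((m / 2) ^ k * z + l * (real k * (m / 2) ^ k) + real k * (1 / 2) ^ k) \<le> 2 ^ k * \<eta>"
      using elim by (intro mult_left_mono) auto
    then have "m ^ k * (z + real k * l) + real k \<le> \<eta> * 2 ^ k"
      by (simp add: power_divide algebra_simps)
    then show ?case by (simp add: exp_of_nat_mult[symmetric])
  qed
  moreover have "summable (\<lambda>k. exp (- 1 :: real) ^ k)" by (intro summable_geometric) auto
  ultimately show ?thesis by (rule summable_comparison_test_ev)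
qed

context weakly_subadditive_weight
begin

text \<open>The quantitative core, free of operators: the condition on \<open>v\<close> bounds
  \<open>a\<close> from below, \<open>b\<close> is a right inverse as a function, and
  \<open>B\<close> is fixed before \<open>a\<close> and \<open>b\<close>, so that it depends only on
  \<open>\<sigma>\<close> and \<open>\<tau>\<close>.\<close>

lemma inverse_bound:
  fixes \<sigma> \<tau> :: real
  assumes \<sigma>: "0 \<le> \<sigma>" and \<tau>: "0 \<le> \<tau>"
  obtains B where "0 \<le> B"
    "\<And>a b. a \<in> W \<Longrightarrow> normW a \<le> \<sigma> \<Longrightarrow>
      (\<And>v. v \<in> ell G 2 \<Longrightarrow> ell_norm G 2 v \<le> \<tau> * ell_norm G 2 (convolution G a v)) \<Longrightarrow>
      b \<in> ell G 2 \<Longrightarrow> convolution G a b = group_delta G \<Longrightarrow> b \<in> W \<and> normW b \<le> B"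
proof -
  \<comment> \<open>\<open>L\<close> will dominate the 1-norm of \<open>a\<close>; the summands 1
    make \<open>L\<close> and \<open>t\<close> positive. The choice of \<open>\<eta>\<close> gives 1
    - 1 / (t L)^2 = 1 - 2 \<eta> \<le> exp (-2 \<eta>), the contraction factor for squared
    2-norms.\<close>
  define L where "L = C0 * \<sigma> + 1"
  define t where "t = \<tau> + 1"
  define \<eta> where "\<eta> = 1 / (2 * t\<^sup>2 * L\<^sup>2)"
  define E where "E = 2 * K * C0"
  \<comment> \<open>\<open>D\<close> is at least 1 so that \<open>ln D\<close> is nonnegative;
    \<open>m\<close> is the exponent of the weighted norm in the squaring estimate.\<close>
  define D where "D = max 1 (2 * K * C)"
  define m where "m = 1 + \<theta>"
  \<comment> \<open>\<open>Z k\<close> will majorize the weighted norm of the power c^(2^k):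
    \<open>z\<close> makes \<open>Z 0\<close> the bound for c itself, and the exponent is built to
    satisfy the recursion that the squaring estimate imposes.\<close>
  define z where "z = ln (1 + E * \<sigma>\<^sup>2 / L\<^sup>2) + \<eta>"
  define Z where "Z = (\<lambda>k. exp (- \<eta> * 2 ^ k + m ^ k * (z + real k * ln D)))"
  define B where "B = E * exp (E * suminf Z) * \<sigma> / L\<^sup>2"
  have L: "0 < L" using \<sigma> C_nonneg by (simp add: L_def add_nonneg_pos)
  have t: "0 < t" using \<tau> by (simp add: t_def)
  have \<eta>: "0 < \<eta>" using L t by (simp add: \<eta>_def)
  have E: "0 \<le> E" using K C_nonneg by (simp add: E_def)
  have D: "1 \<le> D" "2 * K * C \<le> D" by (auto simp: D_def)
  have m: "1 \<le> m" "m < 2" using \<theta> by (auto simp: m_def)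
  have sZ: "summable Z" unfolding Z_def using \<eta> m by (intro summable_exp_minus_dominated_power) auto
  have Z0: "Z 0 = 1 + E * \<sigma>\<^sup>2 / L\<^sup>2"
  proof -
    have "0 < 1 + E * \<sigma>\<^sup>2 / L\<^sup>2" using E by (simp add: add_pos_nonneg)
    then show ?thesis by (simp add: Z_def z_def)
  qed
  have Zpos: "0 < Z k" for k by (simp add: Z_def)
  \<comment> \<open>In the exponent, the two multiples of \<open>\<eta>\<close> add up to
    \<open>- \<eta> * 2 ^ Suc k\<close>, the remaining term picks up a factor \<open>m\<close>, and
    the new \<open>ln D\<close> is absorbed by the step from \<open>k\<close> to
    \<open>Suc k\<close> because \<open>m ^ Suc k\<close> is at least 1.\<close>
  have ZSuc: "D * exp (- \<eta> * 2 ^ k) powr (1 - \<theta>) * Z k powr (1 + \<theta>) \<le> Z (Suc k)" for k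
  proof -
    have "D * exp (- \<eta> * 2 ^ k) powr (1 - \<theta>) * Z k powr (1 + \<theta>)
        = exp (ln D + - \<eta> * 2 ^ k * (1 - \<theta>) + (- \<eta> * 2 ^ k + m ^ k * (z + real k * ln D)) * (1 + \<theta>))"
      unfolding Z_def exp_powr_real using D by (simp only: exp_add) simp
    also have "\<dots> = exp (- \<eta> * 2 ^ Suc k + (ln D + m ^ Suc k * (z + real k * ln D)))"
      by (simp add: m_def algebra_simps)
    also have "\<dots> \<le> Z (Suc k)"
    proof -
      have "1 * ln D \<le> m ^ Suc k * ln D"
        using m D by (intro mult_right_mono one_le_power) auto
      then show ?thesis by (simp add: Z_def algebra_simps)
    qed
    finally show ?thesis .
  qed
  have "0 \<le> B" using E \<sigma> by (simp add: B_def)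
  moreover have "b \<in> W \<and> normW b \<le> B"
    if a: "a \<in> W" "normW a \<le> \<sigma>"
      and low: "\<And>v. v \<in> ell G 2 \<Longrightarrow> ell_norm G 2 v \<le> \<tau> * ell_norm G 2 (convolution G a v)"
      and b: "b \<in> ell G 2" and ab: "convolution G a b = group_delta G" for a b
  proof -
    let ?r = "complex_of_real (1 / L\<^sup>2)"
    define a' where "a' = group_adjoint G a"
    define n where "n = convolution G a' a"
    define c1 where "c1 = (\<lambda>x. ?r * n x)"
    define c where "c = (\<lambda>x. group_delta G x - c1 x)"
    \<comment> \<open>\<open>q k\<close> is the power c^(2^k). \<open>P k\<close> is the product of
      the factors \<delta> + \<open>q j\<close> for \<open>j < k\<close>, the Neumann sum of the
      first 2^k powers of \<open>c\<close>. \<open>Q k\<close> is the resulting approximation to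
      \<open>b\<close>.\<close>
    define q where "q = (\<lambda>k. ((\<lambda>f. convolution G f f) ^^ k) c)"
    define P where "P = rec_nat (group_delta G) (\<lambda>k f x. f x + convolution G (q k) f x)"
    define Q where "Q = (\<lambda>k x. ?r * convolution G (P k) a' x)"
    note a1 = W_ell_1(1)[OF a(1)]
    have a': "a' \<in> W" "normW a' = normW a" unfolding a'_def by (intro W_adjoint a(1))+
    note a'1 = W_ell_1(1)[OF a'(1)]
    have nW: "n \<in> W" unfolding n_def by (intro W_convolution a a')
    have c1W: "c1 \<in> W" unfolding c1_def by (intro W_scale nW)
    have r: "cmod ?r = 1 / L\<^sup>2" by (simp add: norm_divide norm_power)
    have aL: "ell_norm G 1 a \<le> L"
    proof -
      have "ell_norm G 1 a \<le> C0 * normW a"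
        using W_ell_1(2)[OF a(1)] twist_pow_ell(2)[OF a(1)] by simp
      also have "\<dots> \<le> C0 * \<sigma>" using a C_nonneg by (intro mult_left_mono) auto
      finally show ?thesis by (simp add: L_def)
    qed
    have c_eq: "c = (\<lambda>x. group_delta G x + (- ?r) * n x)" by (simp add: c_def c1_def)
    have cW: "c \<in> W" unfolding c_eq by (intro W_add W_delta W_scale nW)
    have c_norm: "normW c \<le> Z 0"
    proof -
      have "normW n \<le> E * (normW a' * normW a)"
        unfolding n_def E_def by (intro normW_convolution_le a a')
      also have "\<dots> \<le> E * (\<sigma> * \<sigma>)"
        unfolding a'(2) using a \<sigma> E by (intro mult_left_mono mult_mono) auto
      finally have "normW n / L\<^sup>2 \<le> E * \<sigma>\<^sup>2 / L\<^sup>2"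
        by (intro divide_right_mono) (auto simp: power2_eq_square)
      moreover have "normW c \<le> normW (group_delta G) + normW (\<lambda>x. (- ?r) * n x)"
        unfolding c_eq by (intro W_add W_delta W_scale nW)
      moreover have "normW (\<lambda>x. (- ?r) * n x) = normW n / L\<^sup>2"
        unfolding W_scale(2)[OF nW] norm_minus_cancel r by simp
      ultimately show ?thesis by (simp add: Z0 W_delta)
    qed
    have c_contr: "ell_norm G 2 (convolution G c v) \<le> exp (- \<eta>) * ell_norm G 2 v"
      if v: "v \<in> ell G 2" for v
    proof -
      have "convolution G c v = (\<lambda>x. v x - ?r * convolution G a' (convolution G a v) x)"
      proof -
        have "convolution G c v = (\<lambda>x. convolution G (group_delta G) v x - convolution G c1 v x)"
          unfolding c_def by (rule convolution_diff_left[OF delta_ell(1) W_ell_1(1)[OF c1W] v]) simp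
        also have "convolution G c1 v = (\<lambda>x. ?r * convolution G a' (convolution G a v) x)"
          unfolding c1_def n_def convolution_scale_left
            convolution_assoc[OF a'1 a1 v zero_less_numeral] ..
        also have "convolution G (group_delta G) v = v"
          by (intro convolution_delta_left ell_support[OF v])
        finally show ?thesis .
      qed
      then have "(ell_norm G 2 (convolution G c v))\<^sup>2
          \<le> (ell_norm G 2 v)\<^sup>2 - (ell_norm G 2 (convolution G a v))\<^sup>2 / L\<^sup>2"
        using ell_2_minus_adjoint_convolution[OF a1 v aL L] by (simp add: a'_def)
      also have "\<dots> \<le> (ell_norm G 2 v)\<^sup>2 - (ell_norm G 2 v / t)\<^sup>2 / L\<^sup>2"
      proof -
        have "ell_norm G 2 v \<le> t * ell_norm G 2 (convolution G a v)"
          using low[OF v] ell_norm_nonneg[of G 2 "convolution G a v"]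
          unfolding t_def distrib_right by linarith
        then have "ell_norm G 2 v / t \<le> ell_norm G 2 (convolution G a v)"
          using t by (simp add: divide_le_eq mult.commute)
        then show ?thesis using t by (intro diff_mono divide_right_mono power_mono) auto
      qed
      also have "\<dots> = (1 + - 2 * \<eta>) * (ell_norm G 2 v)\<^sup>2"
        using t L by (simp add: \<eta>_def field_simps)
      also have "\<dots> \<le> exp (- 2 * \<eta>) * (ell_norm G 2 v)\<^sup>2"
        by (intro mult_right_mono exp_ge_add_one_self) auto
      also have "\<dots> = (exp (- \<eta>) * ell_norm G 2 v)\<^sup>2"
        by (simp add: power_mult_distrib exp_double[symmetric])
      finally show ?thesis by (rule power2_le_imp_le) simp
    qed
    have qSuc: "q (Suc k) = convolution G (q k) (q k)" for k by (simp add: q_def)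
    have qW: "q k \<in> W" for k
      by (induction k) (auto simp: qSuc W_convolution, simp add: q_def cW)
    note q1 = W_ell_1(1)[OF qW]
    have q_contr: "ell_norm G 2 (convolution G (q k) v) \<le> exp (- \<eta> * 2 ^ k) * ell_norm G 2 v"
      if v: "v \<in> ell G 2" for k v
      using v
    proof (induction k arbitrary: v)
      case 0
      then show ?case using c_contr by (simp add: q_def)
    next
      case (Suc k)
      have qv: "convolution G (q k) v \<in> ell G 2"
        by (rule convolution_ell(1)[OF q1 Suc.prems]) simp
      have "ell_norm G 2 (convolution G (q (Suc k)) v)
          = ell_norm G 2 (convolution G (q k) (convolution G (q k) v))"
        using convolution_assoc[OF q1[of k] q1[of k] Suc.prems] by (simp add: qSuc)
      also have "\<dots> \<le> exp (- \<eta> * 2 ^ k) * (exp (- \<eta> * 2 ^ k) * ell_norm G 2 v)"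
        by (rule order_trans[OF Suc.IH[OF qv] mult_left_mono[OF Suc.IH[OF Suc.prems]]]) simp
      also have "\<dots> = exp (- \<eta> * 2 ^ k + - \<eta> * 2 ^ k) * ell_norm G 2 v"
        unfolding exp_add by simp
      also have "- \<eta> * 2 ^ k + - \<eta> * 2 ^ k = - \<eta> * 2 ^ Suc k" by simp
      finally show ?case .
    qed
    have q_norm: "normW (q k) \<le> Z k" for k
    proof (induction k)
      case 0
      then show ?case using c_norm by (simp add: q_def)
    next
      case (Suc k)
      \<comment> \<open>Applied to the unit delta, the contraction estimate bounds the 2-norm of
        \<open>q k\<close>.\<close>
      have "ell_norm G 2 (q k) = ell_norm G 2 (convolution G (q k) (group_delta G))"
        by (simp add: convolution_delta_right W_support[OF qW])
      also have "\<dots> \<le> exp (- \<eta> * 2 ^ k)"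
        using q_contr[OF delta_ell(1), of k] by (simp add: delta_ell(2))
      finally have q2: "ell_norm G 2 (q k) \<le> exp (- \<eta> * 2 ^ k)" .
      have "normW (q (Suc k))
          \<le> 2 * K * C * ell_norm G 2 (q k) powr (1 - \<theta>) * normW (q k) powr (1 + \<theta>)"
        unfolding qSuc by (rule normW_convolution_square_le[OF qW])
      also have "\<dots> \<le> D * exp (- \<eta> * 2 ^ k) powr (1 - \<theta>) * Z k powr (1 + \<theta>)"
        using D(2) D(1) K C_nonneg \<theta> q2 Suc by (intro mult_mono powr_mono2) auto
      also have "\<dots> \<le> Z (Suc k)" by (rule ZSuc)
      finally show ?case .
    qed
    have P0: "P 0 = group_delta G" and PSuc: "P (Suc k) = (\<lambda>x. P k x + convolution G (q k) (P k) x)" for k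
      by (simp_all add: P_def)
    have PW: "P k \<in> W" for k
      by (induction k) (simp_all add: P0 PSuc W_delta W_add W_convolution qW)
    have P_norm: "normW (P k) \<le> exp (E * (\<Sum>j<k. Z j))" for k
    proof (induction k)
      case 0
      then show ?case by (simp add: P0 W_delta)
    next
      case (Suc k)
      have "normW (P (Suc k)) \<le> normW (P k) + normW (convolution G (q k) (P k))"
        unfolding PSuc by (intro W_add W_convolution PW qW)
      also have "\<dots> \<le> normW (P k) + E * (normW (q k) * normW (P k))"
        unfolding E_def by (intro add_left_mono normW_convolution_le PW qW)
      also have "\<dots> \<le> normW (P k) + E * (Z k * normW (P k))"
        using E q_norm by (intro add_left_mono mult_left_mono mult_right_mono) auto
      also have "\<dots> = (1 + E * Z k) * normW (P k)" by (simp add: algebra_simps)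
      also have "\<dots> \<le> exp (E * Z k) * exp (E * (\<Sum>j<k. Z j))"
        using Suc E Zpos[of k] by (intro mult_mono exp_ge_add_one_self) auto
      finally show ?case by (simp add: distrib_left exp_add mult.commute)
    qed
    \<comment> \<open>Telescoping: \<open>c1\<close> is \<delta> - c, and (\<delta> +
      \<open>q k\<close>) (\<delta> - \<open>q k\<close>) = \<delta> -
      \<open>q (Suc k)\<close>.\<close>
    have P_c1: "convolution G (P k) c1 = (\<lambda>x. group_delta G x - q k x)" for k
    proof (induction k)
      case 0
      then show ?case
        by (simp add: P0 convolution_delta_left W_support[OF c1W] q_def c_def)
    next
      case (Suc k)
      have "convolution G (P (Suc k)) c1
          = (\<lambda>x. convolution G (P k) c1 x + convolution G (q k) (convolution G (P k) c1) x)"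
        unfolding PSuc
        using W_ell_1(1)[OF W_convolution(1)[OF qW PW]] W_ell_1(1)[OF PW] q1 W_ell_1(1)[OF c1W]
        by (simp add: convolution_add_left[where r = 1] convolution_assoc[where r = 1])
      also have "\<dots> = (\<lambda>x. group_delta G x - q (Suc k) x)"
        unfolding Suc
        using convolution_diff_right[OF q1 delta_ell(1) q1, of k k]
        by (simp add: qSuc convolution_delta_right W_support[OF qW])
      finally show ?case .
    qed
    have QW: "Q k \<in> W" for k
      unfolding Q_def by (intro W_scale W_convolution PW a')
    have Q_norm: "normW (Q k) \<le> B" for k
    proof -
      have "normW (Q k) = 1 / L\<^sup>2 * normW (convolution G (P k) a')"
        unfolding Q_def W_scale(2)[OF W_convolution(1)[OF PW a'(1)]] r ..
      also have "\<dots> \<le> 1 / L\<^sup>2 * (E * (normW (P k) * normW a'))"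
        unfolding E_def by (intro mult_left_mono normW_convolution_le PW a') auto
      also have "\<dots> \<le> 1 / L\<^sup>2 * (E * (exp (E * suminf Z) * \<sigma>))"
      proof -
        have "(\<Sum>j<k. Z j) \<le> suminf Z"
          using sZ Zpos by (intro sum_le_suminf) (auto intro: less_imp_le)
        then have "exp (E * (\<Sum>j<k. Z j)) \<le> exp (E * suminf Z)"
          using E by (simp add: mult_left_mono)
        then have "normW (P k) \<le> exp (E * suminf Z)" by (rule order_trans[OF P_norm])
        then show ?thesis using E a a'(2) by (intro mult_left_mono mult_mono) auto
      qed
      finally show ?thesis by (simp add: B_def)
    qed
    \<comment> \<open>Obtained by multiplying with \<open>b\<close> on the right: \<open>Q k\<close>
      a = \<delta> - \<open>q k\<close> and a b = \<delta>.\<close>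
    have Q_eq: "Q k = (\<lambda>x. b x - convolution G (q k) b x)" for k
    proof -
      have "convolution G (Q k) a = convolution G (P k) c1"
        unfolding Q_def c1_def n_def convolution_scale_left convolution_scale_right
        using convolution_assoc[OF W_ell_1(1)[OF PW] a'1 a1] by simp
      also have "\<dots> = (\<lambda>x. group_delta G x - q k x)" by (rule P_c1)
      finally have "convolution G (\<lambda>x. group_delta G x - q k x) b = convolution G (Q k) (convolution G a b)"
        using convolution_assoc[OF W_ell_1(1)[OF QW[of k]] a1 b] by simp
      also have "\<dots> = Q k" unfolding ab by (intro convolution_delta_right W_support[OF QW])
      finally show ?thesis
        using convolution_diff_left[OF delta_ell(1) q1[of k] b]
        by (simp add: convolution_delta_left ell_support[OF b])
    qed
    have Q_lim: "(\<lambda>k. Q k x) \<longlonglongrightarrow> b x" for x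
    proof -
      have lim: "(\<lambda>k. exp (- \<eta> * 2 ^ k) * ell_norm G 2 b) \<longlonglongrightarrow> 0"
        using summable_LIMSEQ_zero[OF summable_exp_minus_dominated_power[OF \<eta>, of 0 0 0]]
        by (intro tendsto_mult_left_zero) simp
      have le: "norm (convolution G (q k) b x) \<le> exp (- \<eta> * 2 ^ k) * ell_norm G 2 b" for k
      proof -
        have "convolution G (q k) b \<in> ell G 2" by (rule convolution_ell(1)[OF q1 b]) simp
        then have "norm (convolution G (q k) b x) \<le> ell_norm G 2 (convolution G (q k) b)"
          by (rule norm_le_ell_norm) simp
        also have "\<dots> \<le> exp (- \<eta> * 2 ^ k) * ell_norm G 2 b" by (rule q_contr[OF b])
        finally show ?thesis .
      qed
      have "(\<lambda>k. convolution G (q k) b x) \<longlonglongrightarrow> 0"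
        by (rule Lim_null_comparison[OF always_eventually[OF allI[OF le]] lim])
      then have "(\<lambda>k. b x - convolution G (q k) b x) \<longlonglongrightarrow> b x - 0"
        by (intro tendsto_diff tendsto_const)
      then show ?thesis by (simp add: Q_eq)
    qed
    show ?thesis
      using W_limit[of Q, OF QW Q_norm Q_lim] by (intro conjI)
  qed
  ultimately show thesis using that by blast
qed

text \<open>The inverse operator \<open>T a\<close> supplies the data of
  \<open>inverse_bound\<close>: as it undoes convolution by \<open>a\<close>, the lower bound holds
  with its norm as \<tau>, and its value \<open>b\<close> at the unit delta satisfies a b =
  \<delta>. Thus \<open>b\<close> lies in the weighted space, and \<open>T a\<close> is convolution
  by \<open>b\<close>.\<close>

theorem norm_controlled_inversion_reduced_Cstar:
  "norm_controlled_inversion (weighted_ell_algebra G p \<omega>) normW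
     (reduced_Cstar_algebra G) (operator_norm G) (left_convolution G)"
proof -
  let ?B = "reduced_Cstar_algebra G" and ?l = "left_convolution G"
  \<comment> \<open>\<open>good\<close> packages the conclusion of \<open>inverse_bound\<close>, so
    that \<open>h\<close> can be chosen as a function of the two numbers alone.\<close>
  define good where "good = (\<lambda>\<sigma> \<tau> B. 0 \<le> B \<and> (\<forall>a b. a \<in> W \<longrightarrow> normW a \<le> \<sigma> \<longrightarrow>
      (\<forall>v\<in>ell G 2. ell_norm G 2 v \<le> \<tau> * ell_norm G 2 (convolution G a v)) \<longrightarrow>
      b \<in> ell G 2 \<longrightarrow> convolution G a b = group_delta G \<longrightarrow> b \<in> W \<and> normW b \<le> B))"
  have ex: "\<exists>B. good \<sigma> \<tau> B" if \<sigma>: "0 \<le> \<sigma>" and \<tau>: "0 \<le> \<tau>" for \<sigma> \<tau>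
  proof (rule inverse_bound[OF \<sigma> \<tau>])
    fix B :: real
    assume "0 \<le> B" and "\<And>a b. a \<in> W \<Longrightarrow> normW a \<le> \<sigma> \<Longrightarrow>
      (\<And>v. v \<in> ell G 2 \<Longrightarrow> ell_norm G 2 v \<le> \<tau> * ell_norm G 2 (convolution G a v)) \<Longrightarrow>
      b \<in> ell G 2 \<Longrightarrow> convolution G a b = group_delta G \<Longrightarrow> b \<in> W \<and> normW b \<le> B"
    then have "good \<sigma> \<tau> B" unfolding good_def by blast
    then show ?thesis ..
  qed
  define h where "h = (\<lambda>\<sigma> \<tau>. SOME B. good \<sigma> \<tau> B)"
  have h: "good \<sigma> \<tau> (h \<sigma> \<tau>)" if "0 \<le> \<sigma>" "0 \<le> \<tau>" for \<sigma> \<tau>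
    unfolding h_def using ex[OF that] by (rule someI_ex)
  interpret B: ring ?B
    using reduced_Cstar_unital_complex_algebra by (simp add: unital_complex_algebra_def)
  define T where "T = (\<lambda>a. inv\<^bsub>?B\<^esub> (?l a))"
  have main: "T a (group_delta G) \<in> W \<and> normW (T a (group_delta G)) \<le> h (normW a) (operator_norm G (T a))
      \<and> T a = ?l (T a (group_delta G)) \<and> 0 \<le> operator_norm G (T a)"
    if a: "a \<in> W" and u: "?l a \<in> Units ?B" for a
  proof -
    note a1 = W_ell_1(1)[OF a]
    define b where "b = T a (group_delta G)"
    have T: "T a \<in> reduced_Cstar G"
      using B.Units_inv_closed[OF u] by (simp add: T_def reduced_Cstar_algebra_def)
    note Tb = reduced_Cstar_bounded[OF T]
    have l: "compose (ell G 2) (T a) (?l a) = (\<lambda>g\<in>ell G 2. g)"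
      using B.Units_l_inv[OF u] by (simp add: T_def reduced_Cstar_algebra_def)
    have r: "compose (ell G 2) (?l a) (T a) = (\<lambda>g\<in>ell G 2. g)"
      using B.Units_r_inv[OF u] by (simp add: T_def reduced_Cstar_algebra_def)
    have Ta: "T a (convolution G a v) = v" if "v \<in> ell G 2" for v
      using fun_cong[OF l, of v] that by (simp add: compose_def left_convolution_def)
    have b2: "b \<in> ell G 2"
      unfolding b_def by (intro bounded_operatorsD(1)[OF Tb] delta_ell)
    have ab: "convolution G a b = group_delta G"
      using fun_cong[OF r, of "group_delta G"] b2
      by (simp add: compose_def left_convolution_def delta_ell(1) b_def)
    have "ell_norm G 2 v \<le> operator_norm G (T a) * ell_norm G 2 (convolution G a v)"
      if v: "v \<in> ell G 2" for v
      using operator_norm_bound[OF Tb convolution_ell(1)[OF a1 v]] Ta[OF v] by simp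
    then have bW: "b \<in> W \<and> normW b \<le> h (normW a) (operator_norm G (T a))"
      using h[OF normW_nonneg operator_norm_nonneg[OF Tb], of a] a b2 ab unfolding good_def by blast
    \<comment> \<open>By associativity g = a (b g), and \<open>T a\<close> undoes convolution by
      \<open>a\<close>; off \<open>ell G 2\<close> both sides are \<open>undefined\<close>.\<close>
    have "T a g = ?l b g" for g
    proof (cases "g \<in> ell G 2")
      case True
      have b1: "b \<in> ell G 1" using bW by (intro W_ell_1) auto
      have bg: "convolution G b g \<in> ell G 2" by (rule convolution_ell(1)[OF b1 True]) simp
      have "g = convolution G a (convolution G b g)"
        using convolution_assoc[OF a1 b1 True] by (simp add: ab convolution_delta_left ell_support[OF True])
      then have "T a g = convolution G b g" using Ta[OF bg] by simp
      with True show ?thesis by (simp add: left_convolution_def)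
    qed (simp add: bounded_operatorsD(2)[OF Tb] left_convolution_def)
    then have "T a = ?l b" by (rule ext)
    with bW operator_norm_nonneg[OF Tb] show ?thesis unfolding b_def by blast
  qed
  show ?thesis
    unfolding norm_controlled_inversion_def
  proof (intro conjI ballI impI exI[of _ h] allI)
    show "inv\<^bsub>?B\<^esub> (?l a) \<in> ?l ` carrier (weighted_ell_algebra G p \<omega>)"
      if "a \<in> carrier (weighted_ell_algebra G p \<omega>)" "?l a \<in> Units ?B" for a
      using main[of a] that by (auto simp: weighted_ell_algebra_def T_def intro: image_eqI)
    show "0 \<le> h \<sigma> \<tau>" if "0 \<le> \<sigma>" "0 \<le> \<tau>" for \<sigma> \<tau>
      using h[OF that] by (simp add: good_def)
    show "normW b \<le> h (normW a) (operator_norm G (inv\<^bsub>?B\<^esub> (?l a)))"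
      if "a \<in> carrier (weighted_ell_algebra G p \<omega>)" "b \<in> carrier (weighted_ell_algebra G p \<omega>)"
        and u: "?l a \<in> Units ?B \<and> ?l b = inv\<^bsub>?B\<^esub> (?l a)" for a b
    proof -
      have W: "a \<in> W" "b \<in> W" using that by (auto simp: weighted_ell_algebra_def)
      note m = main[OF W(1) conjunct1[OF u]]
      have "?l b = ?l (T a (group_delta G))" using m u by (simp add: T_def)
      then have "b = T a (group_delta G)"
        using m W by (intro left_convolution_inj W_ell_1) auto
      then show ?thesis using m by (simp add: T_def)
    qed
  qed (intro weighted_ell_unital_complex_algebra reduced_Cstar_unital_complex_algebra
      left_convolution_unital_embedding)+
qed

end

section \<open>Word length and growth\<close>

context group
begin

lemma set_power_subset:
  assumes "U \<subseteq> carrier G"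
  shows "set_power G U n \<subseteq> carrier G"
  by (induction n) (use assms in \<open>auto simp: set_mult_closed\<close>)

lemma set_power_mult:
  assumes U: "U \<subseteq> carrier G" and x: "x \<in> set_power G U m" and y: "y \<in> set_power G U n"
  shows "x \<otimes> y \<in> set_power G U (m + n)"
  using y
proof (induction n arbitrary: y)
  case 0
  then show ?case using x subsetD[OF set_power_subset[OF U] x] by simp
next
  case (Suc n)
  then obtain z u where z: "z \<in> set_power G U n" "u \<in> U" "y = z \<otimes> u" by (auto simp: set_mult_def)
  have "x \<otimes> z \<in> set_power G U (m + n)" using Suc.IH z by simp
  moreover have "x \<otimes> y = (x \<otimes> z) \<otimes> u"
    using z x set_power_subset[OF U] U by (auto simp: m_assoc subset_iff)
  ultimately show ?case using z by (auto simp: set_mult_def)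
qed

lemma set_power_finite:
  assumes "finite U"
  shows "finite (set_power G U n)"
  by (induction n) (use assms in \<open>auto simp: set_mult_def\<close>)

lemma set_power_mono:
  assumes U: "U \<subseteq> carrier G" "\<one> \<in> U" and "m \<le> n"
  shows "set_power G U m \<subseteq> set_power G U n"
proof (rule lift_Suc_mono_le[OF _ \<open>m \<le> n\<close>])
  fix k
  show "set_power G U k \<subseteq> set_power G U (Suc k)"
  proof
    fix x assume x: "x \<in> set_power G U k"
    then have "x = x \<otimes> \<one>" using subsetD[OF set_power_subset[OF U(1)] x] by simp
    with x U show "x \<in> set_power G U (Suc k)" by (auto simp: set_mult_def)
  qed
qed

lemma generate_subset_set_powers:
  assumes U: "U \<subseteq> carrier G" "\<And>u. u \<in> U \<Longrightarrow> inv u \<in> U" and x: "x \<in> generate G U"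
  shows "\<exists>n. x \<in> set_power G U n"
proof -
  have gen: "u \<in> set_power G U (Suc 0)" if "u \<in> U" for u
    using that subsetD[OF U(1) that] by (auto simp: set_mult_def intro!: bexI[of _ u])
  from x show ?thesis
  proof (induction rule: generate.induct)
    case one
    then show ?case by (intro exI[of _ 0]) simp
  next
    case (incl h)
    then show ?case using gen by blast
  next
    case (inv h)
    then show ?case using gen U(2) by blast
  next
    case (eng h1 h2)
    then show ?case using set_power_mult[OF U(1)] by blast
  qed
qed

context
  fixes U assumes U: "symmetric_generating_set G U"
begin

lemma generating_set_props: "U \<subseteq> carrier G" "finite U" "\<one> \<in> U"
  using U by (auto simp: symmetric_generating_set_def)

lemma word_length_in_set_power:
  assumes "x \<in> carrier G"
  shows "x \<in> set_power G U (word_length G U x)"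
proof (cases "x = \<one>")
  case False
  have "\<exists>n. x \<in> set_power G U n"
    using U assms by (intro generate_subset_set_powers) (auto simp: symmetric_generating_set_def)
  then have "Inf {n. x \<in> set_power G U n} \<in> {n. x \<in> set_power G U n}"
    by (intro Inf_nat_def1) auto
  with False show ?thesis by (simp add: word_length_def)
qed (simp add: word_length_def)

lemma word_length_le: "x \<in> set_power G U n \<Longrightarrow> word_length G U x \<le> n"
  by (auto simp: word_length_def intro: cInf_lower)

lemma word_length_mult:
  assumes "x \<in> carrier G" "y \<in> carrier G"
  shows "word_length G U (x \<otimes> y) \<le> word_length G U x + word_length G U y"
  using assms by (intro word_length_le set_power_mult generating_set_props word_length_in_set_power)

lemma word_length_ball:
  assumes S: "S \<subseteq> {x \<in> carrier G. word_length G U x \<le> n}"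
  shows "finite S" and "card S \<le> card (set_power G U n)"
proof -
  have "S \<subseteq> set_power G U n"
    using S word_length_in_set_power set_power_mono[OF generating_set_props(1,3)] by blast
  then show "finite S" and "card S \<le> card (set_power G U n)"
    using set_power_finite[OF generating_set_props(2)] by (auto intro: finite_subset card_mono)
qed

end

end

section \<open>Summability from growth bounds\<close>

lemma summable_on_level_sets:
  fixes \<kappa> :: "'i \<Rightarrow> nat" and \<psi> :: "'i \<Rightarrow> real"
  assumes \<psi>: "\<And>x. x \<in> S \<Longrightarrow> 0 \<le> \<psi> x" "\<And>x. x \<in> S \<Longrightarrow> \<psi> x \<le> \<Phi> (\<kappa> x)"
    and card: "\<And>F k. finite F \<Longrightarrow> F \<subseteq> {x \<in> S. \<kappa> x = k} \<Longrightarrow> real (card F) \<le> N k"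
    and \<Phi>: "\<And>k. 0 \<le> \<Phi> k" and sum: "summable (\<lambda>k. N k * \<Phi> k)"
  shows "\<psi> summable_on S"
proof (rule summable_on_bounded_finite_sums[OF \<psi>(1)])
  fix F assume F: "finite F" "F \<subseteq> S"
  have "sum \<psi> F \<le> (\<Sum>x\<in>F. \<Phi> (\<kappa> x))" using F \<psi> by (intro sum_mono) auto
  also have "\<dots> = (\<Sum>k\<in>\<kappa> ` F. \<Sum>x\<in>{x \<in> F. \<kappa> x = k}. \<Phi> (\<kappa> x))" by (rule sum.image_gen[OF F(1)])
  also have "\<dots> = (\<Sum>k\<in>\<kappa> ` F. real (card {x \<in> F. \<kappa> x = k}) * \<Phi> k)" by simp
  also have "\<dots> \<le> (\<Sum>k\<in>\<kappa> ` F. N k * \<Phi> k)"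
    using F \<Phi> by (intro sum_mono mult_right_mono card) auto
  \<comment> \<open>The empty set in \<open>card\<close> shows that \<open>N k\<close> is
    nonnegative.\<close>
  also have "\<dots> \<le> suminf (\<lambda>k. N k * \<Phi> k)"
    using F \<Phi> card[of "{}"] by (intro sum_le_suminf sum) auto
  finally show "sum \<psi> F \<le> suminf (\<lambda>k. N k * \<Phi> k)" .
qed

text \<open>Summing over the dyadic annuli \<open>2 ^ k \<le> 1 + word_length x < 2 ^ (k + 1)\<close> costs only a
  geometric series, so that every exponent above the growth degree is reached.\<close>

lemma (in group) summable_word_length_powr:
  assumes U: "symmetric_generating_set G U" and growth: "growth_degree_le G U d" and t: "real d < t"
  shows "(\<lambda>x. (1 + real (word_length G U x)) powr (- t)) summable_on carrier G"
proof -
  obtain K where K: "0 < K" "\<And>n. 1 \<le> n \<Longrightarrow> real (card (set_power G U n)) \<le> K * real n ^ d"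
    using growth by (auto simp: growth_degree_le_def)
  \<comment> \<open>\<open>\<kappa> x\<close> will be the integer part of the binary logarithm of
    \<open>1 + word_length G U x\<close>.\<close>
  have "\<exists>k. 2 ^ k \<le> 1 + word_length G U x \<and> 1 + word_length G U x < 2 ^ (k + 1)" for x
    by (rule ex_power_ivl1) auto
  then obtain \<kappa> where \<kappa>: "\<And>x. 2 ^ \<kappa> x \<le> 1 + word_length G U x"
    "\<And>x. 1 + word_length G U x < 2 ^ (\<kappa> x + 1)" by metis
  show ?thesis
  proof (rule summable_on_level_sets[where \<kappa> = \<kappa> and \<Phi> = "\<lambda>k. (2 ^ k) powr (- t)"
        and N = "\<lambda>k. K * (2 ^ (k + 1)) ^ d"])
    fix x
    have "real (2 ^ \<kappa> x) \<le> real (1 + word_length G U x)" using \<kappa>(1)[of x] by (rule of_nat_mono)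
    then show "(1 + real (word_length G U x)) powr (- t) \<le> (2 ^ \<kappa> x) powr (- t)"
      using t by (intro powr_mono2') auto
  next
    fix F k assume F: "F \<subseteq> {x \<in> carrier G. \<kappa> x = k}"
    have "F \<subseteq> {x \<in> carrier G. word_length G U x \<le> 2 ^ (k + 1)}"
    proof
      fix x assume "x \<in> F"
      then show "x \<in> {x \<in> carrier G. word_length G U x \<le> 2 ^ (k + 1)}"
        using F \<kappa>(2)[of x] by auto
    qed
    from word_length_ball(2)[OF U this]
    have "real (card F) \<le> real (card (set_power G U (2 ^ (k + 1))))" by simp
    also have "\<dots> \<le> K * real (2 ^ (k + 1)) ^ d" by (intro K) simp
    finally show "real (card F) \<le> K * (2 ^ (k + 1)) ^ d" by simp
  next
    \<comment> \<open>The level bounds multiply to a geometric sequence with ratio 2^(d - t) <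
      1.\<close>
    have eq: "K * (2 ^ (k + 1)) ^ d * (2 ^ k) powr (- t) = K * 2 ^ d * (2 powr (real d - t)) ^ k" for k
    proof -
      have "(2 ^ (k + 1)) ^ d = (2 :: real) ^ d * 2 powr (real d * real k)"
        by (simp add: power_mult_distrib powr_realpow[symmetric] powr_powr mult.commute)
      moreover have "(2 ^ k) powr (- t) = (2 :: real) powr (- (t * real k))"
        by (simp add: powr_realpow[symmetric] powr_powr mult.commute)
      moreover have "(2 powr (real d - t)) ^ k = (2 :: real) powr (real d * real k) * 2 powr (- (t * real k))"
        by (simp add: powr_realpow[symmetric] powr_powr powr_add[symmetric] algebra_simps)
      ultimately show ?thesis by simp
    qed
    have "(2 :: real) powr (real d - t) < 2 powr 0" using t by (intro powr_less_mono) auto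
    then have "summable (\<lambda>k. K * 2 ^ d * (2 powr (real d - t)) ^ k)"
      by (intro summable_mult summable_geometric) simp
    then show "summable (\<lambda>k. K * (2 ^ (k + 1)) ^ d * (2 ^ k) powr (- t))" by (simp only: eq)
  qed auto
qed

text \<open>As \<open>\<alpha>\<^sub>0 < \<alpha>\<close>, the decay of exp (- t k^\<alpha>)
  outweighs the growth of the level sets of the word length; comparison with the inverse squares
  suffices.\<close>

lemma (in group) summable_exp_word_length:
  assumes U: "symmetric_generating_set G U" and growth: "growth_bounded_by_exp_powr G U \<alpha>\<^sub>0"
    and \<alpha>: "0 < \<alpha>\<^sub>0" "\<alpha>\<^sub>0 < \<alpha>" and t: "0 < t"
  shows "(\<lambda>x. exp (- t * real (word_length G U x) powr \<alpha>)) summable_on carrier G"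
proof -
  obtain K where K: "0 < K"
    "\<And>n. 1 \<le> n \<Longrightarrow> real (card (set_power G U n)) \<le> K * exp (real n powr \<alpha>\<^sub>0)"
    using growth by (auto simp: growth_bounded_by_exp_powr_def)
  show ?thesis
  proof (rule summable_on_level_sets[where \<kappa> = "word_length G U"
        and \<Phi> = "\<lambda>k. exp (- t * real k powr \<alpha>)" and N = "\<lambda>k. max 1 K * exp (real k powr \<alpha>\<^sub>0)"])
    fix F k assume F: "F \<subseteq> {x \<in> carrier G. word_length G U x = k}"
    have "real (card F) \<le> real (card (set_power G U k))"
      using word_length_ball(2)[OF U, of F k] F by auto
    also have "\<dots> \<le> max 1 K * exp (real k powr \<alpha>\<^sub>0)"
    \<comment> \<open>The growth bound starts at 1; at \<open>k = 0\<close> the power of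
      \<open>U\<close> is a singleton, which the 1 in \<open>max 1 K\<close> covers.\<close>
    proof (cases "k = 0")
      case False
      then have "real (card (set_power G U k)) \<le> K * exp (real k powr \<alpha>\<^sub>0)" by (intro K) auto
      also have "\<dots> \<le> max 1 K * exp (real k powr \<alpha>\<^sub>0)" by (intro mult_right_mono) auto
      finally show ?thesis .
    qed simp
    finally show "real (card F) \<le> max 1 K * exp (real k powr \<alpha>\<^sub>0)" .
  next
    \<comment> \<open>The exponents \<open>k powr \<alpha>\<^sub>0\<close> and
      \<open>2 * ln k\<close>, divided by \<open>k powr \<alpha>\<close>; that their sum is
      eventually below \<open>t\<close> yields the comparison with 1 / k^2.\<close>
    have "(\<lambda>k. real k powr (\<alpha>\<^sub>0 - \<alpha>) + 2 * (ln (real k) / real k powr \<alpha>)) \<longlonglongrightarrow> 0 + 2 * 0"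
      using \<alpha> by (intro tendsto_add tendsto_mult_left) real_asymp+
    then have "eventually (\<lambda>k. real k powr (\<alpha>\<^sub>0 - \<alpha>) + 2 * (ln (real k) / real k powr \<alpha>) < t) sequentially"
      using t by (intro order_tendstoD(2)[where y = "0 + 2 * 0"]) auto
    then have "eventually (\<lambda>k. norm (exp (real k powr \<alpha>\<^sub>0) * exp (- t * real k powr \<alpha>))
        \<le> inverse (real k ^ 2)) sequentially"
      using eventually_gt_at_top[of 0]
    proof eventually_elim
      case (elim k)
      have "real k powr \<alpha> * (real k powr (\<alpha>\<^sub>0 - \<alpha>) + 2 * (ln (real k) / real k powr \<alpha>))
          \<le> real k powr \<alpha> * t"
        using elim by (intro mult_left_mono) auto
      then have "real k powr \<alpha>\<^sub>0 + 2 * ln (real k) \<le> t * real k powr \<alpha>"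
        using elim by (simp add: distrib_left powr_diff mult.commute)
      then have "real k powr \<alpha>\<^sub>0 + - t * real k powr \<alpha> \<le> - (2 * ln (real k))" by simp
      then have "exp (real k powr \<alpha>\<^sub>0 + - t * real k powr \<alpha>) \<le> exp (- (2 * ln (real k)))" by simp
      also have "\<dots> = inverse (real k ^ 2)" using elim by (simp add: exp_minus exp_double)
      finally show ?case by (simp add: mult_exp_exp)
    qed
    then have "summable (\<lambda>k. exp (real k powr \<alpha>\<^sub>0) * exp (- t * real k powr \<alpha>))"
      by (rule summable_comparison_test_ev) (intro inverse_power_summable, simp)
    from summable_mult[OF this, of "max 1 K"]
    show "summable (\<lambda>k. max 1 K * exp (real k powr \<alpha>\<^sub>0) * exp (- t * real k powr \<alpha>))"
      by (simp only: mult.assoc)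
  qed auto
qed

text \<open>The quotient of \<open>n ^ d\<close> by exp (n^\<alpha>) tends to 0 and is therefore
  bounded. Subexponential weights can thus be treated at once for polynomial and intermediate
  growth.\<close>

lemma polynomial_growth_bounded_by_exp_powr:
  assumes "polynomial_growth G U" and \<alpha>: "0 < \<alpha>"
  shows "growth_bounded_by_exp_powr G U \<alpha>"
proof -
  obtain d K where K: "0 < K" "\<And>n. 1 \<le> n \<Longrightarrow> real (card (set_power G U n)) \<le> K * real n ^ d"
    using assms by (auto simp: polynomial_growth_def growth_degree_le_def)
  have "(\<lambda>n. real n ^ d * exp (- (real n powr \<alpha>))) \<longlonglongrightarrow> 0"
    using \<alpha> by real_asymp
  then have "Bseq (\<lambda>n. real n ^ d * exp (- (real n powr \<alpha>)))"
    by (intro convergent_imp_Bseq convergentI)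
  then obtain M where M: "0 < M" "\<And>n. norm (real n ^ d * exp (- (real n powr \<alpha>))) \<le> M"
    by (rule BseqE) auto
  have "real (card (set_power G U n)) \<le> (K * M) * exp (real n powr \<alpha>)" if "1 \<le> n" for n
  proof -
    have "real n ^ d \<le> M * exp (real n powr \<alpha>)"
      using M(2)[of n] by (simp add: exp_minus field_simps)
    then have "K * real n ^ d \<le> K * (M * exp (real n powr \<alpha>))" using K by (intro mult_left_mono) auto
    then show ?thesis using K(2)[OF that] by simp
  qed
  then show ?thesis
    unfolding growth_bounded_by_exp_powr_def using K M by (intro exI[of _ "K * M"]) auto
qed

section \<open>The four families of weights\<close>

text \<open>For fixed \<open>n\<close> the increment (x + n)^\<alpha> - x^\<alpha> does not increase
  in \<open>x\<close>, because \<alpha> \<le> 1; its value at \<open>x = n\<close> is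
  \<open>(2 powr \<alpha> - 1) * n powr \<alpha>\<close>. The factor in front becomes the exponent
  \<gamma> of the subexponential weights.\<close>

lemma powr_add_le:
  fixes m n \<alpha> :: real
  assumes "0 \<le> n" "n \<le> m" "0 < \<alpha>" "\<alpha> \<le> 1"
  shows "(m + n) powr \<alpha> \<le> m powr \<alpha> + (2 powr \<alpha> - 1) * n powr \<alpha>"
proof (cases "n = 0")
  case False
  with assms have n: "0 < n" by simp
  define f where "f = (\<lambda>x. (x + n) powr \<alpha> - x powr \<alpha>)"
  have "f m \<le> f n"
  proof (rule DERIV_nonpos_imp_nonincreasing[OF assms(2)])
    fix x assume x: "n \<le> x" "x \<le> m"
    have "(f has_real_derivative \<alpha> * (x + n) powr (\<alpha> - 1) - \<alpha> * x powr (\<alpha> - 1)) (at x)"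
      unfolding f_def using x n by (auto intro!: derivative_eq_intros)
    moreover have "(x + n) powr (\<alpha> - 1) \<le> x powr (\<alpha> - 1)"
      using x n assms by (intro powr_mono2') auto
    then have "\<alpha> * (x + n) powr (\<alpha> - 1) - \<alpha> * x powr (\<alpha> - 1) \<le> 0"
      using assms by (simp add: mult_left_mono)
    ultimately show "\<exists>y. (f has_real_derivative y) (at x) \<and> y \<le> 0" by blast
  qed
  also have "f n = (2 powr \<alpha> - 1) * n powr \<alpha>"
    using n by (simp add: f_def powr_mult[symmetric] left_diff_distrib)
  finally show ?thesis by (simp add: f_def)
qed simp

section \<open>Verification of the weight inequality for each family\<close>

context group
begin

text \<open>A product of two elements lies in the larger of the subgroups in which they first
  appear, so \<omega>(x y) is at most the maximum of \<omega>(x) and \<omega>(y), hence at most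
  their sum. This is the case \<open>\<gamma> = 0\<close>, \<open>K = 1\<close>.\<close>

lemma norm_controlled_inversion_finite_subgroups:
  assumes w: "weight_on G \<omega>" and p: "1 \<le> p"
    and H: "\<And>i. subgroup (H i) G" "incseq H" "carrier G = (\<Union>i. H i)"
    and n: "incseq n" "\<And>i. 1 \<le> n i"
    and \<omega>: "\<And>x. x \<in> carrier G \<Longrightarrow> \<omega> x = 1 + suminf (\<lambda>i. n i * indicator (H (Suc i) - H i) x)"
    and s: "0 < s" "s * (1 - 1 / p) < 1" "(\<lambda>x. inverse (\<omega> x) powr s) summable_on carrier G"
  shows "norm_controlled_inversion (weighted_ell_algebra G p \<omega>) (weighted_ell_norm G p \<omega>)
    (reduced_Cstar_algebra G) (operator_norm G) (left_convolution G)"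
proof -
  define level where "level = (\<lambda>x. LEAST i. x \<in> H i)"
  \<comment> \<open>\<open>v i\<close> is the value of the weight on elements that appear first in
    \<open>H i\<close>; on \<open>H 0\<close> every term of the series vanishes.\<close>
  define v where "v = (\<lambda>i. case i of 0 \<Rightarrow> 1 | Suc j \<Rightarrow> 1 + n j)"
  have mem: "x \<in> H (level x)" if "x \<in> carrier G" for x
    using that H(3) unfolding level_def by (auto intro: LeastI)
  have mem_iff: "x \<in> H i \<longleftrightarrow> level x \<le> i" if "x \<in> carrier G" for x i
    using mem[OF that] incseqD[OF H(2), of "level x" i] by (auto simp: level_def intro: Least_le)
  have v: "v i \<le> v j" if "i \<le> j" for i j
    using that incseqD[OF n(1)] n(2) order_trans[of 0 1 "n _"]
    by (auto simp: v_def split: nat.splits intro: order_trans[of 0 1])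
  have v1: "1 \<le> v i" for i using v[of 0 i] by (simp add: v_def)
  have \<omega>_level: "\<omega> x = v (level x)" if x: "x \<in> carrier G" for x
  proof (cases "level x")
    case 0
    then have "(\<lambda>i. n i * indicator (H (Suc i) - H i) x) = (\<lambda>i. 0)"
      using mem_iff[OF x] by (auto simp: fun_eq_iff)
    with 0 show ?thesis by (simp add: \<omega>[OF x] v_def)
  next
    case (Suc j)
    have "(\<lambda>i. n i * indicator (H (Suc i) - H i) x) sums (\<Sum>i\<in>{j}. n i * indicator (H (Suc i) - H i) x)"
      by (rule sums_finite) (use mem_iff[OF x] Suc in \<open>auto simp: indicator_def\<close>)
    then have "suminf (\<lambda>i. n i * indicator (H (Suc i) - H i) x) = n j"
      using mem_iff[OF x] Suc by (simp add: sums_iff)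
    with Suc show ?thesis by (simp add: \<omega>[OF x] v_def)
  qed
  have "weakly_subadditive_weight G \<omega> p 0 1 s"
  proof (unfold_locales)
    fix x y assume x: "x \<in> carrier G" and y: "y \<in> carrier G"
    have "x \<in> H (max (level x) (level y))" "y \<in> H (max (level x) (level y))"
      using mem_iff[OF x] mem_iff[OF y] by auto
    then have "x \<otimes> y \<in> H (max (level x) (level y))" by (rule subgroup.m_closed[OF H(1)])
    then have "\<omega> (x \<otimes> y) \<le> v (max (level x) (level y))"
      using x y mem_iff[of "x \<otimes> y"] by (simp add: \<omega>_level v)
    also have "\<dots> \<le> v (level x) + v (level y)"
      using v1[of "level x"] v1[of "level y"] by (auto simp: max_def)
    finally show "\<omega> (x \<otimes> y) \<le> 1 * (\<omega> x * \<omega> y powr 0 + \<omega> x powr 0 * \<omega> y)"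
      using v1[of "level x"] v1[of "level y"] by (auto simp: \<omega>_level x y)
  qed (use w p s in auto)
  then show ?thesis by (rule weakly_subadditive_weight.norm_controlled_inversion_reduced_Cstar)
qed

text \<open>One plus the length of x y is at most twice the larger of the corresponding values at x
  and y, so \<omega>(x y) \<le> 2^\<beta> (\<omega>(x) + \<omega>(y)), again with \<gamma> =
  0.\<close>

lemma norm_controlled_inversion_polynomial_weight:
  assumes w: "weight_on G \<omega>" and p: "1 \<le> p"
    and U: "symmetric_generating_set G U" and growth: "polynomial_growth G U"
    and \<beta>: "0 < \<beta>" "real (growth_order G U) * (1 - 1 / p) < \<beta>"
    and \<omega>: "\<And>x. x \<in> carrier G \<Longrightarrow> \<omega> x = (1 + real (word_length G U x)) powr \<beta>"
  shows "norm_controlled_inversion (weighted_ell_algebra G p \<omega>) (weighted_ell_norm G p \<omega>)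
    (reduced_Cstar_algebra G) (operator_norm G) (left_convolution G)"
proof -
  define d where "d = growth_order G U"
  \<comment> \<open>\<open>y\<close> is the reciprocal of the conjugate index and \<open>e\<close>
    half the slack in d y / \<beta> < 1. Then s > d / \<beta> makes the inverse weight s-summable,
    while s y \<le> d y / \<beta> + e < 1.\<close>
  define y where "y = 1 - 1 / p"
  define e where "e = (1 - real d * y / \<beta>) / 2"
  define s where "s = real d / \<beta> + e"
  have d: "growth_degree_le G U d"
    using growth unfolding d_def growth_order_def polynomial_growth_def by (rule LeastI_ex)
  have y: "0 \<le> y" "y \<le> 1" using p by (auto simp: y_def)
  have e: "0 < e" using \<beta> by (simp add: e_def d_def y_def)
  have s: "0 < s" using e \<beta> by (simp add: s_def add_nonneg_pos)
  have "s * y = real d * y / \<beta> + e * y" by (simp add: s_def distrib_right)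
  also have "\<dots> \<le> real d * y / \<beta> + e * 1" using e y by (intro add_left_mono mult_left_mono) auto
  also have "\<dots> < 1" using e by (simp add: e_def field_simps)
  finally have sy: "s * (1 - 1 / p) < 1" by (simp add: y_def)
  have d_less: "real d < \<beta> * s" using \<beta> e by (simp add: s_def distrib_left)
  have "weakly_subadditive_weight G \<omega> p 0 (2 powr \<beta>) s"
  proof (unfold_locales)
    fix x y assume x: "x \<in> carrier G" and y: "y \<in> carrier G"
    define m n where "m = 1 + real (word_length G U x)" and "n = 1 + real (word_length G U y)"
    have mn: "1 \<le> m" "1 \<le> n" by (auto simp: m_def n_def)
    have "real (word_length G U (x \<otimes> y)) \<le> real (word_length G U x + word_length G U y)"
      using word_length_mult[OF U x y] by (rule of_nat_mono)
    then have "1 + real (word_length G U (x \<otimes> y)) \<le> 2 * max m n"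
      by (simp add: m_def n_def max_def)
    then have "\<omega> (x \<otimes> y) \<le> (2 * max m n) powr \<beta>"
      using \<beta> x y by (simp add: \<omega> powr_mono2)
    also have "\<dots> = 2 powr \<beta> * max m n powr \<beta>" using mn by (simp add: powr_mult)
    also have "\<dots> \<le> 2 powr \<beta> * (m powr \<beta> + n powr \<beta>)"
      by (intro mult_left_mono) (auto simp: max_def)
    finally show "\<omega> (x \<otimes> y) \<le> 2 powr \<beta> * (\<omega> x * \<omega> y powr 0 + \<omega> x powr 0 * \<omega> y)"
      using mn by (simp add: \<omega> x y flip: m_def n_def)
  next
    have "(\<lambda>x. (1 + real (word_length G U x)) powr (- (\<beta> * s))) summable_on carrier G"
      by (rule summable_word_length_powr[OF U d d_less])
    then show "(\<lambda>x. inverse (\<omega> x) powr s) summable_on carrier G"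
      by (rule summable_on_cong[THEN iffD1, rotated])
        (simp add: \<omega> powr_minus powr_powr inverse_powr)
  qed (use w p s sy in auto)
  then show ?thesis by (rule weakly_subadditive_weight.norm_controlled_inversion_reduced_Cstar)
qed

text \<open>By \<open>powr_add_le\<close> the weight of the longer element keeps exponent 1 and that
  of the shorter one gets 2^\<alpha> - 1 < 1.\<close>

lemma norm_controlled_inversion_subexponential_weight:
  assumes w: "weight_on G \<omega>" and p: "1 \<le> p"
    and U: "symmetric_generating_set G U" and growth: "growth_bounded_by_exp_powr G U \<alpha>\<^sub>0"
    and \<alpha>: "0 < \<alpha>\<^sub>0" "\<alpha>\<^sub>0 < \<alpha>" "\<alpha> < 1" and C: "0 < C"
    and \<omega>: "\<And>x. x \<in> carrier G \<Longrightarrow> \<omega> x = exp (C * real (word_length G U x) powr \<alpha>)"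
  shows "norm_controlled_inversion (weighted_ell_algebra G p \<omega>) (weighted_ell_norm G p \<omega>)
    (reduced_Cstar_algebra G) (operator_norm G) (left_convolution G)"
proof -
  define \<gamma> where "\<gamma> = 2 powr \<alpha> - 1"
  have \<gamma>: "0 \<le> \<gamma>" "\<gamma> < 1"
    using \<alpha> powr_less_mono[of \<alpha> 1 2] by (auto simp: \<gamma>_def ge_one_powr_ge_zero)
  \<comment> \<open>Any positive number below \<open>1 - \<gamma>\<close> serves, because every
    positive power of the inverse weight is summable.\<close>
  define s where "s = (1 - \<gamma>) / 2"
  have s: "0 < s" using \<gamma> by (simp add: s_def)
  have "s * (1 - 1 / p) \<le> s * 1" using s p by (intro mult_left_mono) auto
  also have "s * 1 < 1 - \<gamma>" using \<gamma> by (simp add: s_def)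
  finally have sy: "s * (1 - 1 / p) < 1 - \<gamma>" .
  \<comment> \<open>A separate element \<open>z\<close> lets the estimate serve both orders of
    \<open>x\<close> and \<open>y\<close>, with the same product \<open>z\<close> each time.\<close>
  have sub: "\<omega> z \<le> \<omega> x * \<omega> y powr \<gamma>"
    if x: "x \<in> carrier G" and y: "y \<in> carrier G" and z: "z \<in> carrier G"
      and le: "word_length G U y \<le> word_length G U x"
      and lz: "word_length G U z \<le> word_length G U x + word_length G U y"
      for x y z
  proof -
    let ?m = "real (word_length G U x)" and ?n = "real (word_length G U y)"
    have "real (word_length G U z) \<le> real (word_length G U x + word_length G U y)"
      using lz by (rule of_nat_mono)
    then have "real (word_length G U z) powr \<alpha> \<le> (?m + ?n) powr \<alpha>"
      using \<alpha> by (intro powr_mono2) auto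
    also have "\<dots> \<le> ?m powr \<alpha> + \<gamma> * ?n powr \<alpha>"
      unfolding \<gamma>_def using le \<alpha> by (intro powr_add_le) auto
    finally have "C * real (word_length G U z) powr \<alpha> \<le> C * (?m powr \<alpha> + \<gamma> * ?n powr \<alpha>)"
      using C by (intro mult_left_mono) auto
    then show ?thesis
      by (simp add: \<omega> x y z exp_powr_real exp_add[symmetric] algebra_simps)
  qed
  have "weakly_subadditive_weight G \<omega> p \<gamma> 1 s"
  proof (unfold_locales)
    fix x y assume x: "x \<in> carrier G" and y: "y \<in> carrier G"
    have pos: "0 \<le> \<omega> x" "0 \<le> \<omega> y" by (simp_all add: \<omega> x y)
    show "\<omega> (x \<otimes> y) \<le> 1 * (\<omega> x * \<omega> y powr \<gamma> + \<omega> x powr \<gamma> * \<omega> y)"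
    proof (cases "word_length G U y \<le> word_length G U x")
      case True
      have "\<omega> (x \<otimes> y) \<le> \<omega> x * \<omega> y powr \<gamma>"
        using x y True word_length_mult[OF U x y] by (intro sub) auto
      moreover have "0 \<le> \<omega> x powr \<gamma> * \<omega> y" using pos by simp
      ultimately show ?thesis by simp
    next
      case False
      have "\<omega> (x \<otimes> y) \<le> \<omega> y * \<omega> x powr \<gamma>"
        using x y False word_length_mult[OF U x y] by (intro sub) auto
      moreover have "0 \<le> \<omega> x * \<omega> y powr \<gamma>" using pos by simp
      ultimately show ?thesis by (simp add: mult.commute)
    qed
  next
    have "(\<lambda>x. exp (- (C * s) * real (word_length G U x) powr \<alpha>)) summable_on carrier G"
      using C s by (intro summable_exp_word_length[OF U growth \<alpha>(1,2)]) simp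
    then show "(\<lambda>x. inverse (\<omega> x) powr s) summable_on carrier G"
      by (rule summable_on_cong[THEN iffD1, rotated])
        (simp add: \<omega> exp_powr_real exp_minus[symmetric] mult_ac)
  qed (use w p s sy \<gamma> in auto)
  then show ?thesis by (rule weakly_subadditive_weight.norm_controlled_inversion_reduced_Cstar)
qed

end

text \<open>In the extended reals the reciprocal of infinity is 0, so p = 1 with infinite q is
  covered, both sides being 0.\<close>

lemma conjugate_index:
  fixes p :: real and q :: ereal
  assumes "1 \<le> p" "1 < q" "1 / ereal p + 1 / q = 1"
  shows "1 / q = ereal (1 - 1 / p)"
proof (cases q)
  case (real r)
  with assms show ?thesis by (simp add: one_ereal_def)
next
  case PInf
  with assms show ?thesis by (simp add: one_ereal_def zero_ereal_def)
qed (use assms in auto)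

lemma less_conjugate_index:
  fixes p s :: real and q :: ereal
  assumes "1 \<le> p" "1 < q" "1 / ereal p + 1 / q = 1" "0 < s" "ereal s < q"
  shows "s * (1 - 1 / p) < 1"
proof (cases q)
  case (real r)
  then have "1 - 1 / p = 1 / r" "1 < r" "s < r"
    using conjugate_index[OF assms(1-3)] assms by (auto simp: one_ereal_def)
  then show ?thesis by simp
next
  case PInf
  then have "1 - 1 / p = 0" using conjugate_index[OF assms(1-3)] by (simp add: zero_ereal_def)
  then show ?thesis by simp
qed (use assms in auto)

lemma divide_conjugate_index:
  fixes p d :: real and q :: ereal
  assumes "1 \<le> p" "1 < q" "1 / ereal p + 1 / q = 1"
  shows "ereal d / q = ereal (d * (1 - 1 / p))"
proof -
  have "ereal d / q = ereal d * (1 / q)" by (simp add: divide_ereal_def)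
  then show ?thesis by (simp add: conjugate_index[OF assms])
qed

theorem corollary4p2:
  fixes G :: "('a, 'm) monoid_scheme" (structure)
    and \<omega> :: "'a \<Rightarrow> real" and p :: real and q :: ereal
  assumes "group G" and "weight_on G \<omega>"
    and "1 \<le> p" and "1 < q" and "1 / ereal p + 1 / q = 1"
    and cases:
      "(\<exists>(H :: nat \<Rightarrow> 'a set) (n :: nat \<Rightarrow> real) (s :: real).
          (\<forall>i. subgroup (H i) G \<and> finite (H i)) \<and> incseq H \<and> carrier G = (\<Union>i. H i) \<and>
          incseq n \<and> (\<forall>i. 1 \<le> n i) \<and>
          (\<forall>x\<in>carrier G. \<omega> x = 1 + suminf (\<lambda>i. n i * indicator (H (Suc i) - H i) x)) \<and>
          0 < s \<and> ereal s < q \<and> (\<lambda>x. inverse (\<omega> x) powr s) summable_on carrier G)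
       \<or>
       (\<exists>(U :: 'a set) (\<beta> :: real).
          symmetric_generating_set G U \<and> polynomial_growth G U \<and>
          0 < \<beta> \<and> ereal (real (growth_order G U)) / q < ereal \<beta> \<and>
          (\<forall>x\<in>carrier G. \<omega> x = (1 + real (word_length G U x)) powr \<beta>))
       \<or>
       (\<exists>(U :: 'a set) (\<alpha> :: real) (C :: real).
          symmetric_generating_set G U \<and> polynomial_growth G U \<and>
          0 < \<alpha> \<and> \<alpha> < 1 \<and> 0 < C \<and>
          (\<forall>x\<in>carrier G. \<omega> x = exp (C * real (word_length G U x) powr \<alpha>)))
       \<or>
       (\<exists>(U :: 'a set) (\<alpha>\<^sub>0 :: real) (\<alpha> :: real) (C :: real).
          symmetric_generating_set G U \<and> intermediate_growth G U \<and>
          growth_bounded_by_exp_powr G U \<alpha>\<^sub>0 \<and>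
          0 < \<alpha>\<^sub>0 \<and> \<alpha>\<^sub>0 < \<alpha> \<and> \<alpha> < 1 \<and> 0 < C \<and>
          (\<forall>x\<in>carrier G. \<omega> x = exp (C * real (word_length G U x) powr \<alpha>)))"
  shows "norm_controlled_inversion
           (weighted_ell_algebra G p \<omega>) (weighted_ell_norm G p \<omega>)
           (reduced_Cstar_algebra G) (operator_norm G)
           (left_convolution G)"
proof -
  interpret group G by fact
  note pq = \<open>1 \<le> p\<close> \<open>1 < q\<close> \<open>1 / ereal p + 1 / q = 1\<close>
  from cases show ?thesis
  proof (elim disjE exE conjE)
    fix H :: "nat \<Rightarrow> 'a set" and n :: "nat \<Rightarrow> real" and s :: real
    assume H: "\<forall>i. subgroup (H i) G \<and> finite (H i)" "incseq H" "carrier G = (\<Union>i. H i)"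
      and n: "incseq n" "\<forall>i. 1 \<le> n i"
      and \<omega>: "\<forall>x\<in>carrier G. \<omega> x = 1 + suminf (\<lambda>i. n i * indicator (H (Suc i) - H i) x)"
      and s: "0 < s" "ereal s < q" "(\<lambda>x. inverse (\<omega> x) powr s) summable_on carrier G"
    show ?thesis
    proof (rule norm_controlled_inversion_finite_subgroups[OF \<open>weight_on G \<omega>\<close> \<open>1 \<le> p\<close>])
      show "s * (1 - 1 / p) < 1" using s by (intro less_conjugate_index[OF pq])
    qed (use H n \<omega> s in auto)
  next
    fix U :: "'a set" and \<beta> :: real
    assume U: "symmetric_generating_set G U" "polynomial_growth G U"
      and \<beta>: "0 < \<beta>" "ereal (real (growth_order G U)) / q < ereal \<beta>"
      and \<omega>: "\<forall>x\<in>carrier G. \<omega> x = (1 + real (word_length G U x)) powr \<beta>"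
    show ?thesis
    proof (rule norm_controlled_inversion_polynomial_weight[OF \<open>weight_on G \<omega>\<close> \<open>1 \<le> p\<close> U])
      show "real (growth_order G U) * (1 - 1 / p) < \<beta>"
        using \<beta>(2) by (simp add: divide_conjugate_index[OF pq])
    qed (use \<beta> \<omega> in auto)
  next
    fix U :: "'a set" and \<alpha> C :: real
    assume U: "symmetric_generating_set G U" "polynomial_growth G U"
      and \<alpha>: "0 < \<alpha>" "\<alpha> < 1" and C: "0 < C"
      and \<omega>: "\<forall>x\<in>carrier G. \<omega> x = exp (C * real (word_length G U x) powr \<alpha>)"
    show ?thesis
    proof (rule norm_controlled_inversion_subexponential_weight[OF \<open>weight_on G \<omega>\<close> \<open>1 \<le> p\<close> U(1)])
      \<comment> \<open>Polynomial growth admits every positive exponent;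
        \<open>\<alpha> / 2\<close> is one below \<open>\<alpha>\<close>.\<close>
      show "growth_bounded_by_exp_powr G U (\<alpha> / 2)"
        using U(2) \<alpha> by (intro polynomial_growth_bounded_by_exp_powr) auto
    qed (use \<alpha> C \<omega> in auto)
  next
    fix U :: "'a set" and \<alpha>\<^sub>0 \<alpha> C :: real
    assume U: "symmetric_generating_set G U" "growth_bounded_by_exp_powr G U \<alpha>\<^sub>0"
      and \<alpha>: "0 < \<alpha>\<^sub>0" "\<alpha>\<^sub>0 < \<alpha>" "\<alpha> < 1" and C: "0 < C"
      and \<omega>: "\<forall>x\<in>carrier G. \<omega> x = exp (C * real (word_length G U x) powr \<alpha>)"
    show ?thesis
      by (rule norm_controlled_inversion_subexponential_weight[OF \<open>weight_on G \<omega>\<close> \<open>1 \<le> p\<close> U \<alpha> C])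
        (use \<omega> in auto)
  qed
qed

end
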